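(* Let $M,N\ge 0$ be integers, not both zero. Let $Z(u)=1+Z^{(2)}u^{-2}+Z^{(3)}u^{-3}+\cdots$ be the formal power series in $u^{-1}$ with coefficients in $\mathrm{Y}(\mathfrak{gl}_{M|N})$ determined by the identities $\sum_{k=1}^{M+N}T_{kj}(u+M-N)\,T'_{ik}(u)=\delta_{ij}Z(u)$ for all $i,j=1,\dots,M+N$. Then the elements $Z^{(2)},Z^{(3)},\dots$ are free generators of the centre of $\mathrm{Y}(\mathfrak{gl}_{M|N})$; that is, they are algebraically independent and generate the centre as a unital algebra.
   Context: All algebras are over $\mathbb{C}$. For $i=1,\dots,M+N$ put $\bar\imath=0$ if $i\le M$ and $\bar\imath=1$ if $i>M$. Tensor products of $\mathbb{Z}_2$-graded algebras use $(X\otimes Y)(X'\otimes Y')=XX'\otimes YY'\,(-1)^{\deg X'\deg Y}$ for homogeneous elements. Square brackets denote the supercommutator $[X,Y]=XY-(-1)^{\deg X\deg Y}YX$. An element is called central if it supercommutes with every element of the algebra, and the centre is the set of central elements. The Yangian $\mathrm{Y}(\mathfrak{gl}_{M|N})$ is the unital associative $\mathbb{Z}_2$-graded algebra with generators $T_{ij}^{(r)}$ ($r\ge 1$, $1\le i,j\le M+N$), $\deg T_{ij}^{(r)}=\bar\imath+\bar\jmath$, and defining relations, for all $i,j,k,l$, $$(u-v)\,[T_{ij}(u),T_{kl}(v)]\,(-1)^{\bar\imath\bar k+\bar\imath\bar l+\bar k\bar l}=T_{kj}(u)T_{il}(v)-T_{kj}(v)T_{il}(u),$$ where $T_{ij}(u)=\delta_{ij}\cdot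 1+T_{ij}^{(1)}u^{-1}+T_{ij}^{(2)}u^{-2}+\cdots$ and $u,v$ are formal variables. Let $E_{ij}$ (degree $\bar\imath+\bar\jmath$) be the standard matrix units of $\mathrm{End}\,\mathbb{C}^{M|N}$ and $T(u)=\sum_{i,j}E_{ij}\otimes T_{ij}(u)\in(\mathrm{End}\,\mathbb{C}^{M|N})\otimes\mathrm{Y}(\mathfrak{gl}_{M|N})[[u^{-1}]]$. The series $T'_{ij}(u)$ are defined by $T(u)^{-1}=\sum_{i,j}E_{ij}\otimes T'_{ij}(u)$. Series in shifted variables such as $T_{ij}(u+M-N)$ are re-expanded in powers of $u^{-1}$. A series $Z(u)$ satisfying the displayed identities exists, is unique, has leading term $1$, zero coefficient at $u^{-1}$ and central coefficients. *)

theory Defs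
  imports Complex_Main "HOL-Algebra.QuotRing" "HOL-Algebra.Module" "HOL-Library.Poly_Mapping"
begin

section \<open>Complex superalgebras\<close>

text \<open>
  A superalgebra is an algebra over the complex numbers together with the projections
  \<open>hpart A 0\<close> and \<open>hpart A 1\<close> onto its even and odd components.  Parities are the numbers 0 and 1.
\<close>

record 'a superalg = "(complex, 'a) module" +
  hpart :: "nat \<Rightarrow> 'a \<Rightarrow> 'a"

text \<open>
  The supercommutator \<open>X Y - (-1)^(deg X deg Y) Y X\<close> of homogeneous elements, extended bilinearly.
\<close>

definition supercomm :: "('a, 'm) superalg_scheme \<Rightarrow> 'a \<Rightarrow> 'a \<Rightarrow> 'a" where
  "supercomm A x y =
     (\<Oplus>\<^bsub>A\<^esub>p\<in>{0, 1}. \<Oplus>\<^bsub>A\<^esub>q\<in>{0, 1}.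
        (hpart A p x \<otimes>\<^bsub>A\<^esub> hpart A q y) \<ominus>\<^bsub>A\<^esub>
        ((- 1) ^ (p * q) \<odot>\<^bsub>A\<^esub> (hpart A q y \<otimes>\<^bsub>A\<^esub> hpart A p x)))"

definition supercentre :: "('a, 'm) superalg_scheme \<Rightarrow> 'a set" where
  "supercentre A = {x \<in> carrier A. \<forall>y\<in>carrier A. supercomm A x y = \<zero>\<^bsub>A\<^esub>}"

text \<open>
  Multiplication and scalar action on cosets are defined as in \<^const>\<open>FactRing\<close>.  The induced
  projections are well defined whenever the two-sided ideal \<open>I\<close> is generated by homogeneous elements.
\<close>

definition quot_superalg :: "('a, 'm) superalg_scheme \<Rightarrow> 'a set \<Rightarrow> 'a set superalg" where
  "quot_superalg A I =
     \<lparr>carrier = carrier (A Quot I),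
      mult = mult (A Quot I),
      one = one (A Quot I),
      zero = zero (A Quot I),
      add = add (A Quot I),
      smult = (\<lambda>c X. \<Union>x\<in>X. I +>\<^bsub>A\<^esub> (c \<odot>\<^bsub>A\<^esub> x)),
      hpart = (\<lambda>p X. \<Union>x\<in>X. I +>\<^bsub>A\<^esub> hpart A p x)\<rparr>"

definition unital_subalgebra :: "'a set \<Rightarrow> ('a, 'm) superalg_scheme \<Rightarrow> bool" where
  "unital_subalgebra B A \<longleftrightarrow>
     B \<subseteq> carrier A \<and> \<zero>\<^bsub>A\<^esub> \<in> B \<and> \<one>\<^bsub>A\<^esub> \<in> B \<and>
     (\<forall>x\<in>B. \<forall>y\<in>B. x \<oplus>\<^bsub>A\<^esub> y \<in> B \<and> x \<otimes>\<^bsub>A\<^esub> y \<in> B) \<and>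
     (\<forall>c. \<forall>x\<in>B. c \<odot>\<^bsub>A\<^esub> x \<in> B)"

definition generated_subalgebra :: "('a, 'm) superalg_scheme \<Rightarrow> 'a set \<Rightarrow> 'a set" where
  "generated_subalgebra A S = \<Inter>{B. unital_subalgebra B A \<and> S \<subseteq> B}"

text \<open>
  Polynomials over the complex numbers in variables indexed by the natural numbers are finitely
  supported functions on monomials, and monomials are finitely supported exponent functions.  They
  are evaluated at families of elements of a ring that need not be commutative, so the factors of a
  monomial are multiplied in increasing order of the index.  Algebraic independence includes that
  the family commutes, so this order does not matter there.
\<close>

definition eval_monomial :: "('a, 'm) superalg_scheme \<Rightarrow> (nat \<Rightarrow> 'a) \<Rightarrow> (nat \<Rightarrow>\<^sub>0 nat) \<Rightarrow> 'a" where
  "eval_monomial A z m =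
     foldr (\<lambda>r x. (z r [^]\<^bsub>A\<^esub> Poly_Mapping.lookup m r) \<otimes>\<^bsub>A\<^esub> x)
       (sorted_list_of_set (Poly_Mapping.keys m)) \<one>\<^bsub>A\<^esub>"

definition eval_poly ::
  "('a, 'm) superalg_scheme \<Rightarrow> (nat \<Rightarrow> 'a) \<Rightarrow> ((nat \<Rightarrow>\<^sub>0 nat) \<Rightarrow>\<^sub>0 complex) \<Rightarrow> 'a" where
  "eval_poly A z P =
     (\<Oplus>\<^bsub>A\<^esub>m\<in>Poly_Mapping.keys P. Poly_Mapping.lookup P m \<odot>\<^bsub>A\<^esub> eval_monomial A z m)"

definition alg_independent :: "('a, 'm) superalg_scheme \<Rightarrow> (nat \<Rightarrow> 'a) \<Rightarrow> nat set \<Rightarrow> bool" where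
  "alg_independent A z J \<longleftrightarrow>
     (\<forall>r\<in>J. \<forall>s\<in>J. z r \<otimes>\<^bsub>A\<^esub> z s = z s \<otimes>\<^bsub>A\<^esub> z r) \<and>
     (\<forall>P. (\<forall>m\<in>Poly_Mapping.keys P. Poly_Mapping.keys m \<subseteq> J) \<longrightarrow>
        eval_poly A z P = \<zero>\<^bsub>A\<^esub> \<longrightarrow> P = 0)"

section \<open>Formal power series\<close>

text \<open>
  A power series in \<open>1/u\<close> with coefficients in \<open>A\<close> is a function on the natural numbers whose value
  at \<open>n\<close> is the coefficient of \<open>u^(-n)\<close>.
\<close>

definition series_mult ::
  "('a, 'm) superalg_scheme \<Rightarrow> (nat \<Rightarrow> 'a) \<Rightarrow> (nat \<Rightarrow> 'a) \<Rightarrow> nat \<Rightarrow> 'a" where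
  "series_mult A f g n = (\<Oplus>\<^bsub>A\<^esub>m\<in>{..n}. f m \<otimes>\<^bsub>A\<^esub> g (n - m))"

text \<open>
  The series \<open>f(u + c)\<close>, re-expanded in \<open>1/u\<close> by the binomial formula
  \<open>(u + c)^(-r) = (\<Sum>k. (-r gchoose k) * c^k * u^(-r-k))\<close>.
\<close>

definition series_shift ::
  "('a, 'm) superalg_scheme \<Rightarrow> complex \<Rightarrow> (nat \<Rightarrow> 'a) \<Rightarrow> nat \<Rightarrow> 'a" where
  "series_shift A c f n =
     (\<Oplus>\<^bsub>A\<^esub>r\<in>{..n}. (((- of_nat r) gchoose (n - r)) * c ^ (n - r)) \<odot>\<^bsub>A\<^esub> f r)"

section \<open>The Yangian\<close>

definition parity :: "nat \<Rightarrow> nat \<Rightarrow> nat" where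
  "parity M i = (if i \<le> M then 0 else 1)"

text \<open>
  The letter \<open>(i, j, r)\<close> stands for the generator \<open>T\<^sub>i\<^sub>j\<close> with upper index \<open>r\<close>.  Words form the free
  monoid, written additively so that \<^typ>\<open>'w \<Rightarrow>\<^sub>0 complex\<close> carries the monoid algebra structure of
  \<^theory>\<open>HOL-Library.Poly_Mapping\<close>.
\<close>

type_synonym letter = "nat \<times> nat \<times> nat"

datatype gen_word = GWord (letters: "letter list")

instantiation gen_word :: monoid_add
begin

definition zero_gen_word :: gen_word where "0 = GWord []"

definition plus_gen_word :: "gen_word \<Rightarrow> gen_word \<Rightarrow> gen_word" where
  "v + w = GWord (letters v @ letters w)"

instance
  by standard (simp_all add: zero_gen_word_def plus_gen_word_def)

end

type_synonym free_elem = "gen_word \<Rightarrow>\<^sub>0 complex"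

definition yangian_letters :: "nat \<Rightarrow> nat \<Rightarrow> letter set" where
  "yangian_letters M N = {1..M + N} \<times> {1..M + N} \<times> {1..}"

definition word_parity :: "nat \<Rightarrow> gen_word \<Rightarrow> nat" where
  "word_parity M w = (\<Sum>(i, j, r)\<leftarrow>letters w. parity M i + parity M j) mod 2"

definition free_superalg :: "nat \<Rightarrow> nat \<Rightarrow> free_elem superalg" where
  "free_superalg M N =
     \<lparr>carrier = {x. \<forall>w\<in>Poly_Mapping.keys x. set (letters w) \<subseteq> yangian_letters M N},
      mult = (*),
      one = 1,
      zero = 0,
      add = (+),
      smult = (\<lambda>c x. Poly_Mapping.single 0 c * x),
      hpart = (\<lambda>p x. \<Sum>w\<in>{w \<in> Poly_Mapping.keys x. word_parity M w = p}.
        Poly_Mapping.single w (Poly_Mapping.lookup x w))\<rparr>"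

text \<open>
  The coefficient of \<open>u^(-r)\<close> in \<open>T\<^sub>i\<^sub>j(u)\<close>, for every integer \<open>r\<close>.
\<close>

definition free_T :: "nat \<Rightarrow> nat \<Rightarrow> int \<Rightarrow> free_elem" where
  "free_T i j r =
     (if r < 0 then 0
      else if r = 0 then (if i = j then 1 else 0)
      else Poly_Mapping.single (GWord [(i, j, nat r)]) 1)"

text \<open>
  The difference of the coefficients of \<open>u^(-r) v^(-s)\<close> in the two sides of the defining relation.
  Multiplying a series in \<open>1/u\<close> and \<open>1/v\<close> with coefficients \<open>a(r, s)\<close> by \<open>u - v\<close> gives the
  coefficients \<open>a(r + 1, s) - a(r, s + 1)\<close>; here \<open>r\<close> and \<open>s\<close> may be \<open>-1\<close>.
\<close>

definition yangian_relator ::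
  "nat \<Rightarrow> nat \<Rightarrow> nat \<Rightarrow> nat \<Rightarrow> nat \<Rightarrow> nat \<Rightarrow> int \<Rightarrow> int \<Rightarrow> free_elem" where
  "yangian_relator M N i j k l r s =
     (let A = free_superalg M N in
      Poly_Mapping.single 0
        ((- 1) ^ (parity M i * parity M k + parity M i * parity M l + parity M k * parity M l)) *
        (supercomm A (free_T i j (r + 1)) (free_T k l s) -
         supercomm A (free_T i j r) (free_T k l (s + 1)))
      - (free_T k j r * free_T i l s - free_T k j s * free_T i l r))"

text \<open>Ideals in \<^const>\<open>genideal\<close> are two-sided.\<close>

definition yangian_ideal :: "nat \<Rightarrow> nat \<Rightarrow> free_elem set" where
  "yangian_ideal M N =
     Idl\<^bsub>free_superalg M N\<^esub>
       {yangian_relator M N i j k l r s | i j k l r s.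
          {i, j, k, l} \<subseteq> {1..M + N}}"

definition yangian :: "nat \<Rightarrow> nat \<Rightarrow> free_elem set superalg" where
  "yangian M N = quot_superalg (free_superalg M N) (yangian_ideal M N)"

definition yangian_T :: "nat \<Rightarrow> nat \<Rightarrow> nat \<Rightarrow> nat \<Rightarrow> nat \<Rightarrow> free_elem set" where
  "yangian_T M N i j r = yangian_ideal M N +>\<^bsub>free_superalg M N\<^esub> free_T i j (int r)"

section \<open>Series with coefficients in the graded tensor product\<close>

text \<open>
  A function \<open>X\<close> represents the series \<open>\<Sum>i j n. E\<^sub>i\<^sub>j \<otimes> X i j n * u^(-n)\<close> with coefficients in the
  graded tensor product of \<open>End \<complex>\<^sup>M\<^sup>|\<^sup>N\<close> and \<open>A\<close>.  In this algebra
  \<open>(E\<^sub>i\<^sub>k \<otimes> x) (E\<^sub>k\<^sub>j \<otimes> y) = (-1)^(deg x (k + j)) E\<^sub>i\<^sub>j \<otimes> x y\<close> for homogeneous \<open>x\<close>, where \<open>k + j\<close>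
  abbreviates the parity of \<open>E\<^sub>k\<^sub>j\<close>.
\<close>

definition tensor_mult ::
  "nat \<Rightarrow> nat \<Rightarrow> ('a, 'm) superalg_scheme \<Rightarrow> (nat \<Rightarrow> nat \<Rightarrow> nat \<Rightarrow> 'a) \<Rightarrow>
   (nat \<Rightarrow> nat \<Rightarrow> nat \<Rightarrow> 'a) \<Rightarrow> nat \<Rightarrow> nat \<Rightarrow> nat \<Rightarrow> 'a" where
  "tensor_mult M N A X Y i j n =
     (\<Oplus>\<^bsub>A\<^esub>k\<in>{1..M + N}. \<Oplus>\<^bsub>A\<^esub>p\<in>{0, 1}.
        (- 1) ^ (p * (parity M k + parity M j)) \<odot>\<^bsub>A\<^esub>
          series_mult A (\<lambda>m. hpart A p (X i k m)) (Y k j) n)"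

definition tensor_one :: "('a, 'm) superalg_scheme \<Rightarrow> nat \<Rightarrow> nat \<Rightarrow> nat \<Rightarrow> 'a" where
  "tensor_one A i j n = (if i = j \<and> n = 0 then \<one>\<^bsub>A\<^esub> else \<zero>\<^bsub>A\<^esub>)"

definition tensor_inverse ::
  "nat \<Rightarrow> nat \<Rightarrow> ('a, 'm) superalg_scheme \<Rightarrow> (nat \<Rightarrow> nat \<Rightarrow> nat \<Rightarrow> 'a) \<Rightarrow>
   (nat \<Rightarrow> nat \<Rightarrow> nat \<Rightarrow> 'a) \<Rightarrow> bool" where
  "tensor_inverse M N A X Y \<longleftrightarrow>
     (\<forall>i\<in>{1..M + N}. \<forall>j\<in>{1..M + N}. \<forall>n.
        Y i j n \<in> carrier A \<and>
        tensor_mult M N A X Y i j n = tensor_one A i j n \<and>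
        tensor_mult M N A Y X i j n = tensor_one A i j n)"

text \<open>The identities that determine \<open>Z(u)\<close>, with \<open>T'\<close> the matrix of series of the inverse of \<open>T(u)\<close>.\<close>

definition Z_identities ::
  "nat \<Rightarrow> nat \<Rightarrow> (nat \<Rightarrow> nat \<Rightarrow> nat \<Rightarrow> free_elem set) \<Rightarrow> (nat \<Rightarrow> free_elem set) \<Rightarrow> bool" where
  "Z_identities M N T' Z \<longleftrightarrow>
     (\<forall>i\<in>{1..M + N}. \<forall>j\<in>{1..M + N}. \<forall>n.
        (\<Oplus>\<^bsub>yangian M N\<^esub>k\<in>{1..M + N}.
           series_mult (yangian M N)
             (series_shift (yangian M N) (of_nat M - of_nat N) (yangian_T M N k j)) (T' i k) n)
        = (if i = j then Z n else \<zero>\<^bsub>yangian M N\<^esub>))"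

end

theory Submission
  imports Defs "HOL-Computational_Algebra.Formal_Power_Series" "HOL-Computational_Algebra.Polynomial"
    "HOL-Library.Multiset"
begin

text \<open>
  Let the Yangian act on tensor powers of the unitization of the current superalgebra
  \<open>gl(M|N)[z]\<close>: on one factor \<open>T\<^sub>i\<^sub>j\<close> with upper index \<open>q + 1\<close> acts as left multiplication by
  \<open>E\<^sub>i\<^sub>j z^q\<close>, and the coproduct gives the action on several factors.  Filter by the degree, which is
  \<open>r - 1\<close> for a generator with upper index \<open>r\<close>, and then by the length of words.  Applied to the
  vacuum of the \<open>p\<close>-th power, an element of length \<open>p\<close> yields in top degree its symmetrized symbol,
  so an element vanishes iff it vanishes in all these representations.

  On one factor the inverse series and \<open>Z(u)\<close> are explicit, and \<open>Z(u)\<close> acts on a tensor power as the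
  product of its actions on the factors.  It follows that the coefficients of \<open>Z(u)\<close> are central and
  that, up to the factor \<open>-(r + 1)\<close>, the leading term of \<open>Z\<close> with index \<open>r + 2\<close> is the supertrace of
  the generators with upper index \<open>r + 1\<close>.

  Multiplying a central element by \<open>T\<^sub>k\<^sub>l\<close> of large degree, before the action on the vacuum, is the
  same in top degree as multiplying by \<open>E\<^sub>k\<^sub>l z^t\<close> on the right in each factor; hence the symbol
  commutes with \<open>gl(M|N)\<close> in each position separately.  So it is a polynomial in the supertraces, and
  subtracting the corresponding polynomial in the \<open>Z\<close> lowers the filtration.  Distinct monomials in
  the \<open>Z\<close> are independent because their symbols at words in \<open>T\<^sub>1\<^sub>1\<close> are.
\<close>

text \<open>The adjoined unit provides a vacuum on which every generator leaves its own letter, so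
  words can be read off states and linear independence of symbols is proved along the way. Degree
  alone would leave the noncommutative enveloping algebra of the current superalgebra as associated
  graded algebra; ordering by length within each degree makes letters supercommute, and symmetrized
  coefficient functions take the place of ordered monomials.

  The one-site formulas come from a contraction: the matrix of generators times itself is
  \<open>M - N\<close> times itself. With z as parameter, T(u) = 1 + E/(u - z) has the inverse 1 -
  E/(u - z + M - N). Shifting u by \<open>M - N\<close> aligns the denominators, and Z(u) = 1 - I/(u
  - z + M - N)^2; the square is the origin of the factor \<open>-(r + 1)\<close>.

  For \<open>M = N\<close> the algebra gl does not split into traceless and scalar matrices. Testing
  one tensor position at a time turns centrality into commutation of that position with all matrix
  units, which forces a scalar matrix in every case.\<close>

unbundle fps_syntax

section \<open>Linear operators on spaces of functions\<close>

text \<open>A type instead of a carrier set makes the linear operators an instance of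
  \<open>ring_1\<close>, over which power series are available. The functions are arbitrary, so no
  finiteness of supports has to be maintained; the single identity encodes both additivity and
  homogeneity.\<close>

typedef 's endo =
  "{f :: ('s \<Rightarrow> complex) \<Rightarrow> 's \<Rightarrow> complex. \<forall>c g h. f (\<lambda>s. c * g s + h s) = (\<lambda>s. c * f g s + f h s)}"
  morphisms app Endo
  by (rule exI[of _ "\<lambda>f. f"]) simp

setup_lifting type_definition_endo

lemma app_linear: "app X (\<lambda>s. c * g s + h s) = (\<lambda>s. c * app X g s + app X h s)"
  using app[of X] by blast

lemma app_add: "app X (\<lambda>s. g s + h s) = (\<lambda>s. app X g s + app X h s)"
  using app_linear[of X 1 g h] by simp

lemma app_zero [simp]: "app X (\<lambda>s. 0) = (\<lambda>s. 0)"
  using app_linear[of X "-1" "\<lambda>s. 0" "\<lambda>s. 0"] by simp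

lemma app_scale: "app X (\<lambda>s. c * g s) = (\<lambda>s. c * app X g s)"
  using app_linear[of X c g "\<lambda>s. 0"] by simp

lemma endo_eqI: "(\<And>f s. app X f s = app Y f s) \<Longrightarrow> X = Y"
  by (metis app_inject ext)

instantiation endo :: (type) ring_1
begin

lift_definition zero_endo :: "'a endo" is "\<lambda>f s. 0" by simp
lift_definition one_endo :: "'a endo" is "\<lambda>f. f" by simp
lift_definition plus_endo :: "'a endo \<Rightarrow> 'a endo \<Rightarrow> 'a endo" is "\<lambda>X Y f s. X f s + Y f s"
  by (auto simp: algebra_simps)
lift_definition minus_endo :: "'a endo \<Rightarrow> 'a endo \<Rightarrow> 'a endo" is "\<lambda>X Y f s. X f s - Y f s"
  by (auto simp: algebra_simps)
lift_definition uminus_endo :: "'a endo \<Rightarrow> 'a endo" is "\<lambda>X f s. - X f s"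
  by (auto simp: algebra_simps)
lift_definition times_endo :: "'a endo \<Rightarrow> 'a endo \<Rightarrow> 'a endo" is "\<lambda>X Y f. X (Y f)"
  by auto

instance
proof
  fix X Y Z :: "'a endo"
  show "X * (Y + Z) = X * Y + X * Z"
    by (rule endo_eqI) (simp add: times_endo.rep_eq plus_endo.rep_eq app_add)
  show "(0 :: 'a endo) \<noteq> 1"
  proof
    assume "(0 :: 'a endo) = 1"
    then have "app (0 :: 'a endo) (\<lambda>s. 1) = app 1 (\<lambda>s. 1)" by simp
    then show False by (auto simp: zero_endo.rep_eq one_endo.rep_eq fun_eq_iff)
  qed
qed (rule endo_eqI;
     simp add: times_endo.rep_eq plus_endo.rep_eq minus_endo.rep_eq uminus_endo.rep_eq
       zero_endo.rep_eq one_endo.rep_eq algebra_simps)+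

end

text \<open>Complex scalars enter the ring as central operators, so that all computations stay in
  the class \<open>ring_1\<close>.\<close>

lift_definition cs :: "complex \<Rightarrow> 's endo" is "\<lambda>c f s. c * f s"
  by (auto simp: algebra_simps)

lemmas app_simps = times_endo.rep_eq plus_endo.rep_eq minus_endo.rep_eq uminus_endo.rep_eq
  zero_endo.rep_eq one_endo.rep_eq cs.rep_eq

lemma cs_0 [simp]: "cs 0 = 0" and cs_1 [simp]: "cs 1 = 1"
  by (rule endo_eqI; simp add: app_simps)+

lemma cs_add: "cs (a + b) = cs a + cs b" and cs_mult: "cs (a * b) = cs a * cs b"
  and cs_minus: "cs (- a) = - cs a" and cs_diff: "cs (a - b) = cs a - cs b"
  by (rule endo_eqI; simp add: app_simps algebra_simps)+

lemma cs_power: "cs (a ^ n) = cs a ^ n"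
  by (induction n) (simp_all add: cs_mult)

lemma cs_sum: "cs (sum f A) = (\<Sum>a\<in>A. cs (f a))"
  by (induction A rule: infinite_finite_induct) (simp_all add: cs_add)

lemma cs_of_nat: "cs (of_nat n) = of_nat n"
  by (induction n) (simp_all add: cs_add)

lemma cs_sign: "cs ((- 1) ^ n) = (- 1) ^ n"
  by (simp add: cs_power cs_minus)

lemma cs_commute: "cs c * X = X * cs c"
  by (rule endo_eqI) (simp add: app_simps app_scale)

lemma cs_commute_left: "X * (cs c * Y) = cs c * (X * Y)"
  by (metis cs_commute mult.assoc)

lemma app_sum: "app (sum X A) f s = (\<Sum>a\<in>A. app (X a) f s)"
  by (induction A rule: infinite_finite_induct) (simp_all add: app_simps)

lemma app_sign: "app ((- 1) ^ n * X) f s = (- 1) ^ n * app X f s"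
  by (simp add: cs_sign[symmetric] app_simps)

lemma app_sign_alone: "app ((- 1) ^ n) f = (\<lambda>s. (- 1) ^ n * f s)"
  by (simp add: cs_sign[symmetric] cs.rep_eq)

lemma sign_commute: "(- 1) ^ n * X = X * (- 1 :: 'a :: ring_1) ^ n"
  by (induction n) simp_all

lemma sign_commute_left: "X * ((- 1) ^ n * Y) = (- 1 :: 'a :: ring_1) ^ n * (X * Y)"
  by (metis sign_commute mult.assoc)

lemma sign_square: "(- 1) ^ n * ((- 1 :: 'a :: ring_1) ^ n * X) = X"
  by (cases "even n") auto

section \<open>Tensor powers of a unitized current algebra\<close>

lemma parity_eq_cases:
  obtains "parity M i = 0" | "parity M i = 1"
  by (cases "i \<le> M") (simp_all add: parity_def)

text \<open>
  A state assigns to each site of an infinite tensor power a basis vector: \<open>Some (i, j, q)\<close> is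
  \<open>E\<^sub>i\<^sub>j z^q\<close> and \<open>None\<close> is the adjoined unit.  Operators act on coefficient functions, so \<open>site_op\<close>
  lists the basis vectors that are mapped to a given one.
\<close>

type_synonym state = "nat \<Rightarrow> letter option"

definition lpar :: "nat \<Rightarrow> letter \<Rightarrow> nat" where
  "lpar M x = (case x of (i, j, q) \<Rightarrow> parity M i + parity M j)"

definition opar :: "nat \<Rightarrow> letter option \<Rightarrow> nat" where
  "opar M o' = (case o' of None \<Rightarrow> 0 | Some x \<Rightarrow> lpar M x)"

definition spar :: "nat \<Rightarrow> state \<Rightarrow> nat \<Rightarrow> nat" where
  "spar M s k = (\<Sum>l<k. opar M (s l))"

text \<open>The sign comes from moving an operator of parity \<open>\<pi>\<close> past the sites
  left of \<open>k\<close>. The case \<open>Some x\<close> is the creation of \<open>x\<close> from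
  the adjoined unit; \<open>c\<close> and \<open>\<sigma>\<close> give the coefficient and the only
  source among the letters. Left and right multiplication are both of this form, so operators on
  different sites are compared only once.\<close>

lift_definition site_op ::
  "nat \<Rightarrow> nat \<Rightarrow> nat \<Rightarrow> letter \<Rightarrow> (letter option \<Rightarrow> complex) \<Rightarrow> (letter option \<Rightarrow> letter option) \<Rightarrow> state endo" is
  "\<lambda>M k \<pi> x c \<sigma> f s. (- 1) ^ (\<pi> * spar M s k) *
     ((if s k = Some x then f (s(k := None)) else 0) + c (s k) * f (s(k := \<sigma> (s k))))"
  by (auto simp: algebra_simps)

lemma spar_upd_le [simp]: "k \<le> l \<Longrightarrow> spar M (s(l := b)) k = spar M s k"
  by (auto simp: spar_def intro!: sum.cong)

lemma spar_upd_less: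
  assumes "k < l"
  shows "spar M (s(k := b)) l + opar M (s k) = spar M s l + opar M b"
proof -
  have *: "sum g {..<l} = g k + sum g ({..<l} - {k})" for g :: "nat \<Rightarrow> nat"
    using assms by (simp add: sum.remove)
  show ?thesis
    unfolding spar_def *[of "\<lambda>l. opar M ((s(k := b)) l)"] *[of "\<lambda>l. opar M (s l)"] by simp
qed

lemma sign_cong: "even (a + b) \<Longrightarrow> (- 1 :: 'a :: ring_1) ^ a = (- 1) ^ b"
  by (cases "even a"; cases "even b") (auto simp: minus_one_power_iff)

text \<open>The operator on the left site changes the parity of that site by \<open>\<pi>\<close>,
  and this parity enters the sign of the operator on the right site. The converse influence is
  absent, which leaves the single sign with exponent \<open>\<pi> * \<pi>'\<close>.\<close>

lemma site_op_supercommute_less: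
  assumes "k < l"
    and "lpar M x = \<pi>" and "\<And>b. c b \<noteq> 0 \<Longrightarrow> even (opar M b + opar M (\<sigma> b) + \<pi>)"
    and "lpar M x' = \<pi>'" and "\<And>b. c' b \<noteq> 0 \<Longrightarrow> even (opar M b + opar M (\<sigma>' b) + \<pi>')"
  shows "site_op M k \<pi> x c \<sigma> * site_op M l \<pi>' x' c' \<sigma>' =
    (- 1) ^ (\<pi> * \<pi>') * (site_op M l \<pi>' x' c' \<sigma>' * site_op M k \<pi> x c \<sigma>)"
proof (rule endo_eqI, unfold app_sign)
  fix f s
  have sg: "(- 1 :: complex) ^ (\<pi>' * spar M (s(k := b)) l) = (- 1) ^ (\<pi> * \<pi>') * (- 1) ^ (\<pi>' * spar M s l)"
    if "even (opar M (s k) + opar M b + \<pi>)" for b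
  proof -
    have "even (spar M (s(k := b)) l + (\<pi> + spar M s l))"
    proof -
      have eq: "spar M (s(k := b)) l + (\<pi> + spar M s l) + 2 * opar M (s k) =
          2 * spar M s l + (opar M (s k) + opar M b + \<pi>)"
        using spar_upd_less[OF assms(1), of M s b] by linarith
      have "even (2 * spar M s l + (opar M (s k) + opar M b + \<pi>))"
        by (rule dvd_add[OF dvd_triv_left that])
      then have "even (spar M (s(k := b)) l + (\<pi> + spar M s l) + 2 * opar M (s k))"
        unfolding eq .
      then show ?thesis by (metis dvd_add_left_iff dvd_triv_left)
    qed
    then have "even (\<pi>' * (spar M (s(k := b)) l + (\<pi> + spar M s l)))" by simp
    then have "even (\<pi>' * spar M (s(k := b)) l + (\<pi> * \<pi>' + \<pi>' * spar M s l))"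
      by (simp add: algebra_simps)
    then show ?thesis using sign_cong by (metis power_add)
  qed
  have sg1: "(- 1 :: complex) ^ (\<pi>' * spar M (s(k := None)) l) = (- 1) ^ (\<pi> * \<pi>') * (- 1) ^ (\<pi>' * spar M s l)"
    if "s k = Some x"
    by (rule sg) (use that assms(2) in \<open>simp add: opar_def\<close>)
  have sg2: "(- 1 :: complex) ^ (\<pi>' * spar M (s(k := \<sigma> (s k))) l) = (- 1) ^ (\<pi> * \<pi>') * (- 1) ^ (\<pi>' * spar M s l)"
    if "c (s k) \<noteq> 0"
    by (rule sg) (use that assms(3) in simp)
  have tw: "s(k := a, l := b) = s(l := b, k := a)" for a b
    using assms(1) by (auto simp: fun_upd_twist)
  have neq: "k \<noteq> l" "l \<noteq> k" "k \<le> l" using assms(1) by auto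
  define B where "B b = (if s l = Some x' then f (s(l := None, k := b)) else 0) +
      c' (s l) * f (s(l := \<sigma>' (s l), k := b))" for b
  define e :: complex where "e = (- 1) ^ (\<pi> * \<pi>') * (- 1) ^ (\<pi>' * spar M s l)"
  have inner: "app (site_op M l \<pi>' x' c' \<sigma>') f (s(k := b)) = (- 1) ^ (\<pi>' * spar M (s(k := b)) l) * B b" for b
    using neq by (simp add: site_op.rep_eq B_def tw)
  have 1: "(if s k = Some x then app (site_op M l \<pi>' x' c' \<sigma>') f (s(k := None)) else 0) =
      e * (if s k = Some x then B None else 0)"
    using sg1 by (simp add: inner e_def)
  have 2: "c (s k) * app (site_op M l \<pi>' x' c' \<sigma>') f (s(k := \<sigma> (s k))) = e * (c (s k) * B (\<sigma> (s k)))"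
    using sg2 by (cases "c (s k) = 0") (simp_all add: inner e_def)
  have 3: "app (site_op M k \<pi> x c \<sigma> * site_op M l \<pi>' x' c' \<sigma>') f s =
      (- 1) ^ (\<pi> * spar M s k) * (e * ((if s k = Some x then B None else 0) + c (s k) * B (\<sigma> (s k))))"
    unfolding times_endo.rep_eq site_op.rep_eq[of M k] 1 2 by (simp only: distrib_left)
  have outer: "app (site_op M k \<pi> x c \<sigma>) f (s(l := b)) = (- 1) ^ (\<pi> * spar M s k) *
     ((if s k = Some x then f (s(l := b, k := None)) else 0) + c (s k) * f (s(l := b, k := \<sigma> (s k))))" for b
    using neq by (simp add: site_op.rep_eq)
  have 4: "app (site_op M l \<pi>' x' c' \<sigma>' * site_op M k \<pi> x c \<sigma>) f s = (- 1) ^ (\<pi>' * spar M s l) *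
     ((- 1) ^ (\<pi> * spar M s k) * ((if s k = Some x then B None else 0) + c (s k) * B (\<sigma> (s k))))"
    unfolding times_endo.rep_eq site_op.rep_eq[of M l] outer B_def
    by (cases "s k = Some x"; cases "s l = Some x'") (simp_all add: algebra_simps)
  show "app (site_op M k \<pi> x c \<sigma> * site_op M l \<pi>' x' c' \<sigma>') f s =
    (- 1) ^ (\<pi> * \<pi>') * app (site_op M l \<pi>' x' c' \<sigma>' * site_op M k \<pi> x c \<sigma>) f s"
    unfolding 3 4 e_def by (simp only: mult_ac)
qed

lemma site_op_supercommute:
  assumes "k \<noteq> l"
    and "lpar M x = \<pi>" and "\<And>b. c b \<noteq> 0 \<Longrightarrow> even (opar M b + opar M (\<sigma> b) + \<pi>)"
    and "lpar M x' = \<pi>'" and "\<And>b. c' b \<noteq> 0 \<Longrightarrow> even (opar M b + opar M (\<sigma>' b) + \<pi>')"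
  shows "site_op M k \<pi> x c \<sigma> * site_op M l \<pi>' x' c' \<sigma>' =
    (- 1) ^ (\<pi> * \<pi>') * (site_op M l \<pi>' x' c' \<sigma>' * site_op M k \<pi> x c \<sigma>)"
proof (cases "k < l")
  case True
  then show ?thesis using site_op_supercommute_less assms by blast
next
  case False
  then have "l < k" using assms(1) by simp
  from site_op_supercommute_less[OF this assms(4,5) assms(2,3)]
  show ?thesis by (simp add: sign_square mult.commute[of \<pi> \<pi>'])
qed

text \<open>The letter \<open>(i, j, q)\<close> is E_ij z^q up to the sign with exponent
  \<open>parity M i * parity M j\<close>. In this basis the product of the letters ij and je
  acquires exactly the sign below, which is the one of the defining relation. Consequently the
  supertrace of the letters of degree q is the identity matrix times z^q.\<close>

definition lcoef :: "nat \<Rightarrow> letter \<Rightarrow> letter option \<Rightarrow> complex" where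
  "lcoef M x b = (case (x, b) of ((i, j, q), Some (a, e, r)) \<Rightarrow>
     if a = i \<and> q \<le> r
     then (- 1) ^ (parity M i * parity M j + parity M i * parity M e + parity M j * parity M e) else 0
   | _ \<Rightarrow> 0)"

definition lsrc :: "letter \<Rightarrow> letter option \<Rightarrow> letter option" where
  "lsrc x b = (case (x, b) of ((i, j, q), Some (a, e, r)) \<Rightarrow> Some (j, e, r - q) | _ \<Rightarrow> None)"

text \<open>Right multiplication carries, besides the sign of the product, the sign for moving the
  multiplier past the letter it acts on. With this convention it supercommutes with left
  multiplication.\<close>

definition rcoef :: "nat \<Rightarrow> letter \<Rightarrow> letter option \<Rightarrow> complex" where
  "rcoef M x b = (case (x, b) of ((i, j, q), Some (a, e, r)) \<Rightarrow>
     if e = j \<and> q \<le> r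
     then (- 1) ^ ((parity M i + parity M j) * (parity M a + parity M i) +
       parity M a * parity M i + parity M a * parity M j + parity M i * parity M j) else 0
   | _ \<Rightarrow> 0)"

definition rsrc :: "letter \<Rightarrow> letter option \<Rightarrow> letter option" where
  "rsrc x b = (case (x, b) of ((i, j, q), Some (a, e, r)) \<Rightarrow> Some (a, i, r - q) | _ \<Rightarrow> None)"

definition lam :: "nat \<Rightarrow> nat \<Rightarrow> letter \<Rightarrow> state endo" where
  "lam M k x = site_op M k (lpar M x) x (lcoef M x) (lsrc x)"

definition rho :: "nat \<Rightarrow> nat \<Rightarrow> letter \<Rightarrow> state endo" where
  "rho M k x = site_op M k (lpar M x) x (rcoef M x) (rsrc x)"

lemma lcoef_parity: "lcoef M x b \<noteq> 0 \<Longrightarrow> even (opar M b + opar M (lsrc x b) + lpar M x)"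
  by (auto simp: lcoef_def lsrc_def opar_def lpar_def split: prod.splits option.splits if_splits)

lemma rcoef_parity: "rcoef M x b \<noteq> 0 \<Longrightarrow> even (opar M b + opar M (rsrc x b) + lpar M x)"
  by (auto simp: rcoef_def rsrc_def opar_def lpar_def split: prod.splits option.splits if_splits)

lemma lam_lam_commute:
  "k \<noteq> l \<Longrightarrow> lam M k x * lam M l y = (- 1) ^ (lpar M x * lpar M y) * (lam M l y * lam M k x)"
  unfolding lam_def by (rule site_op_supercommute) (assumption | rule refl | erule lcoef_parity)+

lemma site_op_None: "c None = 0 \<Longrightarrow> s k = None \<Longrightarrow> app (site_op M k \<pi> x c \<sigma>) f s = 0"
  by (simp add: site_op.rep_eq)

lemma lam_None: "s k = None \<Longrightarrow> app (lam M k x) f s = 0"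
  unfolding lam_def by (rule site_op_None) (simp_all add: lcoef_def)

lemma rho_None: "s k = None \<Longrightarrow> app (rho M k x) f s = 0"
  unfolding rho_def by (rule site_op_None) (simp_all add: rcoef_def split: prod.splits)

lemma lam_Some:
  "s k = Some (a, e, r) \<Longrightarrow> app (lam M k (i, j, q)) f s =
    (- 1) ^ ((parity M i + parity M j) * spar M s k) *
     ((if (a, e, r) = (i, j, q) then f (s(k := None)) else 0) +
      (if a = i \<and> q \<le> r
       then (- 1) ^ (parity M i * parity M j + parity M i * parity M e + parity M j * parity M e) *
         f (s(k := Some (j, e, r - q))) else 0))"
  by (auto simp: lam_def site_op.rep_eq lcoef_def lsrc_def lpar_def)

lemma rho_Some:
  "s k = Some (a, e, r) \<Longrightarrow> app (rho M k (i, j, q)) f s =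
    (- 1) ^ ((parity M i + parity M j) * spar M s k) *
     ((if (a, e, r) = (i, j, q) then f (s(k := None)) else 0) +
      (if e = j \<and> q \<le> r
       then (- 1) ^ ((parity M i + parity M j) * (parity M a + parity M i) +
         parity M a * parity M i + parity M a * parity M j + parity M i * parity M j) *
         f (s(k := Some (a, i, r - q))) else 0))"
  by (auto simp: rho_def site_op.rep_eq rcoef_def rsrc_def lpar_def)

text \<open>Associativity of the current superalgebra; on the adjoined unit the right factor creates
  its letter and the left factor multiplies it. Products at one site thus stay linear in the
  letters, which is why the one-site series can be written down explicitly.\<close>

lemma lam_mult:
  "lam M k (i, j, q) * lam M k (j', l, q') =
    (if j = j' then (- 1) ^ (parity M i * parity M j + parity M i * parity M l + parity M j * parity M l) *
       lam M k (i, l, q + q') else 0)"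
proof (rule endo_eqI)
  fix f s
  define P where "P = parity M i * parity M j + parity M i * parity M l + parity M j * parity M l"
  show "app (lam M k (i, j, q) * lam M k (j', l, q')) f s =
    app (if j = j' then (- 1) ^ P * lam M k (i, l, q + q') else 0) f s"
  proof (cases "s k")
    case None
    then show ?thesis by (cases "j = j'") (simp_all add: lam_None app_simps app_sign_alone)
  next
    case (Some x)
    obtain a e r where "x = (a, e, r)" by (cases x)
    with Some have sk: "s k = Some (a, e, r)" by simp
    define S where "S n = (- 1 :: complex) ^ (n * spar M s k)" for n :: nat
    have lam_upd: "app (lam M k (i, j, q)) h (s(k := Some (a, e, r))) = S (parity M i + parity M j) *
       ((if a = i \<and> e = j \<and> r = q then h (s(k := None)) else 0) +
        (if a = i \<and> q \<le> r
         then (- 1) ^ (parity M i * parity M j + parity M i * parity M e + parity M j * parity M e) *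
           h (s(k := Some (j, e, r - q))) else 0))" for h a e r i j q
      using lam_Some[of "s(k := Some (a, e, r))" k a e r M i j q h] by (simp add: S_def)
    have none: "app (lam M k (i, j, q)) h (s(k := None)) = 0" for h i j q
      by (simp add: lam_None)
    have idem: "s(k := Some (a, e, r)) = s" using sk by (simp add: fun_upd_idem)
    have lt: "app (lam M k (i, j, q) * lam M k (j', l, q')) f (s(k := Some (a, e, r))) =
        S (parity M i + parity M j) *
         (if a = i \<and> q \<le> r then
          (- 1) ^ (parity M i * parity M j + parity M i * parity M e + parity M j * parity M e) *
          (S (parity M j' + parity M l) * ((if j = j' \<and> e = l \<and> r - q = q' then f (s(k := None)) else 0) +
           (if j = j' \<and> q' \<le> r - q then
             (- 1) ^ (parity M j' * parity M l + parity M j' * parity M e + parity M l * parity M e) *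
             f (s(k := Some (l, e, r - q - q'))) else 0))) else 0)"
      unfolding times_endo.rep_eq lam_upd none if_cancel add_0_left ..
    have sgn: "S (parity M i + parity M j) * S (parity M j + parity M l) = S (parity M i + parity M l)"
      unfolding S_def power_add[symmetric] by (rule sign_cong) auto
    show ?thesis
    proof (cases "j = j' \<and> a = i \<and> q + q' \<le> r")
      case False
      have "app (lam M k (i, j, q) * lam M k (j', l, q')) f s = 0"
      proof (cases "a = i \<and> q \<le> r")
        case True
        with False have "j \<noteq> j' \<or> r - q \<noteq> q' \<and> \<not> q' \<le> r - q" by auto
        then show ?thesis using lt unfolding idem by auto
      next
        case False
        then show ?thesis using lt unfolding idem by (simp only: False if_False mult_zero_right)
      qed
      moreover have "app (if j = j' then (- 1) ^ P * lam M k (i, l, q + q') else 0) f (s(k := Some (a, e, r))) = 0"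
      proof (cases "j = j'")
        case True
        then have "\<not> (a = i \<and> e = l \<and> r = q + q')" "\<not> (a = i \<and> q + q' \<le> r)" using False by auto
        then show ?thesis
          by (simp only: True simp_thms if_True if_False app_sign lam_upd add_0_left mult_zero_right)
      qed (simp add: zero_endo.rep_eq)
      ultimately show ?thesis unfolding idem by simp
    next
      case True
      then have *: "j = j'" "a = i" "q \<le> r" "q' \<le> r - q" "q + q' \<le> r" "r - q = q' \<longleftrightarrow> r = q + q'"
        "r - (q + q') = r - q - q'" by auto
      have e1: "app (if j = j' then (- 1) ^ P * lam M k (i, l, q + q') else 0) f (s(k := Some (a, e, r))) =
        (- 1) ^ P * (S (parity M i + parity M l) * ((if e = l \<and> r = q + q' then f (s(k := None)) else 0) +
           (- 1) ^ (parity M i * parity M l + parity M i * parity M e + parity M l * parity M e) *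
             f (s(k := Some (l, e, r - q - q')))))"
        by (simp only: * simp_thms if_True app_sign lam_upd)
      have e2: "app (lam M k (i, j, q) * lam M k (j', l, q')) f (s(k := Some (a, e, r))) =
         (- 1) ^ (parity M i * parity M j + parity M i * parity M e + parity M j * parity M e) *
         ((S (parity M i + parity M j) * S (parity M j + parity M l)) *
          ((if e = l \<and> r = q + q' then f (s(k := None)) else 0) +
             (- 1) ^ (parity M j * parity M l + parity M j * parity M e + parity M l * parity M e) *
             f (s(k := Some (l, e, r - q - q')))))"
        unfolding lt by (simp only: * simp_thms if_True mult_ac)
      have c1: "(- 1) ^ P * (if e = l \<and> r = q + q' then f (s(k := None)) else 0) =
        (- 1) ^ (parity M i * parity M j + parity M i * parity M e + parity M j * parity M e) *
        (if e = l \<and> r = q + q' then f (s(k := None)) else 0)"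
        by (simp add: P_def)
      have c2: "(- 1 :: complex) ^ P * (- 1) ^ (parity M i * parity M l + parity M i * parity M e + parity M l * parity M e) =
         (- 1) ^ (parity M i * parity M j + parity M i * parity M e + parity M j * parity M e) *
         (- 1) ^ (parity M j * parity M l + parity M j * parity M e + parity M l * parity M e)"
        unfolding P_def power_add[symmetric] by (rule sign_cong) auto
      have key: "a * (S' * (D + s1 * F)) = t * (S' * (D + s3 * F))"
        if "a * D = t * D" "a * s1 = t * s3" for a t S' D F s1 s3 :: complex
      proof -
        have "a * (S' * (D + s1 * F)) = S' * (a * D + (a * s1) * F)" by (simp add: algebra_simps)
        also have "\<dots> = t * (S' * (D + s3 * F))" unfolding that by (simp add: algebra_simps)
        finally show ?thesis .
      qed
      show ?thesis
        using e1 e2 key[OF c1 c2, of "S (parity M i + parity M l)" "f (s(k := Some (l, e, r - q - q')))"]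
        unfolding idem sgn by (simp only:)
    qed
  qed
qed

text \<open>With x the left and y the right multiplier, a letter b is sent to x b y in either order,
  and the adjoined unit to x y, with the same Koszul sign between the two orders.\<close>

lemma lam_rho_commute_same:
  "app (lam M k (i, j, q) * rho M k (i', j', q')) f (s(k := Some (a, e, r))) =
   (- 1) ^ ((parity M i + parity M j) * (parity M i' + parity M j')) *
     app (rho M k (i', j', q') * lam M k (i, j, q)) f (s(k := Some (a, e, r)))"
proof -
  define g where "g b = f (s(k := b))" for b
  define S where "S n = (- 1 :: complex) ^ (n * spar M s k)" for n :: nat
  have lam_upd: "app (lam M k (i, j, q)) h (s(k := Some (a, e, r))) = S (parity M i + parity M j) *
     ((if a = i \<and> e = j \<and> r = q then h (s(k := None)) else 0) +
      (if a = i \<and> q \<le> r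
       then (- 1) ^ (parity M i * parity M j + parity M i * parity M e + parity M j * parity M e) *
         h (s(k := Some (j, e, r - q))) else 0))" for h a e r
    using lam_Some[of "s(k := Some (a, e, r))" k a e r M i j q h] by (simp add: S_def)
  have rho_upd: "app (rho M k (i', j', q')) h (s(k := Some (a, e, r))) = S (parity M i' + parity M j') *
     ((if a = i' \<and> e = j' \<and> r = q' then h (s(k := None)) else 0) +
      (if e = j' \<and> q' \<le> r
       then (- 1) ^ ((parity M i' + parity M j') * (parity M a + parity M i') +
         parity M a * parity M i' + parity M a * parity M j' + parity M i' * parity M j') *
         h (s(k := Some (a, i', r - q'))) else 0))" for h a e r
    using rho_Some[of "s(k := Some (a, e, r))" k a e r M i' j' q' h] by (simp add: S_def)
  have none: "app (lam M k (i, j, q)) h (s(k := None)) = 0" "app (rho M k (i', j', q')) h (s(k := None)) = 0" for h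
    by (simp_all add: lam_None rho_None)
  consider "a \<noteq> i" | "e \<noteq> j'" | "a = i" "e = j'" by blast
  then show ?thesis
  proof cases
    case 1
    show ?thesis
      unfolding times_endo.rep_eq lam_upd rho_upd none if_cancel using 1
      by (simp only: simp_thms if_True if_False add_0_left mult_zero_right if_cancel)
  next
    case 2
    show ?thesis
      unfolding times_endo.rep_eq lam_upd rho_upd none if_cancel using 2
      by (simp only: simp_thms if_True if_False add_0_left mult_zero_right if_cancel)
  next
    case 3
    have lt: "app (lam M k (i, j, q) * rho M k (i', j', q')) f (s(k := Some (a, e, r))) =
        S (parity M i + parity M j) *
         (if q \<le> r then
          (- 1) ^ (parity M i * parity M j + parity M i * parity M j' + parity M j * parity M j') *
          (S (parity M i' + parity M j') * ((if j = i' \<and> r - q = q' then f (s(k := None)) else 0) +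
           (if q' \<le> r - q then
             (- 1) ^ ((parity M i' + parity M j') * (parity M j + parity M i') + parity M j * parity M i' +
               parity M j * parity M j' + parity M i' * parity M j') *
             f (s(k := Some (j, i', r - q - q'))) else 0))) else 0)"
      unfolding times_endo.rep_eq lam_upd rho_upd none if_cancel using 3
      by (simp only: simp_thms if_True add_0_left)
    have rt: "app (rho M k (i', j', q') * lam M k (i, j, q)) f (s(k := Some (a, e, r))) =
        S (parity M i' + parity M j') *
         (if q' \<le> r then
          (- 1) ^ ((parity M i' + parity M j') * (parity M i + parity M i') + parity M i * parity M i' +
             parity M i * parity M j' + parity M i' * parity M j') *
          (S (parity M i + parity M j) * ((if i' = j \<and> r - q' = q then f (s(k := None)) else 0) +
           (if q \<le> r - q' then
             (- 1) ^ (parity M i * parity M j + parity M i * parity M i' + parity M j * parity M i') *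
             f (s(k := Some (j, i', r - q' - q))) else 0))) else 0)"
      unfolding times_endo.rep_eq lam_upd rho_upd none if_cancel using 3
      by (simp only: simp_thms if_True add_0_left)
    define F where "F = f (s(k := Some (j, i', r - q - q')))"
    define G where "G = f (s(k := None))"
    show ?thesis
    proof (cases "q + q' \<le> r")
      case True
      then have *: "q \<le> r" "q' \<le> r" "q' \<le> r - q" "q \<le> r - q'" "r - q' = q \<longleftrightarrow> r - q = q'"
        "r - q' - q = r - q - q'" by auto
      show ?thesis
      proof (cases "i' = j")
        case True
        show ?thesis
          unfolding lt rt
          apply (simp only: * if_True True simp_thms F_def[symmetric] G_def[symmetric])
          by (cases rule: parity_eq_cases[of M i]; cases rule: parity_eq_cases[of M j'];
            cases rule: parity_eq_cases[of M j]) simp_all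
      next
        case False
        then have F1: "(i' = j) = False" and F2: "(j = i') = False" by auto
        show ?thesis
          unfolding lt rt
          apply (simp only: * if_True if_False F1 F2 simp_thms F_def[symmetric] add_0_left)
          by (cases rule: parity_eq_cases[of M i]; cases rule: parity_eq_cases[of M j'];
            cases rule: parity_eq_cases[of M j]; cases rule: parity_eq_cases[of M i']) simp_all
      qed
    next
      case False
      then have "\<not> q' \<le> r - q \<and> r - q \<noteq> q' \<or> \<not> q \<le> r" "\<not> q \<le> r - q' \<and> r - q' \<noteq> q \<or> \<not> q' \<le> r"
        by auto
      then show ?thesis
        unfolding lt rt by (cases "q \<le> r"; cases "q' \<le> r")
          (simp_all only: simp_thms if_False if_True mult_zero_right add_0_left)
    qed
  qed
qed

lemma lam_rho_commute:
  "lam M k x * rho M l y = (- 1) ^ (lpar M x * lpar M y) * (rho M l y * lam M k x)"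
proof (cases "k = l")
  case False
  then show ?thesis
    unfolding lam_def rho_def
    by (rule site_op_supercommute) (assumption | rule refl | erule lcoef_parity rcoef_parity)+
next
  case True
  obtain i j q where x: "x = (i, j, q)" by (cases x)
  obtain i' j' q' where y: "y = (i', j', q')" by (cases y)
  show ?thesis
  proof (rule endo_eqI, unfold app_sign)
    fix f s
    show "app (lam M k x * rho M l y) f s = (- 1) ^ (lpar M x * lpar M y) * app (rho M l y * lam M k x) f s"
    proof (cases "s k")
      case None
      then show ?thesis using True by (simp add: times_endo.rep_eq lam_None rho_None)
    next
      case (Some b)
      obtain a e r where b: "b = (a, e, r)" by (cases b)
      have eq: "s(k := Some (a, e, r)) = s" using Some b by (simp add: fun_upd_idem)
      show ?thesis
        using lam_rho_commute_same[of M k i j q i' j' q' f s a e r, unfolded eq]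
        by (simp add: x y lpar_def True[symmetric])
    qed
  qed
qed

section \<open>The matrix relation and coproducts\<close>

text \<open>The variables stand for \<open>x = 1/u\<close> and \<open>y = 1/v\<close>; the defining relation is multiplied by \<open>x * y\<close>.\<close>

definition rtt :: "nat \<Rightarrow> nat set \<Rightarrow> 'a::ring_1 \<Rightarrow> 'a \<Rightarrow> (nat \<Rightarrow> nat \<Rightarrow> 'a) \<Rightarrow> (nat \<Rightarrow> nat \<Rightarrow> 'a) \<Rightarrow> bool" where
  "rtt M I x y A A' \<longleftrightarrow> (\<forall>i\<in>I. \<forall>j\<in>I. \<forall>k\<in>I. \<forall>l\<in>I.
     (y - x) * (A i j * A' k l -
       (- 1) ^ ((parity M i + parity M j) * (parity M k + parity M l)) * (A' k l * A i j)) =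
     x * y * ((- 1) ^ (parity M i * parity M k + parity M i * parity M l + parity M k * parity M l) *
       (A k j * A' i l - A' k j * A i l)))"

text \<open>The signs that absorb those of the defining relation, leaving an identity between ordinary matrices
  that is preserved by products.\<close>

definition rsgn :: "nat \<Rightarrow> nat \<Rightarrow> nat \<Rightarrow> nat \<Rightarrow> nat \<Rightarrow> nat" where
  "rsgn M i k a b = parity M i + parity M k + parity M i * parity M k + parity M i * parity M a +
     parity M k * parity M a + parity M k * parity M b"

text \<open>With P the graded permutation, Q the product of the first matrix with the second and Q'
  the product in the opposite order, this is (y - x) (Q - Q') = x y (P Q - Q' P), that is, R Q = Q'
  R for R = (y - x) - x y P.\<close>

lemma rtt_matrix_form:
  fixes M :: nat and A A' :: "nat \<Rightarrow> nat \<Rightarrow> 'a::ring_1" and x y :: 'a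
  defines "Q \<equiv> \<lambda>i k a b. (- 1) ^ rsgn M i k a b * (A i a * A' k b)"
    and "Q' \<equiv> \<lambda>i k a b. (- 1) ^ (rsgn M i k a b + (parity M i + parity M a) * (parity M k + parity M b)) *
      (A' k b * A i a)"
  shows "rtt M I x y A A' \<longleftrightarrow> (\<forall>i\<in>I. \<forall>a\<in>I. \<forall>k\<in>I. \<forall>b\<in>I. (y - x) * (Q i k a b - Q' i k a b) =
      x * y * ((- 1) ^ (parity M i * parity M k) * Q k i a b - (- 1) ^ (parity M a * parity M b) * Q' i k b a))"
proof -
  have "(y - x) * (A i a * A' k b - (- 1) ^ ((parity M i + parity M a) * (parity M k + parity M b)) * (A' k b * A i a)) =
     x * y * ((- 1) ^ (parity M i * parity M k + parity M i * parity M b + parity M k * parity M b) *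
       (A k a * A' i b - A' k a * A i b)) \<longleftrightarrow>
    (y - x) * (Q i k a b - Q' i k a b) =
      x * y * ((- 1) ^ (parity M i * parity M k) * Q k i a b - (- 1) ^ (parity M a * parity M b) * Q' i k b a)"
    (is "?l = ?r \<longleftrightarrow> ?l' = ?r'") for i a k b
  proof -
    have l: "?l' = (- 1) ^ rsgn M i k a b * ?l"
    proof -
      have "Q i k a b - Q' i k a b = (- 1) ^ rsgn M i k a b *
          (A i a * A' k b - (- 1) ^ ((parity M i + parity M a) * (parity M k + parity M b)) * (A' k b * A i a))"
        by (simp only: Q_def Q'_def power_add[of _ "rsgn M i k a b"] right_diff_distrib mult.assoc)
      then show ?thesis by (simp only: sign_commute_left[of "y - x"])
    qed
    have r: "?r' = (- 1) ^ rsgn M i k a b * ?r"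
    proof -
      have 1: "(- 1 :: 'a) ^ (parity M i * parity M k) * (- 1) ^ rsgn M k i a b =
          (- 1) ^ rsgn M i k a b * (- 1) ^ (parity M i * parity M k + parity M i * parity M b + parity M k * parity M b)"
        unfolding power_add[symmetric] rsgn_def
          by (cases rule: parity_eq_cases[of M i]; cases rule: parity_eq_cases[of M k]; cases rule: parity_eq_cases[of M a]; cases rule: parity_eq_cases[of M b]; simp)
      have 2: "(- 1 :: 'a) ^ (parity M a * parity M b) *
          (- 1) ^ (rsgn M i k b a + (parity M i + parity M b) * (parity M k + parity M a)) =
          (- 1) ^ rsgn M i k a b * (- 1) ^ (parity M i * parity M k + parity M i * parity M b + parity M k * parity M b)"
        unfolding power_add[symmetric] rsgn_def
          by (cases rule: parity_eq_cases[of M i]; cases rule: parity_eq_cases[of M k]; cases rule: parity_eq_cases[of M a]; cases rule: parity_eq_cases[of M b]; simp)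
      show ?thesis
        unfolding Q_def Q'_def mult.assoc[of "(- 1) ^ _" "(- 1) ^ _", symmetric] 1 2
        by (simp only: right_diff_distrib mult.assoc sign_commute_left[of x] sign_commute_left[of y])
    qed
    show ?thesis
      unfolding l r by (metis sign_square)
  qed
  then show ?thesis unfolding rtt_def by simp
qed

text \<open>Since entries of one factor supercommute with entries of the other, Q of the product is
  the product of the matrices Q, and likewise for Q'. Then R can be moved through one factor after
  the other.\<close>

lemma rtt_coproduct:
  fixes A A' B B' :: "nat \<Rightarrow> nat \<Rightarrow> 'a::ring_1" and x y :: 'a
  assumes A: "rtt M I x y A A'" and B: "rtt M I x y B B'"
    and xc: "\<And>z. x * z = z * x" and yc: "\<And>z. y * z = z * y"
    and BA: "\<And>a j k b. a \<in> I \<Longrightarrow> j \<in> I \<Longrightarrow> k \<in> I \<Longrightarrow> b \<in> I \<Longrightarrow> B a j * A' k b =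
      (- 1) ^ ((parity M a + parity M j) * (parity M k + parity M b)) * (A' k b * B a j)"
    and B'A: "\<And>a j k b. a \<in> I \<Longrightarrow> j \<in> I \<Longrightarrow> k \<in> I \<Longrightarrow> b \<in> I \<Longrightarrow> B' a j * A k b =
      (- 1) ^ ((parity M a + parity M j) * (parity M k + parity M b)) * (A k b * B' a j)"
  shows "rtt M I x y
    (\<lambda>i j. \<Sum>c\<in>I. (- 1) ^ ((parity M i + parity M c) * (parity M c + parity M j)) * (A i c * B c j))
    (\<lambda>i j. \<Sum>c\<in>I. (- 1) ^ ((parity M i + parity M c) * (parity M c + parity M j)) * (A' i c * B' c j))"
    (is "rtt M I x y ?C ?C'")
proof -
  define Q where "Q A A' i k a b = (- 1) ^ rsgn M i k a b * (A i a * A' k b)"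
    for A A' :: "nat \<Rightarrow> nat \<Rightarrow> 'a" and i k a b
  define Q' where "Q' A A' i k a b =
      (- 1) ^ (rsgn M i k a b + (parity M i + parity M a) * (parity M k + parity M b)) * (A' k b * A i a)"
    for A A' :: "nat \<Rightarrow> nat \<Rightarrow> 'a" and i k a b
  note pull = sign_commute_left[of "A i j" for i j] sign_commute_left[of "A' i j" for i j]
    sign_commute_left[of "B i j" for i j] sign_commute_left[of "B' i j" for i j]
    sign_commute_left[of "Q U V i j k l" for U V i j k l] sign_commute_left[of "Q' U V i j k l" for U V i j k l]
  note form = rtt_matrix_form[of M I x y, folded Q_def Q'_def]
  let ?P = "\<lambda>i k. (- 1 :: 'a) ^ (parity M i * parity M k)"
  have QC: "Q ?C ?C' i k j l = (\<Sum>a\<in>I. \<Sum>b\<in>I. Q A A' i k a b * Q B B' a b j l)"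
    if "i \<in> I" "k \<in> I" "j \<in> I" "l \<in> I" for i k j l
  proof -
    have "Q A A' i k a b * Q B B' a b j l = (- 1) ^ rsgn M i k j l *
        ((- 1) ^ ((parity M i + parity M a) * (parity M a + parity M j)) * (A i a * B a j) *
         ((- 1) ^ ((parity M k + parity M b) * (parity M b + parity M l)) * (A' k b * B' b l)))"
      if "a \<in> I" "b \<in> I" for a b
    proof -
      have "A i a * B a j * (A' k b * B' b l) = A i a * (B a j * A' k b) * B' b l" by (simp add: mult.assoc)
      also have "\<dots> = (- 1) ^ ((parity M a + parity M j) * (parity M k + parity M b)) *
          (A i a * A' k b * (B a j * B' b l))"
        using that \<open>j \<in> I\<close> \<open>k \<in> I\<close> by (simp add: BA mult.assoc pull)
      finally have 1: "A i a * B a j * (A' k b * B' b l) =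
          (- 1) ^ ((parity M a + parity M j) * (parity M k + parity M b)) *
          (A i a * A' k b * (B a j * B' b l))" .
      have 2: "(- 1 :: 'a) ^ (rsgn M i k a b + rsgn M a b j l) =
          (- 1) ^ (rsgn M i k j l + ((parity M i + parity M a) * (parity M a + parity M j) +
            ((parity M k + parity M b) * (parity M b + parity M l) +
            (parity M a + parity M j) * (parity M k + parity M b))))"
        unfolding rsgn_def
        by (cases rule: parity_eq_cases[of M i]; cases rule: parity_eq_cases[of M j]; cases rule: parity_eq_cases[of M k]; cases rule: parity_eq_cases[of M l]; cases rule: parity_eq_cases[of M a]; cases rule: parity_eq_cases[of M b]; simp)
      have "Q A A' i k a b * Q B B' a b j l =
          (- 1) ^ (rsgn M i k a b + rsgn M a b j l) * (A i a * A' k b * (B a j * B' b l))"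
        by (simp only: Q_def power_add[of _ "rsgn M i k a b"] mult.assoc pull)
      also have "\<dots> = (- 1) ^ rsgn M i k j l *
        ((- 1) ^ ((parity M i + parity M a) * (parity M a + parity M j)) *
         ((- 1) ^ ((parity M k + parity M b) * (parity M b + parity M l)) * (A i a * B a j * (A' k b * B' b l))))"
        unfolding 1 2 by (simp only: power_add[of _ "rsgn M i k j l"] mult.assoc
            power_add[of _ "(parity M k + parity M b) * (parity M b + parity M l)"]
            power_add[of _ "(parity M i + parity M a) * (parity M a + parity M j)"])
      finally show ?thesis by (simp only: mult.assoc pull)
    qed
    then have "(\<Sum>a\<in>I. \<Sum>b\<in>I. Q A A' i k a b * Q B B' a b j l) =
      (\<Sum>a\<in>I. \<Sum>b\<in>I. (- 1) ^ rsgn M i k j l *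
        ((- 1) ^ ((parity M i + parity M a) * (parity M a + parity M j)) * (A i a * B a j) *
         ((- 1) ^ ((parity M k + parity M b) * (parity M b + parity M l)) * (A' k b * B' b l))))"
      by (intro sum.cong refl) simp
    also have "\<dots> = Q ?C ?C' i k j l"
      unfolding Q_def sum_product unfolding sum_distrib_left ..
    finally show ?thesis by simp
  qed
  have Q'C: "Q' ?C ?C' i k j l = (\<Sum>a\<in>I. \<Sum>b\<in>I. Q' A A' i k a b * Q' B B' a b j l)"
    if "i \<in> I" "k \<in> I" "j \<in> I" "l \<in> I" for i k j l
  proof -
    have "Q' A A' i k a b * Q' B B' a b j l =
        (- 1) ^ (rsgn M i k j l + (parity M i + parity M j) * (parity M k + parity M l)) *
        ((- 1) ^ ((parity M k + parity M b) * (parity M b + parity M l)) * (A' k b * B' b l) *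
         ((- 1) ^ ((parity M i + parity M a) * (parity M a + parity M j)) * (A i a * B a j)))"
      if "a \<in> I" "b \<in> I" for a b
    proof -
      have "A' k b * B' b l * (A i a * B a j) = A' k b * (B' b l * A i a) * B a j" by (simp add: mult.assoc)
      also have "\<dots> = (- 1) ^ ((parity M b + parity M l) * (parity M i + parity M a)) *
          (A' k b * A i a * (B' b l * B a j))"
        using that \<open>i \<in> I\<close> \<open>l \<in> I\<close> by (simp add: B'A mult.assoc pull)
      finally have 1: "A' k b * B' b l * (A i a * B a j) =
          (- 1) ^ ((parity M b + parity M l) * (parity M i + parity M a)) *
          (A' k b * A i a * (B' b l * B a j))" .
      have 2: "(- 1 :: 'a) ^ ((rsgn M i k a b + (parity M i + parity M a) * (parity M k + parity M b)) +
          (rsgn M a b j l + (parity M a + parity M j) * (parity M b + parity M l))) =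
          (- 1) ^ ((rsgn M i k j l + (parity M i + parity M j) * (parity M k + parity M l)) +
            ((parity M k + parity M b) * (parity M b + parity M l) +
            ((parity M i + parity M a) * (parity M a + parity M j) +
            (parity M b + parity M l) * (parity M i + parity M a))))"
        unfolding rsgn_def
        by (cases rule: parity_eq_cases[of M i]; cases rule: parity_eq_cases[of M j]; cases rule: parity_eq_cases[of M k]; cases rule: parity_eq_cases[of M l]; cases rule: parity_eq_cases[of M a]; cases rule: parity_eq_cases[of M b]; simp)
      have "Q' A A' i k a b * Q' B B' a b j l =
          (- 1) ^ ((rsgn M i k a b + (parity M i + parity M a) * (parity M k + parity M b)) +
          (rsgn M a b j l + (parity M a + parity M j) * (parity M b + parity M l))) *
          (A' k b * A i a * (B' b l * B a j))"
        unfolding Q'_def power_add[of _ "rsgn M i k a b + _"]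
        by (simp only: mult.assoc pull)
      also have "\<dots> = (- 1) ^ (rsgn M i k j l + (parity M i + parity M j) * (parity M k + parity M l)) *
        ((- 1) ^ ((parity M k + parity M b) * (parity M b + parity M l)) *
         ((- 1) ^ ((parity M i + parity M a) * (parity M a + parity M j)) * (A' k b * B' b l * (A i a * B a j))))"
        unfolding 1 2 power_add[of _ "rsgn M i k j l + _"]
        by (simp only: power_add[of _ "(parity M k + parity M b) * (parity M b + parity M l)"]
            power_add[of _ "(parity M i + parity M a) * (parity M a + parity M j)"] mult.assoc)
      finally show ?thesis by (simp only: mult.assoc pull)
    qed
    then have "(\<Sum>a\<in>I. \<Sum>b\<in>I. Q' A A' i k a b * Q' B B' a b j l) =
      (\<Sum>a\<in>I. \<Sum>b\<in>I. (- 1) ^ (rsgn M i k j l + (parity M i + parity M j) * (parity M k + parity M l)) *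
        ((- 1) ^ ((parity M k + parity M b) * (parity M b + parity M l)) * (A' k b * B' b l) *
         ((- 1) ^ ((parity M i + parity M a) * (parity M a + parity M j)) * (A i a * B a j))))"
      by (intro sum.cong refl) simp
    also have "\<dots> = Q' ?C ?C' i k j l"
      unfolding Q'_def sum_product unfolding sum_distrib_left by (rule sum.swap)
    finally show ?thesis by simp
  qed
  have main: "(y - x) * (Q ?C ?C' i k j l - Q' ?C ?C' i k j l) =
      x * y * (?P i k * Q ?C ?C' k i j l - ?P j l * Q' ?C ?C' i k l j)"
    if idx: "i \<in> I" "k \<in> I" "j \<in> I" "l \<in> I" for i k j l
  proof -
    have 1: "(y - x) * (Q A A' i k a b * Q B B' a b j l - Q' A A' i k a b * Q' B B' a b j l) =
       x * y * ((?P i k * Q A A' k i a b - ?P a b * Q' A A' i k b a) * Q B B' a b j l +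
        Q' A A' i k a b * (?P a b * Q B B' b a j l - ?P j l * Q' B B' a b l j))"
      if "a \<in> I" "b \<in> I" for a b
    proof -
      have a: "(y - x) * (Q A A' i k a b - Q' A A' i k a b) =
          x * y * (?P i k * Q A A' k i a b - ?P a b * Q' A A' i k b a)"
        using A idx that unfolding form by blast
      have b: "(y - x) * (Q B B' a b j l - Q' B B' a b j l) =
          x * y * (?P a b * Q B B' b a j l - ?P j l * Q' B B' a b l j)"
        using B idx that unfolding form by blast
      have c: "(y - x) * z = z * (y - x)" "x * y * z = z * (x * y)" for z
      proof -
        show "(y - x) * z = z * (y - x)"
          by (simp only: left_diff_distrib right_diff_distrib xc[of z] yc[of z])
        show "x * y * z = z * (x * y)" by (metis mult.assoc xc yc)
      qed
      have d: "Q' A A' i k a b * (x * (y * W)) = x * (y * (Q' A A' i k a b * W))" for W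
        by (metis c(2) mult.assoc)
      \<comment> \<open>One factor is exchanged at a time, so that the relation of each factor
        applies to one summand.\<close>
      have "(y - x) * (Q A A' i k a b * Q B B' a b j l - Q' A A' i k a b * Q' B B' a b j l) =
        (y - x) * (Q A A' i k a b - Q' A A' i k a b) * Q B B' a b j l +
        (y - x) * Q' A A' i k a b * (Q B B' a b j l - Q' B B' a b j l)"
        by (simp add: algebra_simps)
      also have "\<dots> = (y - x) * (Q A A' i k a b - Q' A A' i k a b) * Q B B' a b j l +
        Q' A A' i k a b * ((y - x) * (Q B B' a b j l - Q' B B' a b j l))"
        by (simp only: c(1) mult.assoc)
      also have "\<dots> = x * y * (?P i k * Q A A' k i a b - ?P a b * Q' A A' i k b a) * Q B B' a b j l +
        x * y * Q' A A' i k a b * (?P a b * Q B B' b a j l - ?P j l * Q' B B' a b l j)"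
        unfolding a b by (simp only: d mult.assoc)
      finally show ?thesis by (simp only: distrib_left mult.assoc)
    qed
    have "(y - x) * (Q ?C ?C' i k j l - Q' ?C ?C' i k j l) =
      (\<Sum>a\<in>I. \<Sum>b\<in>I. (y - x) * (Q A A' i k a b * Q B B' a b j l - Q' A A' i k a b * Q' B B' a b j l))"
      by (simp only: QC[OF idx] Q'C[OF idx] sum_distrib_left sum_subtractf right_diff_distrib)
    also have "\<dots> = x * y * (\<Sum>a\<in>I. \<Sum>b\<in>I. (?P i k * Q A A' k i a b - ?P a b * Q' A A' i k b a) * Q B B' a b j l +
        Q' A A' i k a b * (?P a b * Q B B' b a j l - ?P j l * Q' B B' a b l j))"
      unfolding sum_distrib_left by (intro sum.cong refl 1)
    also have "(\<Sum>a\<in>I. \<Sum>b\<in>I. (?P i k * Q A A' k i a b - ?P a b * Q' A A' i k b a) * Q B B' a b j l +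
        Q' A A' i k a b * (?P a b * Q B B' b a j l - ?P j l * Q' B B' a b l j)) =
      ?P i k * (\<Sum>a\<in>I. \<Sum>b\<in>I. Q A A' k i a b * Q B B' a b j l) -
      ?P j l * (\<Sum>a\<in>I. \<Sum>b\<in>I. Q' A A' i k a b * Q' B B' a b l j) +
      ((\<Sum>a\<in>I. \<Sum>b\<in>I. ?P a b * (Q' A A' i k a b * Q B B' b a j l)) -
       (\<Sum>a\<in>I. \<Sum>b\<in>I. ?P a b * (Q' A A' i k b a * Q B B' a b j l)))"
      by (simp add: left_diff_distrib right_diff_distrib sum.distrib sum_subtractf sum_distrib_left
          mult.assoc pull)
    \<comment> \<open>The terms with the permutation between the two factors agree after exchanging
      \<open>a\<close> and \<open>b\<close>, and therefore cancel.\<close>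
    also have "(\<Sum>a\<in>I. \<Sum>b\<in>I. ?P a b * (Q' A A' i k b a * Q B B' a b j l)) =
       (\<Sum>a\<in>I. \<Sum>b\<in>I. ?P a b * (Q' A A' i k a b * Q B B' b a j l))"
      by (subst sum.swap) (simp add: mult.commute)
    finally show ?thesis
      by (simp add: QC idx Q'C)
  qed
  show ?thesis unfolding form using main by blast
qed


section \<open>Formal series in two commuting variables\<close>

definition lift1 :: "'a::zero fps \<Rightarrow> 'a fps fps" where
  "lift1 f = Abs_fps (\<lambda>r. fps_const (f $ r))"

definition lift2 :: "'a::zero fps \<Rightarrow> 'a fps fps" where
  "lift2 f = fps_const f"

lemma lift1_nth [simp]: "lift1 f $ r = fps_const (f $ r)"
  by (simp add: lift1_def)

lemma lift2_nth: "lift2 f $ r = (if r = 0 then f else 0)"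
  by (simp add: lift2_def)

lemma fps_sign_nth: "((- 1) ^ n * f) $ r = (- 1) ^ n * ((f :: 'a::ring_1 fps) $ r)"
  by (cases "even n") simp_all

lemma fps_const_sum: "fps_const (sum f A) = (\<Sum>a\<in>A. fps_const (f a :: 'a::comm_monoid_add))"
  by (rule fps_ext) (simp add: fps_sum_nth)

lemma lift1_sum: "lift1 (sum f A) = (\<Sum>a\<in>A. lift1 (f a :: 'a::comm_monoid_add fps))"
  by (rule fps_ext) (simp add: fps_sum_nth fps_const_sum)

lemma lift1_mult: "lift1 (f * g) = lift1 f * lift1 (g :: 'a::semiring_0 fps)"
  by (rule fps_ext) (simp add: fps_mult_nth fps_const_sum)

lemma lift1_sign: "lift1 ((- 1) ^ n * f) = (- 1) ^ n * lift1 (f :: 'a::ring_1 fps)"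
  by (cases "even n") (auto intro!: fps_ext)

lemma lift2_sum: "lift2 (sum f A) = (\<Sum>a\<in>A. lift2 (f a :: 'a::comm_monoid_add fps))"
  by (simp add: lift2_def fps_const_sum)

lemma lift2_mult: "lift2 (f * g) = lift2 f * lift2 (g :: 'a::semiring_0 fps)"
  by (simp add: lift2_def)

lemma lift2_sign: "lift2 ((- 1) ^ n * f) = (- 1) ^ n * lift2 (f :: 'a::ring_1 fps)"
  by (cases "even n") (auto simp: lift2_def)

lemma lift12_nth: "(lift1 f * lift2 g) $ r $ s = f $ r * (g :: 'a::ring_1 fps) $ s"
  by (simp add: lift2_def)

lemma lift21_nth: "(lift2 g * lift1 f) $ r $ s = (g :: 'a::ring_1 fps) $ s * f $ r"
  by (simp add: lift2_def)

definition rtt_series :: "nat \<Rightarrow> nat set \<Rightarrow> (nat \<Rightarrow> nat \<Rightarrow> 'a::ring_1 fps) \<Rightarrow> bool" where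
  "rtt_series M I A \<longleftrightarrow>
    rtt M I fps_X (fps_const fps_X) (\<lambda>i j. lift1 (A i j)) (\<lambda>i j. lift2 (A i j))"

definition rtt_coeff :: "nat \<Rightarrow> (nat \<Rightarrow> nat \<Rightarrow> nat \<Rightarrow> 'a::ring_1) \<Rightarrow> nat \<Rightarrow> nat \<Rightarrow> nat \<Rightarrow> nat \<Rightarrow> nat \<Rightarrow> nat \<Rightarrow> 'a" where
  "rtt_coeff M a i j k l r s =
     a i j r * a k l s - (- 1) ^ ((parity M i + parity M j) * (parity M k + parity M l)) * (a k l s * a i j r)"

text \<open>Comparison of coefficients after multiplication by x y: monomials that involve only one
  of the variables are absent on the right, which gives the two vanishing conditions; the other
  monomials give the relation with both indices lowered by one.\<close>

lemma rtt_series_iff: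
  "rtt_series M I A \<longleftrightarrow> (\<forall>i\<in>I. \<forall>j\<in>I. \<forall>k\<in>I. \<forall>l\<in>I.
     (\<forall>r. rtt_coeff M (\<lambda>i j n. A i j $ n) i j k l r 0 = 0) \<and>
     (\<forall>s. rtt_coeff M (\<lambda>i j n. A i j $ n) i j k l 0 s = 0) \<and>
     (\<forall>r s. rtt_coeff M (\<lambda>i j n. A i j $ n) i j k l (Suc r) s -
         rtt_coeff M (\<lambda>i j n. A i j $ n) i j k l r (Suc s) =
       (- 1) ^ (parity M i * parity M k + parity M i * parity M l + parity M k * parity M l) *
       (A k j $ r * A i l $ s - A k j $ s * A i l $ r)))"
proof -
  have "(fps_const fps_X - fps_X) * (lift1 (A i j) * lift2 (A k l) -
        (- 1) ^ ((parity M i + parity M j) * (parity M k + parity M l)) * (lift2 (A k l) * lift1 (A i j))) =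
      fps_X * fps_const fps_X *
        ((- 1) ^ (parity M i * parity M k + parity M i * parity M l + parity M k * parity M l) *
        (lift1 (A k j) * lift2 (A i l) - lift2 (A k j) * lift1 (A i l))) \<longleftrightarrow>
     (\<forall>r. rtt_coeff M (\<lambda>i j n. A i j $ n) i j k l r 0 = 0) \<and>
     (\<forall>s. rtt_coeff M (\<lambda>i j n. A i j $ n) i j k l 0 s = 0) \<and>
     (\<forall>r s. rtt_coeff M (\<lambda>i j n. A i j $ n) i j k l (Suc r) s -
         rtt_coeff M (\<lambda>i j n. A i j $ n) i j k l r (Suc s) =
       (- 1) ^ (parity M i * parity M k + parity M i * parity M l + parity M k * parity M l) *
       (A k j $ r * A i l $ s - A k j $ s * A i l $ r))" (is "?L = ?R \<longleftrightarrow> ?rel") for i j k l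
  proof -
    let ?e = "(- 1) ^ (parity M i * parity M k + parity M i * parity M l + parity M k * parity M l)"
    define c where "c = rtt_coeff M (\<lambda>i j n. A i j $ n) i j k l"
    define d where "d r s = ?e * (A k j $ r * A i l $ s - A k j $ s * A i l $ r)" for r s
    have L: "?L $ r $ s = (if s = 0 then 0 else c r (s - 1)) - (if r = 0 then 0 else c (r - 1) s)" for r s
      by (simp add: left_diff_distrib fps_sign_nth lift12_nth lift21_nth lift2_nth c_def rtt_coeff_def)
    have R: "?R $ r $ s = (if r = 0 \<or> s = 0 then 0 else d (r - 1) (s - 1))" for r s
      by (simp add: mult.assoc fps_sign_nth lift12_nth lift21_nth lift2_nth d_def)
    have "?L = ?R \<longleftrightarrow> (\<forall>r s. ?L $ r $ s = ?R $ r $ s)"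
      by (simp add: fps_eq_iff)
    also have "\<dots> \<longleftrightarrow> (\<forall>r. c r 0 = 0) \<and> (\<forall>s. c 0 s = 0) \<and> (\<forall>r s. c (Suc r) s - c r (Suc s) = d r s)"
      (is "?a \<longleftrightarrow> ?b")
    proof
      assume a: ?a
      have "c r 0 = 0" for r using a[rule_format, of "Suc r" 0] unfolding L R by simp
      moreover have "c 0 s = 0" for s using a[rule_format, of 0 "Suc s"] unfolding L R by simp
      moreover have "c (Suc r) s - c r (Suc s) = d r s" for r s
        using a[rule_format, of "Suc r" "Suc s"] unfolding L R by simp
      ultimately show ?b by blast
    next
      assume b: ?b
      show ?a
      proof (intro allI)
        fix r s
        show "?L $ r $ s = ?R $ r $ s"
          unfolding L R using b by (cases r; cases s) auto
      qed
    qed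
    finally show ?thesis unfolding c_def d_def .
  qed
  then show ?thesis unfolding rtt_series_def rtt_def by simp
qed

section \<open>The series of the tensor product of evaluation representations\<close>

text \<open>This is the expansion of 1 + E/(u - z) in 1/u: the evaluation homomorphism whose
  parameter z remains a variable of the current superalgebra.\<close>

definition tL :: "nat \<Rightarrow> nat \<Rightarrow> nat \<Rightarrow> nat \<Rightarrow> state endo fps" where
  "tL M k i j = Abs_fps (\<lambda>n. case n of 0 \<Rightarrow> if i = j then 1 else 0 | Suc q \<Rightarrow> lam M k (i, j, q))"

text \<open>The graded coproduct, iterated; the sign belongs to the multiplication of matrices with
  entries in a superalgebra. Without sites it is the counit.\<close>

primrec tT :: "nat \<Rightarrow> nat \<Rightarrow> nat \<Rightarrow> nat \<Rightarrow> nat \<Rightarrow> state endo fps" where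
  "tT M N 0 = (\<lambda>i j. if i = j then 1 else 0)"
| "tT M N (Suc m) = (\<lambda>i j. \<Sum>c\<in>{1..M + N}.
     (- 1) ^ ((parity M i + parity M c) * (parity M c + parity M j)) * (tT M N m i c * tL M m c j))"

lemma tL_0 [simp]: "tL M k i j $ 0 = (if i = j then 1 else 0)"
  and tL_Suc [simp]: "tL M k i j $ Suc q = lam M k (i, j, q)"
  by (simp_all add: tL_def)

lemma lam_bracket:
  "lam M m (i, j, q) * lam M m (k, l, q') -
     (- 1) ^ ((parity M i + parity M j) * (parity M k + parity M l)) * (lam M m (k, l, q') * lam M m (i, j, q)) =
   (- 1) ^ (parity M i * parity M k + parity M i * parity M l + parity M k * parity M l) *
     ((if k = j then lam M m (i, l, q + q') else 0) - (if i = l then lam M m (k, j, q + q') else 0))"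
proof -
  have 1: "(- 1 :: state endo) ^ (parity M i * parity M k + parity M i * parity M l + parity M k * parity M l) =
      (- 1) ^ ((parity M i + parity M j) * (parity M k + parity M l)) *
      (- 1) ^ (parity M k * parity M l + parity M k * parity M j + parity M l * parity M j)" if "i = l"
    unfolding that by (cases rule: parity_eq_cases[of M j]; cases rule: parity_eq_cases[of M k];
      cases rule: parity_eq_cases[of M l]; simp)
  show ?thesis
  proof (cases "i = l")
    case True
    then show ?thesis
      using 1 by (cases "k = j") (simp_all add: lam_mult right_diff_distrib mult.assoc add.commute[of q'])
  next
    case False
    then show ?thesis by (cases "k = j") (simp_all add: lam_mult)
  qed
qed

text \<open>For positive indices both sides vanish, because brackets and products of letters depend
  on the degrees only through their sum. An index 0 on one side leaves the bracket of the current
  superalgebra.\<close>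

lemma rtt_series_tL: "rtt_series M I (tL M m)"
proof -
  let ?c = "rtt_coeff M (\<lambda>i j n. tL M m i j $ n)"
  have r0: "?c i j k l r 0 = 0" for i j k l r
    by (cases "k = l") (simp_all add: rtt_coeff_def)
  have s0: "?c i j k l 0 s = 0" for i j k l s
    by (cases "i = j") (simp_all add: rtt_coeff_def)
  have ss: "?c i j k l (Suc q) (Suc q') =
     (- 1) ^ (parity M i * parity M k + parity M i * parity M l + parity M k * parity M l) *
     ((if k = j then lam M m (i, l, q + q') else 0) - (if i = l then lam M m (k, j, q + q') else 0))"
    for i j k l q q'
    by (simp add: rtt_coeff_def lam_bracket)
  have "?c i j k l (Suc r) s - ?c i j k l r (Suc s) =
       (- 1) ^ (parity M i * parity M k + parity M i * parity M l + parity M k * parity M l) *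
       (tL M m k j $ r * tL M m i l $ s - tL M m k j $ s * tL M m i l $ r)" for i j k l r s
  proof (cases r; cases s)
    fix r' s' assume "r = Suc r'" "s = Suc s'"
    then show ?thesis by (simp add: ss lam_mult add.commute)
  qed (auto simp: r0 s0 ss right_diff_distrib)
  then show ?thesis unfolding rtt_series_iff using r0 s0 by blast
qed

section \<open>Supercommutation with the factors of a tensor power\<close>

definition site_supercommutes :: "nat \<Rightarrow> nat set \<Rightarrow> nat \<Rightarrow> nat \<Rightarrow> state endo \<Rightarrow> bool" where
  "site_supercommutes M I k \<pi> Y \<longleftrightarrow> (\<forall>i\<in>I. \<forall>j\<in>I. \<forall>q.
     lam M k (i, j, q) * Y = (- 1) ^ ((parity M i + parity M j) * \<pi>) * (Y * lam M k (i, j, q)))"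

lemma tL_supercommutes:
  assumes "site_supercommutes M I k \<pi> Y" "i \<in> I" "j \<in> I"
  shows "tL M k i j $ n * Y = (- 1) ^ ((parity M i + parity M j) * \<pi>) * (Y * tL M k i j $ n)"
proof (cases n)
  case 0
  then show ?thesis by simp
next
  case (Suc q)
  then show ?thesis using assms by (simp add: site_supercommutes_def)
qed

text \<open>The parities of the two factors add up to that of the outer indices, since the inner
  index occurs twice. This is the induction step for \<open>tT\<close> as well as for its
  inverse.\<close>

lemma fps_product_supercommutes:
  fixes A B :: "nat \<Rightarrow> nat \<Rightarrow> 'a::ring_1 fps"
  assumes A: "\<And>c a. c \<in> I \<Longrightarrow> A i c $ a * Y = (- 1) ^ ((parity M i + parity M c) * \<pi>) * (Y * A i c $ a)"
    and B: "\<And>c a. c \<in> I \<Longrightarrow> B c j $ a * Y = (- 1) ^ ((parity M c + parity M j) * \<pi>) * (Y * B c j $ a)"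
  shows "(\<Sum>c\<in>I. (- 1) ^ ((parity M i + parity M c) * (parity M c + parity M j)) * (A i c * B c j)) $ n * Y =
    (- 1) ^ ((parity M i + parity M j) * \<pi>) *
      (Y * (\<Sum>c\<in>I. (- 1) ^ ((parity M i + parity M c) * (parity M c + parity M j)) * (A i c * B c j)) $ n)"
proof -
  define e where "e i j = (- 1 :: 'a) ^ ((parity M i + parity M j) * \<pi>)" for i j
  define d where "d c = (- 1 :: 'a) ^ ((parity M i + parity M c) * (parity M c + parity M j))" for c
  have ee: "e c j * e i c = e i j" for c
    unfolding e_def power_add[symmetric] by (rule sign_cong) (cases "even \<pi>"; auto)
  have comp: "(\<Sum>c\<in>I. (- 1) ^ ((parity M i + parity M c) * (parity M c + parity M j)) * (A i c * B c j)) $ n =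
      (\<Sum>c\<in>I. \<Sum>a=0..n. d c * (A i c $ a * B c j $ (n - a)))"
    unfolding fps_sum_nth fps_sign_nth unfolding fps_mult_nth sum_distrib_left d_def ..
  have "d c * (A i c $ a * B c j $ (n - a)) * Y = e i j * (Y * (d c * (A i c $ a * B c j $ (n - a))))"
    if c: "c \<in> I" for c a
  proof -
    have "d c * (A i c $ a * B c j $ (n - a)) * Y = d c * (A i c $ a * (e c j * (Y * B c j $ (n - a))))"
      unfolding e_def by (simp only: mult.assoc B[OF c])
    also have "\<dots> = d c * (e c j * (A i c $ a * Y * B c j $ (n - a)))"
      unfolding e_def by (simp only: sign_commute_left[of "A i c $ a"] mult.assoc)
    also have "\<dots> = d c * ((e c j * e i c) * (Y * A i c $ a * B c j $ (n - a)))"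
      unfolding e_def by (simp only: A[OF c] mult.assoc)
    also have "\<dots> = e i j * (Y * (d c * (A i c $ a * B c j $ (n - a))))"
      unfolding ee unfolding e_def d_def sign_commute_left[of Y] unfolding mult.assoc by (rule sign_commute_left)
    finally show ?thesis .
  qed
  then show ?thesis
    unfolding comp e_def[symmetric] by (simp add: sum_distrib_left sum_distrib_right)
qed

lemma tT_supercommutes:
  assumes "\<And>k. k < m \<Longrightarrow> site_supercommutes M {1..M + N} k \<pi> Y" "i \<in> {1..M + N}" "j \<in> {1..M + N}"
  shows "tT M N m i j $ n * Y = (- 1) ^ ((parity M i + parity M j) * \<pi>) * (Y * tT M N m i j $ n)"
  using assms
proof (induction m arbitrary: i j n)
  case (Suc m)
  have L: "tL M m c j $ a * Y = (- 1) ^ ((parity M c + parity M j) * \<pi>) * (Y * tL M m c j $ a)"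
    if "c \<in> {1..M + N}" for c a
    by (rule tL_supercommutes[OF Suc.prems(1)[OF lessI] that Suc.prems(3)])
  show ?case
    unfolding tT.simps by (rule fps_product_supercommutes) (use L Suc in auto)
qed simp

lemma tL_site_supercommutes:
  assumes "k \<noteq> m"
  shows "site_supercommutes M I k (parity M a + parity M j) (tL M m a j $ r)"
  unfolding site_supercommutes_def using lam_lam_commute[OF assms, of M] by (cases r) (auto simp: lpar_def)

lemma rtt_series_tT: "rtt_series M {1..M + N} (tT M N m)"
proof (induction m)
  case 0
  have "rtt_coeff M (\<lambda>i j n. (if i = j then 1 else 0 :: state endo fps) $ n) i j k l r s = 0" for i j k l r s
    by (auto simp: rtt_coeff_def)
  then show ?case by (auto simp: rtt_series_iff)
next
  case (Suc m)
  have TL: "tT M N m k b $ s * tL M m a j $ r = (- 1) ^ ((parity M k + parity M b) * (parity M a + parity M j)) *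
      (tL M m a j $ r * tT M N m k b $ s)"
    if "k \<in> {1..M + N}" "b \<in> {1..M + N}" for a j k b r s
    by (rule tT_supercommutes) (use that tL_site_supercommutes in auto)
  have LT: "tL M m a j $ r * tT M N m k b $ s = (- 1) ^ ((parity M a + parity M j) * (parity M k + parity M b)) *
      (tT M N m k b $ s * tL M m a j $ r)"
    if "k \<in> {1..M + N}" "b \<in> {1..M + N}" for a j k b r s
    unfolding TL[OF that] by (simp add: sign_square mult.commute[of "parity M a + parity M j"])
  have "rtt M {1..M + N} fps_X (fps_const fps_X)
    (\<lambda>i j. \<Sum>c\<in>{1..M + N}. (- 1) ^ ((parity M i + parity M c) * (parity M c + parity M j)) *
       (lift1 (tT M N m i c) * lift1 (tL M m c j)))
    (\<lambda>i j. \<Sum>c\<in>{1..M + N}. (- 1) ^ ((parity M i + parity M c) * (parity M c + parity M j)) *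
       (lift2 (tT M N m i c) * lift2 (tL M m c j)))"
  proof (rule rtt_coproduct)
    show "rtt M {1..M + N} fps_X (fps_const fps_X) (\<lambda>i j. lift1 (tT M N m i j)) (\<lambda>i j. lift2 (tT M N m i j))"
      using Suc.IH unfolding rtt_series_def .
    show "rtt M {1..M + N} fps_X (fps_const fps_X) (\<lambda>i j. lift1 (tL M m i j)) (\<lambda>i j. lift2 (tL M m i j))"
      using rtt_series_tL unfolding rtt_series_def .
    show "fps_X * z = z * fps_X" for z :: "state endo fps fps" by (rule fps_mult_fps_X_commute)
    show "fps_const fps_X * z = z * fps_const fps_X" for z :: "state endo fps fps"
      by (rule fps_ext) (simp add: fps_mult_fps_X_commute)
    show "lift1 (tL M m a j) * lift2 (tT M N m k b) = (- 1) ^ ((parity M a + parity M j) * (parity M k + parity M b)) *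
        (lift2 (tT M N m k b) * lift1 (tL M m a j))"
      if "k \<in> {1..M + N}" "b \<in> {1..M + N}" for a j k b
      by (intro fps_ext, unfold fps_sign_nth lift12_nth lift21_nth) (rule LT[OF that])
    show "lift2 (tL M m a j) * lift1 (tT M N m k b) = (- 1) ^ ((parity M a + parity M j) * (parity M k + parity M b)) *
        (lift1 (tT M N m k b) * lift2 (tL M m a j))"
      if "k \<in> {1..M + N}" "b \<in> {1..M + N}" for a j k b
      by (intro fps_ext, unfold fps_sign_nth lift12_nth lift21_nth) (rule LT[OF that])
  qed
  then show ?case
    unfolding rtt_series_def tT.simps lift1_sum lift2_sum lift1_sign lift2_sign
    unfolding lift1_mult lift2_mult .
qed

section \<open>Evaluation of free algebra elements\<close>

definition evalw :: "(letter \<Rightarrow> 's endo) \<Rightarrow> gen_word \<Rightarrow> 's endo" where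
  "evalw \<phi> w = prod_list (map \<phi> (letters w))"

definition evalf :: "(letter \<Rightarrow> 's endo) \<Rightarrow> free_elem \<Rightarrow> 's endo" where
  "evalf \<phi> x = (\<Sum>w\<in>Poly_Mapping.keys x. cs (Poly_Mapping.lookup x w) * evalw \<phi> w)"

lemma evalf_superset:
  "finite S \<Longrightarrow> Poly_Mapping.keys x \<subseteq> S \<Longrightarrow> evalf \<phi> x = (\<Sum>w\<in>S. cs (Poly_Mapping.lookup x w) * evalw \<phi> w)"
  unfolding evalf_def by (rule sum.mono_neutral_left) (auto simp: in_keys_iff)

lemma evalf_0 [simp]: "evalf \<phi> 0 = 0"
  by (simp add: evalf_def)

lemma evalf_add: "evalf \<phi> (x + y) = evalf \<phi> x + evalf \<phi> y"
proof -
  let ?S = "Poly_Mapping.keys x \<union> Poly_Mapping.keys y"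
  have "evalf \<phi> (x + y) = (\<Sum>w\<in>?S. cs (Poly_Mapping.lookup (x + y) w) * evalw \<phi> w)"
    by (rule evalf_superset) (auto simp: Poly_Mapping.keys_add)
  also have "\<dots> = (\<Sum>w\<in>?S. cs (Poly_Mapping.lookup x w) * evalw \<phi> w) +
      (\<Sum>w\<in>?S. cs (Poly_Mapping.lookup y w) * evalw \<phi> w)"
    by (simp add: lookup_add cs_add distrib_right sum.distrib)
  finally show ?thesis by (simp add: evalf_superset[of ?S])
qed

lemma evalf_sum: "evalf \<phi> (sum f A) = (\<Sum>a\<in>A. evalf \<phi> (f a))"
  by (induction A rule: infinite_finite_induct) (simp_all add: evalf_add)

lemma evalf_single: "evalf \<phi> (Poly_Mapping.single w c) = cs c * evalw \<phi> w"
  by (simp add: evalf_def)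

lemma poly_mapping_sum_singles:
  "x = (\<Sum>w\<in>Poly_Mapping.keys x. Poly_Mapping.single w (Poly_Mapping.lookup x w))"
  by (rule poly_mapping_eqI) (auto simp: lookup_sum lookup_single when_def in_keys_iff)

lemma evalw_plus: "evalw \<phi> (v + w) = evalw \<phi> v * evalw \<phi> w"
  by (simp add: evalw_def plus_gen_word_def)

lemma evalw_0 [simp]: "evalw \<phi> 0 = 1"
  by (simp add: evalw_def zero_gen_word_def)

lemma evalf_1 [simp]: "evalf \<phi> 1 = 1"
  using evalf_single[of \<phi> 0 1] by simp

lemma evalf_mult: "evalf \<phi> (x * y) = evalf \<phi> x * evalf \<phi> y"
proof -
  have "x * y = (\<Sum>v\<in>Poly_Mapping.keys x. \<Sum>w\<in>Poly_Mapping.keys y.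
      Poly_Mapping.single (v + w) (Poly_Mapping.lookup x v * Poly_Mapping.lookup y w))"
    by (subst poly_mapping_sum_singles[of x], subst poly_mapping_sum_singles[of y])
      (simp add: sum_product mult_single)
  also have "evalf \<phi> \<dots> = evalf \<phi> x * evalf \<phi> y"
    unfolding evalf_sum evalf_single evalw_plus cs_mult unfolding evalf_def sum_product
    by (simp only: mult.assoc cs_commute_left[of "evalw \<phi> w" for w])
  finally show ?thesis .
qed

lemma evalf_minus: "evalf \<phi> (- x) = - evalf \<phi> x"
  using evalf_add[of \<phi> x "- x"] by (simp add: eq_neg_iff_add_eq_0 add.commute)

lemma evalf_diff: "evalf \<phi> (x - y) = evalf \<phi> x - evalf \<phi> y"
  using evalf_add[of \<phi> x "- y"] by (simp add: evalf_minus)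

definition beta :: "nat \<Rightarrow> nat \<Rightarrow> nat \<Rightarrow> free_elem \<Rightarrow> state endo" where
  "beta M N m = evalf (\<lambda>(i, j, r). tT M N m i j $ r)"

section \<open>The free superalgebra and the Yangian as rings\<close>

definition in_range :: "nat \<Rightarrow> nat \<Rightarrow> gen_word \<Rightarrow> bool" where
  "in_range M N w \<longleftrightarrow> set (letters w) \<subseteq> yangian_letters M N"

lemma in_range_plus: "in_range M N (v + w) \<longleftrightarrow> in_range M N v \<and> in_range M N w"
  by (simp add: in_range_def plus_gen_word_def)

lemma in_range_0 [simp]: "in_range M N 0"
  by (simp add: in_range_def zero_gen_word_def)

lemma keys_mult_cases:
  assumes "w \<in> Poly_Mapping.keys (x * y :: free_elem)"
  obtains u v where "w = u + v" "u \<in> Poly_Mapping.keys x" "v \<in> Poly_Mapping.keys y"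
  using assms keys_mult[of x y] by blast

lemma keys_scale: "Poly_Mapping.keys (Poly_Mapping.single 0 c * x :: free_elem) \<subseteq> Poly_Mapping.keys x"
  by (auto elim!: keys_mult_cases split: if_splits)

lemma single_0_sign: "Poly_Mapping.single 0 ((- 1) ^ n) = ((- 1) ^ n :: free_elem)"
  by (cases "even n") (simp_all add: single_uminus)

lemma single_0_commute: "Poly_Mapping.single 0 c * x = (x * Poly_Mapping.single 0 c :: free_elem)"
  by (subst (1 2) poly_mapping_sum_singles[of x])
    (simp add: sum_distrib_left sum_distrib_right mult_single mult.commute)

definition hp :: "nat \<Rightarrow> nat \<Rightarrow> free_elem \<Rightarrow> free_elem" where
  "hp M p x = (\<Sum>w\<in>{w \<in> Poly_Mapping.keys x. word_parity M w = p}.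
     Poly_Mapping.single w (Poly_Mapping.lookup x w))"

lemma lookup_hp: "Poly_Mapping.lookup (hp M p x) w = (if word_parity M w = p then Poly_Mapping.lookup x w else 0)"
  by (auto simp: hp_def lookup_sum lookup_single when_def in_keys_iff)

lemma hp_add: "hp M p (x + y) = hp M p x + hp M p y"
  by (rule poly_mapping_eqI) (simp add: lookup_hp lookup_add)

lemma hp_0 [simp]: "hp M p 0 = 0"
  by (rule poly_mapping_eqI) (simp add: lookup_hp)

lemma hp_diff: "hp M p (x - y) = hp M p x - hp M p y"
  by (rule poly_mapping_eqI) (simp add: lookup_hp lookup_minus)

lemma word_parity_less: "word_parity M w < 2"
  by (simp add: word_parity_def)

lemma hp_split: "hp M 0 x + hp M 1 x = x"
proof (rule poly_mapping_eqI)
  fix w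
  show "Poly_Mapping.lookup (hp M 0 x + hp M 1 x) w = Poly_Mapping.lookup x w"
    using word_parity_less[of M w] by (auto simp: lookup_hp lookup_add less_2_cases_iff)
qed

lemma keys_hp: "Poly_Mapping.keys (hp M p x) \<subseteq> Poly_Mapping.keys x"
  by (auto simp: in_keys_iff lookup_hp split: if_splits)

definition homogeneous :: "nat \<Rightarrow> nat \<Rightarrow> free_elem \<Rightarrow> bool" where
  "homogeneous M p x \<longleftrightarrow> (\<forall>w\<in>Poly_Mapping.keys x. word_parity M w = p)"

lemma hp_homogeneous: "homogeneous M p x \<Longrightarrow> hp M p' x = (if p' = p then x else 0)"
  by (rule poly_mapping_eqI) (auto simp: lookup_hp homogeneous_def in_keys_iff)

lemma homogeneous_hp: "homogeneous M p (hp M p x)"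
  by (auto simp: homogeneous_def in_keys_iff lookup_hp split: if_splits)

lemma homogeneous_diff: "homogeneous M p x \<Longrightarrow> homogeneous M p y \<Longrightarrow> homogeneous M p (x - y)"
  using keys_diff[of x y] unfolding homogeneous_def by blast

lemma word_parity_plus: "word_parity M (v + w) = (word_parity M v + word_parity M w) mod 2"
  by (simp add: word_parity_def plus_gen_word_def mod_simps)

lemma homogeneous_mult: "homogeneous M p x \<Longrightarrow> homogeneous M q y \<Longrightarrow> homogeneous M ((p + q) mod 2) (x * y)"
  unfolding homogeneous_def by (auto elim!: keys_mult_cases simp: word_parity_plus)

lemma homogeneous_scale: "homogeneous M p x \<Longrightarrow> homogeneous M p (Poly_Mapping.single 0 c * x)"
  using keys_scale[of c x] unfolding homogeneous_def by blast

lemma homogeneous_free_T: "homogeneous M ((parity M i + parity M j) mod 2) (free_T i j r)"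
  by (auto simp: homogeneous_def free_T_def word_parity_def zero_gen_word_def)

context
  fixes M N :: nat
begin

abbreviation (input) "FA \<equiv> free_superalg M N"
abbreviation (input) "YI \<equiv> yangian_ideal M N"
abbreviation (input) "Yg \<equiv> yangian M N"

definition FC :: "free_elem set" where
  "FC = {x. \<forall>w\<in>Poly_Mapping.keys x. in_range M N w}"

lemma FA_simps [simp]:
  "carrier FA = FC" "Group.monoid.mult FA = (*)" "Group.monoid.one FA = 1" "ring.zero FA = 0" "ring.add FA = (+)"
  "module.smult FA = (\<lambda>c x. Poly_Mapping.single 0 c * x)" "hpart FA = hp M"
  by (auto simp: free_superalg_def FC_def in_range_def hp_def fun_eq_iff)

lemma FC_0 [simp]: "0 \<in> FC" and FC_1 [simp]: "1 \<in> FC"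
  by (simp_all add: FC_def)

lemma FC_add [simp]: "x \<in> FC \<Longrightarrow> y \<in> FC \<Longrightarrow> x + y \<in> FC"
  using Poly_Mapping.keys_add[of x y] unfolding FC_def by blast

lemma FC_uminus [simp]: "x \<in> FC \<Longrightarrow> - x \<in> FC"
  by (simp add: FC_def)

lemma FC_diff [simp]: "x \<in> FC \<Longrightarrow> y \<in> FC \<Longrightarrow> x - y \<in> FC"
  using FC_add[of x "- y"] by simp

lemma FC_mult [simp]: "x \<in> FC \<Longrightarrow> y \<in> FC \<Longrightarrow> x * y \<in> FC"
  unfolding FC_def by (auto elim!: keys_mult_cases simp: in_range_plus)

lemma FC_scale [simp]: "x \<in> FC \<Longrightarrow> Poly_Mapping.single 0 c * x \<in> FC"
  using keys_scale[of c x] unfolding FC_def by blast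

lemma FC_single_0 [simp]: "Poly_Mapping.single 0 c \<in> FC"
  by (simp add: FC_def)

lemma FC_sum: "(\<And>a. a \<in> A \<Longrightarrow> f a \<in> FC) \<Longrightarrow> sum f A \<in> FC"
  by (induction A rule: infinite_finite_induct) auto

lemma FC_hp [simp]: "x \<in> FC \<Longrightarrow> hp M p x \<in> FC"
  using keys_hp[of M p x] unfolding FC_def by blast

lemma FC_sign [simp]: "x \<in> FC \<Longrightarrow> (- 1) ^ n * x \<in> FC"
  by (cases "even n") auto

lemma FC_free_T: "i \<in> {1..M + N} \<Longrightarrow> j \<in> {1..M + N} \<Longrightarrow> free_T i j r \<in> FC"
  by (auto simp: FC_def free_T_def in_range_def yangian_letters_def zero_gen_word_def)

lemma ring_FA: "ring FA"
proof (rule ringI)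
  show "abelian_group FA"
  proof (rule abelian_groupI)
    fix x assume "x \<in> carrier FA"
    then have "- x \<in> carrier FA \<and> - x \<oplus>\<^bsub>FA\<^esub> x = \<zero>\<^bsub>FA\<^esub>" by simp
    then show "\<exists>y\<in>carrier FA. y \<oplus>\<^bsub>FA\<^esub> x = \<zero>\<^bsub>FA\<^esub>" by blast
  qed (simp_all add: add_ac)
  show "Group.monoid FA"
    by (rule monoidI) (simp_all add: mult.assoc)
qed (simp_all add: distrib_left distrib_right)

lemma FA_uminus: "x \<in> FC \<Longrightarrow> \<ominus>\<^bsub>FA\<^esub> x = - x"
  using abelian_group.minus_equality[OF ring.is_abelian_group[OF ring_FA], of "- x" x] by simp

lemma FA_minus: "x \<in> FC \<Longrightarrow> y \<in> FC \<Longrightarrow> x \<ominus>\<^bsub>FA\<^esub> y = x - y"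
  by (simp add: a_minus_def FA_uminus)

lemma FA_finsum:
  assumes "finite A" "\<And>a. a \<in> A \<Longrightarrow> f a \<in> FC"
  shows "finsum FA f A = sum f A"
proof -
  interpret ring FA by (rule ring_FA)
  show ?thesis using assms
    by (induction A rule: finite_induct) (simp_all add: Pi_def)
qed

lemma FA_supercomm:
  assumes "x \<in> FC" "y \<in> FC"
  shows "supercomm FA x y = (\<Sum>p\<in>{0, 1}. \<Sum>q\<in>{0, 1}. hp M p x * hp M q y - (- 1) ^ (p * q) * (hp M q y * hp M p x))"
proof -
  have 1: "hp M p x * hp M q y \<ominus>\<^bsub>FA\<^esub> Poly_Mapping.single 0 ((- 1) ^ (p * q)) * (hp M q y * hp M p x) =
      hp M p x * hp M q y - (- 1) ^ (p * q) * (hp M q y * hp M p x)" for p q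
    using assms by (subst FA_minus) (simp_all only: FC_hp FC_mult FC_scale FC_sign single_0_sign)
  have "supercomm FA x y = (\<Sum>p\<in>{0, 1}. finsum FA
      (\<lambda>q. hp M p x * hp M q y - (- 1) ^ (p * q) * (hp M q y * hp M p x)) {0, 1})"
    unfolding supercomm_def FA_simps 1 using assms
    by (intro FA_finsum) (auto intro!: FC_sum simp: FA_finsum)
  also have "\<dots> = (\<Sum>p\<in>{0, 1}. \<Sum>q\<in>{0, 1}. hp M p x * hp M q y - (- 1) ^ (p * q) * (hp M q y * hp M p x))"
    using assms by (intro sum.cong refl FA_finsum) auto
  finally show ?thesis .
qed

lemma FA_supercomm_homogeneous:
  assumes "x \<in> FC" "y \<in> FC" "homogeneous M (p mod 2) x" "homogeneous M (q mod 2) y"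
  shows "supercomm FA x y = x * y - (- 1) ^ (p * q) * (y * x)"
proof -
  have sg: "(- 1 :: free_elem) ^ (p * q) = (- 1) ^ ((p mod 2) * (q mod 2))"
    by (rule sign_cong) auto
  have pq: "p mod 2 \<in> {0, 1}" "q mod 2 \<in> {0, 1}" by auto
  have "supercomm FA x y = (\<Sum>p'\<in>{0, 1}. \<Sum>q'\<in>{0, 1}. if p' = p mod 2 then if q' = q mod 2 then
      x * y - (- 1) ^ (p' * q') * (y * x) else 0 else 0)"
    unfolding FA_supercomm[OF assms(1,2)] hp_homogeneous[OF assms(3)] hp_homogeneous[OF assms(4)]
    by (intro sum.cong refl) auto
  also have "\<dots> = x * y - (- 1) ^ ((p mod 2) * (q mod 2)) * (y * x)"
    using pq by auto
  finally show ?thesis unfolding sg .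
qed

definition relators :: "free_elem set" where
  "relators = {yangian_relator M N i j k l r s | i j k l r s. {i, j, k, l} \<subseteq> {1..M + N}}"

definition T_bracket :: "nat \<Rightarrow> nat \<Rightarrow> nat \<Rightarrow> nat \<Rightarrow> int \<Rightarrow> int \<Rightarrow> free_elem" where
  "T_bracket i j k l r s = free_T i j r * free_T k l s -
     (- 1) ^ ((parity M i + parity M j) * (parity M k + parity M l)) * (free_T k l s * free_T i j r)"

lemma yangian_relator_eq:
  assumes "{i, j, k, l} \<subseteq> {1..M + N}"
  shows "yangian_relator M N i j k l r s =
    (- 1) ^ (parity M i * parity M k + parity M i * parity M l + parity M k * parity M l) *
      (T_bracket i j k l (r + 1) s - T_bracket i j k l r (s + 1)) -
    (free_T k j r * free_T i l s - free_T k j s * free_T i l r)"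
proof -
  have "supercomm FA (free_T i j r) (free_T k l s) = T_bracket i j k l r s" for r s
    unfolding T_bracket_def using assms
    by (intro FA_supercomm_homogeneous FC_free_T homogeneous_free_T) auto
  then show ?thesis
    unfolding yangian_relator_def Let_def single_0_sign by simp
qed

lemma T_bracket_FC: "{i, j, k, l} \<subseteq> {1..M + N} \<Longrightarrow> T_bracket i j k l r s \<in> FC"
  unfolding T_bracket_def by (intro FC_diff FC_mult FC_sign FC_free_T) auto

lemma relators_FC: "relators \<subseteq> FC"
  unfolding relators_def by (auto simp: yangian_relator_eq intro!: FC_diff FC_sign FC_mult FC_free_T T_bracket_FC)

lemma ideal_YI: "ideal YI FA"
  unfolding yangian_ideal_def relators_def[symmetric]
  by (rule ring.genideal_ideal[OF ring_FA]) (simp add: relators_FC)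

lemma YI_minimal: "ideal J FA \<Longrightarrow> relators \<subseteq> J \<Longrightarrow> YI \<subseteq> J"
  unfolding yangian_ideal_def relators_def[symmetric] by (rule ring.genideal_minimal[OF ring_FA])

lemma relators_YI: "relators \<subseteq> YI"
  unfolding yangian_ideal_def relators_def[symmetric]
  by (rule ring.genideal_self[OF ring_FA]) (simp add: relators_FC)

lemma ideal_FA_I:
  assumes "J \<subseteq> FC" "0 \<in> J" "\<And>x y. x \<in> J \<Longrightarrow> y \<in> J \<Longrightarrow> x + y \<in> J" "\<And>x. x \<in> J \<Longrightarrow> - x \<in> J"
    "\<And>x y. x \<in> J \<Longrightarrow> y \<in> FC \<Longrightarrow> y * x \<in> J" "\<And>x y. x \<in> J \<Longrightarrow> y \<in> FC \<Longrightarrow> x * y \<in> J"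
  shows "ideal J FA"
proof (rule idealI)
  show "subgroup J (add_monoid FA)"
  proof
    fix x assume "x \<in> J"
    then show "inv\<^bsub>add_monoid FA\<^esub> x \<in> J"
      using assms(1,4) FA_uminus[of x] unfolding a_inv_def by auto
  qed (use assms in auto)
qed (use assms ring_FA in auto)

lemma YI_FC: "x \<in> YI \<Longrightarrow> x \<in> FC"
  using ideal.Icarr[OF ideal_YI] by simp

lemma YI_0 [simp]: "0 \<in> YI"
  using additive_subgroup.zero_closed[OF ideal.axioms(1)[OF ideal_YI]] by simp

lemma YI_add: "x \<in> YI \<Longrightarrow> y \<in> YI \<Longrightarrow> x + y \<in> YI"
  using additive_subgroup.a_closed[OF ideal.axioms(1)[OF ideal_YI]] by simp

lemma YI_mult_left: "x \<in> YI \<Longrightarrow> y \<in> FC \<Longrightarrow> y * x \<in> YI"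
  using ideal.I_l_closed[OF ideal_YI] by simp

lemma YI_mult_right: "x \<in> YI \<Longrightarrow> y \<in> FC \<Longrightarrow> x * y \<in> YI"
  using ideal.I_r_closed[OF ideal_YI] by simp

lemma YI_scale: "x \<in> YI \<Longrightarrow> Poly_Mapping.single 0 c * x \<in> YI"
  by (rule YI_mult_left) simp_all

lemma YI_sign: "x \<in> YI \<Longrightarrow> (- 1) ^ n * x \<in> YI"
  using YI_scale[of x "(- 1) ^ n"] unfolding single_0_sign .

lemma YI_uminus: "x \<in> YI \<Longrightarrow> - x \<in> YI"
  using YI_sign[of x 1] by simp

lemma YI_diff: "x \<in> YI \<Longrightarrow> y \<in> YI \<Longrightarrow> x - y \<in> YI"
  using YI_add[of x "- y"] YI_uminus[of y] by simp

lemma homogeneous_sign: "homogeneous M p x \<Longrightarrow> homogeneous M p ((- 1) ^ n * x)"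
  using homogeneous_scale[of M p x "(- 1) ^ n"] unfolding single_0_sign .

lemma homogeneous_T_bracket:
  "homogeneous M ((parity M i + parity M j + parity M k + parity M l) mod 2) (T_bracket i j k l r s)"
proof -
  have e1: "((parity M i + parity M j) mod 2 + (parity M k + parity M l) mod 2) mod 2 =
      (parity M i + parity M j + parity M k + parity M l) mod 2"
    unfolding mod_add_eq by (simp only: add_ac)
  have e2: "((parity M k + parity M l) mod 2 + (parity M i + parity M j) mod 2) mod 2 =
      (parity M i + parity M j + parity M k + parity M l) mod 2"
    unfolding mod_add_eq by (simp only: add_ac)
  note 1 = homogeneous_mult[OF homogeneous_free_T[of M i j r] homogeneous_free_T[of M k l s], unfolded e1]
  note 2 = homogeneous_mult[OF homogeneous_free_T[of M k l s] homogeneous_free_T[of M i j r], unfolded e2]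
  show ?thesis
    unfolding T_bracket_def by (intro homogeneous_diff homogeneous_sign 1 2)
qed

lemma homogeneous_relator:
  assumes "{i, j, k, l} \<subseteq> {1..M + N}"
  shows "homogeneous M ((parity M i + parity M j + parity M k + parity M l) mod 2) (yangian_relator M N i j k l r s)"
proof -
  have e: "((parity M k + parity M j) mod 2 + (parity M i + parity M l) mod 2) mod 2 =
      (parity M i + parity M j + parity M k + parity M l) mod 2"
    unfolding mod_add_eq by (simp only: add_ac)
  note 1 = homogeneous_mult[OF homogeneous_free_T[of M k j r] homogeneous_free_T[of M i l s], unfolded e]
    homogeneous_mult[OF homogeneous_free_T[of M k j s] homogeneous_free_T[of M i l r], unfolded e]
  show ?thesis
    unfolding yangian_relator_eq[OF assms]
    by (intro homogeneous_diff homogeneous_sign homogeneous_T_bracket 1)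
qed

lemma hp_mult:
  assumes "p < 2"
  shows "hp M p (x * y) = hp M p x * hp M 0 y + hp M (1 - p) x * hp M 1 y"
proof -
  have h: "hp M p (hp M a x * hp M b y) = (if p = (a + b) mod 2 then hp M a x * hp M b y else 0)" for a b
    by (rule hp_homogeneous[OF homogeneous_mult[OF homogeneous_hp homogeneous_hp]])
  have "x * y = (hp M 0 x + hp M 1 x) * (hp M 0 y + hp M 1 y)"
    by (simp only: hp_split)
  also have "hp M p \<dots> = hp M p (hp M 0 x * hp M 0 y) + hp M p (hp M 0 x * hp M 1 y) +
      (hp M p (hp M 1 x * hp M 0 y) + hp M p (hp M 1 x * hp M 1 y))"
    by (simp only: distrib_left distrib_right hp_add add_ac)
  finally show ?thesis
    using assms unfolding h by (auto simp: less_2_cases_iff)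
qed

lemma hp_uminus: "hp M p (- x) = - hp M p x"
  using hp_diff[of M p 0 x] by simp

text \<open>The elements both of whose parity components lie in the ideal form an ideal themselves,
  and it contains the relators because they are homogeneous. This makes the projections well defined
  on the quotient.\<close>

lemma YI_hp:
  assumes "x \<in> YI"
  shows "hp M p x \<in> YI"
proof -
  let ?J = "{x \<in> FC. \<forall>p<2. hp M p x \<in> YI}"
  have "ideal ?J FA"
  proof (rule ideal_FA_I)
    fix x y assume x: "x \<in> ?J" and y: "y \<in> FC"
    then show "x * y \<in> ?J"
      by (auto simp: hp_mult intro!: YI_add YI_mult_right)
    show "y * x \<in> ?J"
      using x y by (auto simp: hp_mult intro!: YI_add YI_mult_left)
  qed (auto simp: hp_add hp_uminus intro: YI_add YI_uminus)
  moreover have "relators \<subseteq> ?J"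
  proof
    fix x assume x: "x \<in> relators"
    then obtain i j k l r s where eq: "x = yangian_relator M N i j k l r s" and idx: "{i, j, k, l} \<subseteq> {1..M + N}"
      unfolding relators_def by blast
    have "hp M p x = (if p = (parity M i + parity M j + parity M k + parity M l) mod 2 then x else 0)" for p
      unfolding eq by (rule hp_homogeneous[OF homogeneous_relator[OF idx]])
    then show "x \<in> ?J" using x relators_YI relators_FC by auto
  qed
  ultimately have "YI \<subseteq> ?J" by (rule YI_minimal)
  show ?thesis
  proof (cases "p < 2")
    case True
    then show ?thesis using assms \<open>YI \<subseteq> ?J\<close> by blast
  next
    case False
    then have "hp M p x = 0"
      using word_parity_less[of M] by (intro poly_mapping_eqI) (auto simp: lookup_hp)
    then show ?thesis by simp
  qed
qed

section \<open>Cosets and the operations of the Yangian\<close>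

definition cls :: "free_elem \<Rightarrow> free_elem set" where
  "cls x = YI +>\<^bsub>FA\<^esub> x"

lemma cls_eq_iff: "x \<in> FC \<Longrightarrow> y \<in> FC \<Longrightarrow> cls x = cls y \<longleftrightarrow> x - y \<in> YI"
  using ring.quotient_eq_iff_same_a_r_cos[OF ring_FA ideal_YI, of x y] by (simp add: cls_def FA_minus)

lemma mem_cls: "z \<in> cls x \<longleftrightarrow> (\<exists>h\<in>YI. z = h + x)"
  by (auto simp: cls_def a_r_coset_def')

lemma cls_self: "x \<in> cls x"
  by (simp add: mem_cls)

lemma cls_0: "cls 0 = YI"
  by (auto simp: mem_cls)

lemma carrier_Yg: "carrier Yg = cls ` FC"
  by (auto simp: yangian_def quot_superalg_def FactRing_def A_RCOSETS_def' cls_def)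

lemma one_Yg: "\<one>\<^bsub>Yg\<^esub> = cls 1"
  by (simp add: yangian_def quot_superalg_def FactRing_def cls_def)

lemma zero_Yg: "\<zero>\<^bsub>Yg\<^esub> = cls 0"
  by (simp add: yangian_def quot_superalg_def FactRing_def cls_0)

lemma mult_Yg: "x \<in> FC \<Longrightarrow> y \<in> FC \<Longrightarrow> cls x \<otimes>\<^bsub>Yg\<^esub> cls y = cls (x * y)"
  using ideal.rcoset_mult_add[OF ideal_YI, of x y]
  by (simp add: yangian_def quot_superalg_def FactRing_def cls_def)

lemma add_Yg: "x \<in> FC \<Longrightarrow> y \<in> FC \<Longrightarrow> cls x \<oplus>\<^bsub>Yg\<^esub> cls y = cls (x + y)"
  using abelian_subgroup.a_rcos_sum[OF abelian_subgroupI3[OF ideal.axioms(1)[OF ideal_YI]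
      ring.is_abelian_group[OF ring_FA]], of x y]
  by (simp add: yangian_def quot_superalg_def FactRing_def cls_def)

text \<open>Scalar action and parity projections of the quotient are unions over all
  representatives; the last hypothesis says that every representative yields the same coset.\<close>

lemma UN_cls:
  assumes "x \<in> FC" "\<And>y. y \<in> FC \<Longrightarrow> f y \<in> FC" "\<And>h. h \<in> YI \<Longrightarrow> f (h + x) - f x \<in> YI"
  shows "(\<Union>y\<in>cls x. cls (f y)) = cls (f x)"
proof -
  have "cls (f y) = cls (f x)" if y: "y \<in> cls x" for y
  proof -
    obtain h where h: "h \<in> YI" "y = h + x" using y by (auto simp: mem_cls)
    then have "y \<in> FC" "f y - f x \<in> YI" using assms YI_FC by auto
    then show ?thesis using assms by (subst cls_eq_iff) auto
  qed
  then show ?thesis using cls_self[of x] by blast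
qed

lemma smult_Yg: "x \<in> FC \<Longrightarrow> c \<odot>\<^bsub>Yg\<^esub> cls x = cls (Poly_Mapping.single 0 c * x)"
  using UN_cls[of x "\<lambda>x. Poly_Mapping.single 0 c * x"]
  by (simp add: yangian_def quot_superalg_def distrib_left YI_scale cls_def)

lemma hpart_Yg: "x \<in> FC \<Longrightarrow> hpart Yg p (cls x) = cls (hp M p x)"
  using UN_cls[of x "hp M p"]
  by (simp add: yangian_def quot_superalg_def hp_add YI_hp cls_def)

lemma ring_Yg: "ring Yg"
proof (rule ringI)
  show "abelian_group Yg"
  proof (rule abelian_groupI)
    fix X assume "X \<in> carrier Yg"
    then obtain x where x: "X = cls x" "x \<in> FC" by (auto simp: carrier_Yg)
    then have "cls (- x) \<in> carrier Yg \<and> cls (- x) \<oplus>\<^bsub>Yg\<^esub> X = \<zero>\<^bsub>Yg\<^esub>"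
      by (auto simp: add_Yg zero_Yg carrier_Yg)
    then show "\<exists>y\<in>carrier Yg. y \<oplus>\<^bsub>Yg\<^esub> X = \<zero>\<^bsub>Yg\<^esub>" by blast
  qed (auto simp: carrier_Yg add_Yg zero_Yg add_ac)
  show "Group.monoid Yg"
    by (rule monoidI) (auto simp: carrier_Yg mult_Yg one_Yg mult.assoc)
qed (auto simp: carrier_Yg mult_Yg add_Yg distrib_left distrib_right)

lemma uminus_Yg: "x \<in> FC \<Longrightarrow> \<ominus>\<^bsub>Yg\<^esub> (cls x) = cls (- x)"
  by (rule abelian_group.minus_equality[OF ring.is_abelian_group[OF ring_Yg]])
    (auto simp: carrier_Yg add_Yg zero_Yg)

lemma minus_Yg: "x \<in> FC \<Longrightarrow> y \<in> FC \<Longrightarrow> cls x \<ominus>\<^bsub>Yg\<^esub> cls y = cls (x - y)"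
  by (simp add: a_minus_def uminus_Yg add_Yg)

lemma finsum_Yg:
  assumes "finite A" "\<And>a. a \<in> A \<Longrightarrow> f a \<in> FC"
  shows "finsum Yg (\<lambda>a. cls (f a)) A = cls (sum f A)"
proof -
  interpret ring Yg by (rule ring_Yg)
  show ?thesis using assms
  proof (induction A rule: finite_induct)
    case empty
    then show ?case by (simp add: zero_Yg)
  next
    case (insert a A)
    have "(\<lambda>a. cls (f a)) \<in> A \<rightarrow> carrier Yg" "cls (f a) \<in> carrier Yg"
      using insert by (auto simp: carrier_Yg)
    then have "finsum Yg (\<lambda>a. cls (f a)) (insert a A) = cls (f a) \<oplus>\<^bsub>Yg\<^esub> finsum Yg (\<lambda>a. cls (f a)) A"
      using insert by simp
    also have "\<dots> = cls (sum f (insert a A))"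
      using insert by (simp add: add_Yg FC_sum)
    finally show ?case .
  qed
qed

lemma finsum_Yg':
  assumes "finite A" "\<And>a. a \<in> A \<Longrightarrow> g a = cls (f a)" "\<And>a. a \<in> A \<Longrightarrow> f a \<in> FC"
  shows "finsum Yg g A = cls (sum f A)"
proof -
  interpret ring Yg by (rule ring_Yg)
  have "finsum Yg g A = finsum Yg (\<lambda>a. cls (f a)) A"
    using assms by (intro add.finprod_cong') (auto simp: carrier_Yg)
  then show ?thesis using finsum_Yg[OF assms(1,3)] by simp
qed

lemma supercomm_Yg:
  assumes "x \<in> FC" "y \<in> FC"
  shows "supercomm Yg (cls x) (cls y) =
    cls (\<Sum>p\<in>{0, 1}. \<Sum>p'\<in>{0, 1}. hp M p x * hp M p' y - (- 1) ^ (p * p') * (hp M p' y * hp M p x))"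
  unfolding supercomm_def using assms
  by (intro finsum_Yg' FC_sum)
    (auto simp: hpart_Yg mult_Yg smult_Yg minus_Yg single_0_sign)

end

section \<open>The representations of the Yangian\<close>

lemma tT_0:
  assumes "i \<in> {1..M + N}"
  shows "tT M N m i j $ 0 = (if i = j then 1 else 0)"
  using assms
proof (induction m arbitrary: j)
  case (Suc m)
  have "tT M N (Suc m) i j $ 0 = (\<Sum>c\<in>{1..M + N}. if c = i then if i = j then 1 else 0 else 0)"
    unfolding tT.simps fps_sum_nth fps_sign_nth
    using Suc by (intro sum.cong refl) (auto simp: fps_mult_nth)
  then show ?case using Suc.prems by simp
qed simp

lemma beta_add: "beta M N m (x + y) = beta M N m x + beta M N m y"
  and beta_diff: "beta M N m (x - y) = beta M N m x - beta M N m y"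
  and beta_mult: "beta M N m (x * y) = beta M N m x * beta M N m y"
  and beta_uminus: "beta M N m (- x) = - beta M N m x"
  and beta_sum: "beta M N m (sum f A) = (\<Sum>a\<in>A. beta M N m (f a))"
  and beta_0: "beta M N m 0 = 0" and beta_1: "beta M N m 1 = 1"
  and beta_scale: "beta M N m (Poly_Mapping.single 0 c * x) = cs c * beta M N m x"
  by (simp_all add: beta_def evalf_add evalf_diff evalf_mult evalf_minus evalf_sum evalf_single)

lemma beta_sign: "beta M N m ((- 1) ^ n) = (- 1) ^ n"
  using beta_scale[of M N m "(- 1) ^ n" 1] by (simp only: single_0_sign cs_sign mult_1_right beta_1)

lemma beta_free_T:
  assumes "i \<in> {1..M + N}"
  shows "beta M N m (free_T i j r) = (if r < 0 then 0 else tT M N m i j $ nat r)"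
  using tT_0[OF assms, of m j]
  by (auto simp: free_T_def beta_def evalf_single evalw_def)

context
  fixes M N :: nat
begin

lemma beta_T_bracket:
  assumes "{i, j, k, l} \<subseteq> {1..M + N}"
  shows "beta M N m (T_bracket M i j k l r s) =
    (if r < 0 \<or> s < 0 then 0 else rtt_coeff M (\<lambda>i j n. tT M N m i j $ n) i j k l (nat r) (nat s))"
  using assms by (simp add: T_bracket_def beta_diff beta_sign beta_mult beta_free_T rtt_coeff_def)

lemma beta_relator:
  assumes "{i, j, k, l} \<subseteq> {1..M + N}"
  shows "beta M N m (yangian_relator M N i j k l r s) = 0"
proof -
  let ?c = "rtt_coeff M (\<lambda>i j n. tT M N m i j $ n) i j k l"
  let ?e = "(- 1 :: state endo) ^ (parity M i * parity M k + parity M i * parity M l + parity M k * parity M l)"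
  have rtt: "?c r 0 = 0" "?c 0 s = 0" "?c (Suc r) s - ?c r (Suc s) =
       ?e * (tT M N m k j $ r * tT M N m i l $ s - tT M N m k j $ s * tT M N m i l $ r)" for r s
    using rtt_series_tT[of M N m] assms unfolding rtt_series_iff by auto
  note eq = yangian_relator_eq[OF assms, of r s]
  show ?thesis
  \<comment> \<open>Negative indices occur because multiplication by u - v shifts by one. If an
    index is -1, the bracket in which it is raised has an index 0 and vanishes.\<close>
  proof (cases "r < 0 \<or> s < 0")
    case True
    have "beta M N m (T_bracket M i j k l (r + 1) s) = 0"
    proof (cases "s < 0 \<or> r < - 1")
      case False
      with True have "r = - 1" by auto
      then show ?thesis by (simp add: beta_T_bracket[OF assms] rtt)
    qed (auto simp: beta_T_bracket[OF assms])
    moreover have "beta M N m (T_bracket M i j k l r (s + 1)) = 0"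
    proof (cases "r < 0 \<or> s < - 1")
      case False
      with True have "s = - 1" by auto
      then show ?thesis by (simp add: beta_T_bracket[OF assms] rtt)
    qed (auto simp: beta_T_bracket[OF assms])
    ultimately show ?thesis
      unfolding eq using True assms by (auto simp: beta_diff beta_sign beta_mult beta_free_T)
  next
    case False
    then obtain r' s' where rs: "r = int r'" "s = int s'" by (metis nonneg_int_cases not_less)
    have nat: "nat (int r' + 1) = Suc r'" "nat (int s' + 1) = Suc s'" by auto
    have "beta M N m (T_bracket M i j k l (r + 1) s) - beta M N m (T_bracket M i j k l r (s + 1)) =
        ?e * (tT M N m k j $ r' * tT M N m i l $ s' - tT M N m k j $ s' * tT M N m i l $ r')"
      unfolding rs rtt(3)[symmetric] by (simp add: beta_T_bracket[OF assms] nat)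
    then have "beta M N m (yangian_relator M N i j k l r s) =
        ?e * (?e * (tT M N m k j $ r' * tT M N m i l $ s' - tT M N m k j $ s' * tT M N m i l $ r')) -
        (tT M N m k j $ r' * tT M N m i l $ s' - tT M N m k j $ s' * tT M N m i l $ r')"
      unfolding eq using assms by (simp add: beta_diff beta_sign beta_mult beta_free_T rs)
    then show ?thesis unfolding sign_square by simp
  qed
qed

lemma beta_YI:
  assumes "x \<in> yangian_ideal M N"
  shows "beta M N m x = 0"
proof -
  have "ideal {x \<in> FC M N. beta M N m x = 0} (free_superalg M N)"
    by (rule ideal_FA_I) (auto simp: beta_add beta_mult beta_uminus beta_0)
  moreover have "relators M N \<subseteq> {x \<in> FC M N. beta M N m x = 0}"
  proof
    fix x assume x: "x \<in> relators M N"
    then obtain i j k l r s where eq: "x = yangian_relator M N i j k l r s" and idx: "{i, j, k, l} \<subseteq> {1..M + N}"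
      unfolding relators_def by blast
    have "beta M N m x = 0" unfolding eq by (rule beta_relator[OF idx])
    then show "x \<in> {x \<in> FC M N. beta M N m x = 0}" using x relators_FC[of M N] by blast
  qed
  ultimately show ?thesis using YI_minimal assms by blast
qed

section \<open>The lexicographic filtration\<close>

definition wdeg :: "gen_word \<Rightarrow> nat" where
  "wdeg w = (\<Sum>(i, j, r)\<leftarrow>letters w. r - 1)"

definition wlen :: "gen_word \<Rightarrow> nat" where
  "wlen w = length (letters w)"

lemma wdeg_plus [simp]: "wdeg (v + w) = wdeg v + wdeg w"
  and wlen_plus [simp]: "wlen (v + w) = wlen v + wlen w"
  by (simp_all add: wdeg_def wlen_def plus_gen_word_def)

definition low :: "nat \<Rightarrow> nat \<Rightarrow> gen_word \<Rightarrow> bool" where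
  "low d p w \<longleftrightarrow> wdeg w < d \<or> wdeg w = d \<and> wlen w < p"

text \<open>The bounds are strict: \<open>G 0 0\<close> is the ideal, words of degree
  \<open>d\<close> and length \<open>p\<close> lie in \<open>G d (Suc p)\<close>, and
  \<open>G (Suc d) 0\<close> is the union of the \<open>G d p\<close> over all
  \<open>p\<close>.\<close>

definition G :: "nat \<Rightarrow> nat \<Rightarrow> free_elem set" where
  "G d p = {x \<in> FC M N. \<exists>y\<in>FC M N. x - y \<in> yangian_ideal M N \<and> (\<forall>w\<in>Poly_Mapping.keys y. low d p w)}"

lemma G_I: "y \<in> FC M N \<Longrightarrow> x \<in> FC M N \<Longrightarrow> x - y \<in> yangian_ideal M N \<Longrightarrow>
    (\<And>w. w \<in> Poly_Mapping.keys y \<Longrightarrow> low d p w) \<Longrightarrow> x \<in> G d p"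
  unfolding G_def by blast

lemma G_FC: "x \<in> G d p \<Longrightarrow> x \<in> FC M N"
  by (simp add: G_def)

lemma G_YI: "x \<in> yangian_ideal M N \<Longrightarrow> x \<in> G d p"
  by (rule G_I[of 0]) (auto intro: YI_FC)

lemma G_0 [simp]: "0 \<in> G d p"
  by (rule G_YI) simp

lemma G_add:
  assumes "x \<in> G d p" "y \<in> G d p"
  shows "x + y \<in> G d p"
proof -
  obtain x' y' where x': "x' \<in> FC M N" "x - x' \<in> yangian_ideal M N" "\<forall>w\<in>Poly_Mapping.keys x'. low d p w"
    and y': "y' \<in> FC M N" "y - y' \<in> yangian_ideal M N" "\<forall>w\<in>Poly_Mapping.keys y'. low d p w"
    using assms unfolding G_def by blast
  show ?thesis
  proof (rule G_I[of "x' + y'"])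
    have "x + y - (x' + y') = (x - x') + (y - y')" by simp
    then show "x + y - (x' + y') \<in> yangian_ideal M N" using YI_add x'(2) y'(2) by metis
    show "low d p w" if "w \<in> Poly_Mapping.keys (x' + y')" for w
      using that Poly_Mapping.keys_add[of x' y'] x'(3) y'(3) by blast
  qed (use x' y' assms G_FC in auto)
qed

lemma G_scale:
  assumes "x \<in> G d p"
  shows "Poly_Mapping.single 0 c * x \<in> G d p"
proof -
  obtain x' where x': "x' \<in> FC M N" "x - x' \<in> yangian_ideal M N" "\<forall>w\<in>Poly_Mapping.keys x'. low d p w"
    using assms unfolding G_def by blast
  show ?thesis
  proof (rule G_I[of "Poly_Mapping.single 0 c * x'"])
    show "Poly_Mapping.single 0 c * x - Poly_Mapping.single 0 c * x' \<in> yangian_ideal M N"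
      unfolding right_diff_distrib[symmetric] by (rule YI_scale[OF x'(2)])
    show "low d p w" if "w \<in> Poly_Mapping.keys (Poly_Mapping.single 0 c * x')" for w
      using that keys_scale[of c x'] x'(3) by blast
  qed (use x' assms G_FC in auto)
qed

lemma G_sign: "x \<in> G d p \<Longrightarrow> (- 1) ^ n * x \<in> G d p"
  using G_scale[of x d p "(- 1) ^ n"] unfolding single_0_sign .

lemma G_uminus: "x \<in> G d p \<Longrightarrow> - x \<in> G d p"
  using G_sign[of x d p 1] by simp

lemma G_diff: "x \<in> G d p \<Longrightarrow> y \<in> G d p \<Longrightarrow> x - y \<in> G d p"
  using G_add[of x d p "- y"] G_uminus[of y] by simp

lemma G_sum: "(\<And>a. a \<in> A \<Longrightarrow> f a \<in> G d p) \<Longrightarrow> sum f A \<in> G d p"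
  by (induction A rule: infinite_finite_induct) (auto intro: G_add)

lemma G_of_nat: "x \<in> G d p \<Longrightarrow> of_nat n * x \<in> G d p"
  by (induction n) (auto simp: distrib_right intro: G_add)

lemma G_mono:
  assumes "x \<in> G d p" "d < d' \<or> d = d' \<and> p \<le> p'"
  shows "x \<in> G d' p'"
  using assms unfolding G_def low_def by fastforce

lemma G_mult:
  assumes x: "x \<in> G d p" and y: "y \<in> G d' p'"
    and low: "\<And>u v. low d p u \<Longrightarrow> low d' p' v \<Longrightarrow> low d'' p'' (u + v)"
  shows "x * y \<in> G d'' p''"
proof -
  obtain x' y' where x': "x' \<in> FC M N" "x - x' \<in> yangian_ideal M N" "\<forall>w\<in>Poly_Mapping.keys x'. low d p w"
    and y': "y' \<in> FC M N" "y - y' \<in> yangian_ideal M N" "\<forall>w\<in>Poly_Mapping.keys y'. low d' p' w"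
    using x y unfolding G_def by blast
  show ?thesis
  proof (rule G_I[of "x' * y'"])
    have eq: "x * y - x' * y' = (x - x') * y + x' * (y - y')" by (simp add: algebra_simps)
    show "x * y - x' * y' \<in> yangian_ideal M N"
      unfolding eq by (rule YI_add[OF YI_mult_right[OF x'(2) G_FC[OF y]] YI_mult_left[OF y'(2) x'(1)]])
    show "low d'' p'' w" if "w \<in> Poly_Mapping.keys (x' * y')" for w
      using that x'(3) y'(3) low by (auto elim!: keys_mult_cases)
  qed (use x' y' G_FC x y in auto)
qed

text \<open>The bound for \<open>x\<close> admits words of degree \<open>d\<close> and length
  \<open>p\<close>, the bound for \<open>y\<close> is strict; the strictness survives in the
  product.\<close>

lemma G_mult_left: "x \<in> G d (Suc p) \<Longrightarrow> y \<in> G d' p' \<Longrightarrow> x * y \<in> G (d + d') (p + p')"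
  by (rule G_mult[of x d "Suc p" y d' p']) (auto simp: low_def)

lemma G_mult_right: "x \<in> G d p \<Longrightarrow> y \<in> G d' (Suc p') \<Longrightarrow> x * y \<in> G (d + d') (p + p')"
  by (rule G_mult[of x d p y d' "Suc p'"]) (auto simp: low_def)

section \<open>Words in generators indexed by their degree\<close>

definition qletters :: "letter set" where
  "qletters = {1..M + N} \<times> {1..M + N} \<times> UNIV"

definition lq :: "letter \<Rightarrow> nat" where
  "lq x = snd (snd x)"

definition qdeg :: "letter list \<Rightarrow> nat" where
  "qdeg v = sum_list (map lq v)"

lemma qdeg_simps [simp]: "qdeg [] = 0" "qdeg (x # v) = lq x + qdeg v"
  by (simp_all add: qdeg_def)

definition gword :: "letter list \<Rightarrow> gen_word" where
  "gword v = GWord (map (\<lambda>(i, j, q). (i, j, Suc q)) v)"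

definition tw :: "letter list \<Rightarrow> free_elem" where
  "tw v = Poly_Mapping.single (gword v) 1"

lemma wdeg_gword: "wdeg (gword v) = qdeg v"
  by (induction v) (auto simp: wdeg_def gword_def lq_def)

lemma wlen_gword: "wlen (gword v) = length v"
  by (simp add: wlen_def gword_def)

lemma in_range_gword: "in_range M N (gword v) \<longleftrightarrow> set v \<subseteq> qletters"
  by (auto simp: in_range_def gword_def yangian_letters_def qletters_def)

lemma gword_surj:
  assumes "in_range M N w"
  obtains v where "w = gword v" "set v \<subseteq> qletters"
proof -
  let ?v = "map (\<lambda>(i, j, r). (i, j, r - 1)) (letters w)"
  have "map (\<lambda>(i, j, q). (i, j, Suc q)) ?v = map (\<lambda>x. x) (letters w)"
    unfolding map_map using assms by (intro map_cong) (auto simp: in_range_def yangian_letters_def)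
  then have "w = gword ?v" by (cases w) (simp add: gword_def)
  then show thesis using that[of ?v] assms in_range_gword by metis
qed

lemma tw_FC: "set v \<subseteq> qletters \<Longrightarrow> tw v \<in> FC M N"
  by (simp add: tw_def FC_def in_range_gword)

lemma tw_Nil [simp]: "tw [] = 1"
  by (simp add: tw_def gword_def zero_gen_word_def[symmetric])

lemma tw_append: "tw (v @ w) = tw v * tw w"
  by (simp add: tw_def gword_def mult_single plus_gen_word_def)

lemma tw_Cons: "tw (x # v) = tw [x] * tw v"
  using tw_append[of "[x]" v] by simp

lemma tw_G:
  assumes "set v \<subseteq> qletters" "qdeg v < d \<or> qdeg v = d \<and> length v < p"
  shows "tw v \<in> G d p"
proof (rule G_I[of "tw v"])
  show "low d p w" if "w \<in> Poly_Mapping.keys (tw v)" for w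
    using that assms(2) by (simp add: tw_def low_def wdeg_gword wlen_gword)
qed (use assms tw_FC in auto)

lemma free_T_Suc: "free_T i j (int (Suc q)) = tw [(i, j, q)]"
  by (auto simp: free_T_def tw_def gword_def nat_add_distrib)

text \<open>The defining relation transfers one unit of the index from the first generator to the
  second, at the cost of quadratic terms of smaller degree. When the first index has reached 1, the
  relation itself expresses the bracket by single generators.\<close>

lemma T_bracket_G:
  assumes "{i, j, k, l} \<subseteq> {1..M + N}"
  shows "T_bracket M i j k l (int (Suc r)) (int (Suc s)) \<in> G (r + s) 2"
  using assms
proof (induction r arbitrary: s)
  case (0 s)
  let ?e = "parity M i * parity M k + parity M i * parity M l + parity M k * parity M l"
  have rel: "yangian_relator M N i j k l 0 (int (Suc s)) \<in> yangian_ideal M N"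
    using relators_YI[of M N] 0 unfolding relators_def by blast
  have "T_bracket M i j k l 0 (int (Suc s) + 1) = 0"
    by (cases "i = j") (simp_all add: T_bracket_def free_T_def)
  then have eq: "T_bracket M i j k l (int (Suc 0)) (int (Suc s)) = (- 1) ^ ?e * yangian_relator M N i j k l 0 (int (Suc s)) +
     (- 1) ^ ?e * (free_T k j 0 * tw [(i, l, s)] - tw [(k, j, s)] * free_T i l 0)"
    unfolding yangian_relator_eq[OF 0] free_T_Suc[symmetric]
    by (simp add: right_diff_distrib sign_square)
  have f: "free_T a b 0 * tw [(i, l, s)] \<in> G s 2" "tw [(k, j, s)] * free_T a b 0 \<in> G s 2" for a b
    using 0 by (auto simp: free_T_def lq_def qletters_def intro!: tw_G)
  show ?case unfolding eq add_0 by (intro G_add G_sign G_diff G_YI[OF rel] f)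
next
  case (Suc r s)
  let ?e = "parity M i * parity M k + parity M i * parity M l + parity M k * parity M l"
  have rel: "yangian_relator M N i j k l (int (Suc r)) (int (Suc s)) \<in> yangian_ideal M N"
    using relators_YI[of M N] Suc.prems unfolding relators_def by blast
  have i: "int (Suc r) + 1 = int (Suc (Suc r))" "int (Suc s) + 1 = int (Suc (Suc s))" by simp_all
  have eq: "T_bracket M i j k l (int (Suc (Suc r))) (int (Suc s)) =
     (- 1) ^ ?e * yangian_relator M N i j k l (int (Suc r)) (int (Suc s)) +
     T_bracket M i j k l (int (Suc r)) (int (Suc (Suc s))) +
     (- 1) ^ ?e * (tw [(k, j, r)] * tw [(i, l, s)] - tw [(k, j, s)] * tw [(i, l, r)])"
    unfolding yangian_relator_eq[OF Suc.prems] free_T_Suc[symmetric] i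
    by (simp only: right_diff_distrib sign_square) simp
  have IH: "T_bracket M i j k l (int (Suc r)) (int (Suc (Suc s))) \<in> G (Suc r + s) 2"
    using Suc.IH[OF Suc.prems, of "Suc s"] by simp
  have f: "tw [(k, j, r)] * tw [(i, l, s)] \<in> G (Suc r + s) 2" "tw [(k, j, s)] * tw [(i, l, r)] \<in> G (Suc r + s) 2"
    unfolding tw_append[symmetric] using Suc.prems
    by (auto simp: lq_def qletters_def intro!: tw_G)
  show ?case unfolding eq by (intro G_add G_sign G_diff G_YI[OF rel] f IH)
qed

lemma tw_swap:
  assumes "x \<in> qletters" "y \<in> qletters"
  shows "(- 1) ^ (lpar M x * lpar M y) * (tw [y] * tw [x]) - tw [x] * tw [y] \<in> G (lq x + lq y) 2"
proof -
  obtain i j r k l s where xy: "x = (i, j, r)" "y = (k, l, s)" by (cases x; cases y)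
  have "(- 1) ^ (lpar M x * lpar M y) * (tw [y] * tw [x]) - tw [x] * tw [y] =
      - T_bracket M i j k l (int (Suc r)) (int (Suc s))"
    unfolding T_bracket_def free_T_Suc by (simp add: xy lpar_def)
  moreover have "{i, j, k, l} \<subseteq> {1..M + N}" using assms by (auto simp: xy qletters_def)
  ultimately show ?thesis using T_bracket_G[of i j k l r s] by (simp add: xy lq_def G_uminus)
qed

section \<open>Symmetrization\<close>

text \<open>Dual to insertion: if \<open>f\<close> gives the coefficients of a combination of words,
  this is the coefficient at a word after \<open>x\<close> has been inserted at all positions, with
  the sign for passing the letters in front of it.\<close>

fun del :: "letter \<Rightarrow> (letter list \<Rightarrow> complex) \<Rightarrow> letter list \<Rightarrow> complex" where
  "del x f [] = 0"
| "del x f (y # v) = (if x = y then f v else 0) + (- 1) ^ (lpar M x * lpar M y) * del x (\<lambda>v'. f (y # v')) v"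

text \<open>The coefficient of a word in the signed sum of all rearrangements of the given word,
  counted with multiplicity.\<close>

primrec Sym :: "letter list \<Rightarrow> letter list \<Rightarrow> complex" where
  "Sym [] = (\<lambda>v. if v = [] then 1 else 0)"
| "Sym (x # w) = del x (Sym w)"

lemma del_zero [simp]: "del x (\<lambda>v. 0) v = 0"
  by (induction v) simp_all

lemma del_nonzero: "del x f v \<noteq> 0 \<Longrightarrow> \<exists>v'. f v' \<noteq> 0 \<and> mset v = add_mset x (mset v')"
proof (induction v arbitrary: f)
  case (Cons y v)
  consider "x = y" "f v \<noteq> 0" | "del x (\<lambda>v'. f (y # v')) v \<noteq> 0"
    using Cons.prems
    by (cases "x = y"; cases "f v = 0"; cases "del x (\<lambda>v'. f (y # v')) v = 0") auto
  then show ?case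
  proof cases
    case 2
    from Cons.IH[OF this] obtain v' where "f (y # v') \<noteq> 0" "mset v = add_mset x (mset v')" by blast
    then show ?thesis by (intro exI[of _ "y # v'"]) auto
  qed auto
qed simp

lemma Sym_nonzero: "Sym w v \<noteq> 0 \<Longrightarrow> mset v = mset w"
proof (induction w arbitrary: v)
  case (Cons x w)
  then show ?case using del_nonzero[of x "Sym w" v] by fastforce
qed (simp split: if_splits)

definition words :: "letter set \<Rightarrow> nat \<Rightarrow> letter list set" where
  "words X p = {v. set v \<subseteq> X \<and> length v = p}"

definition wsum :: "letter set \<Rightarrow> nat \<Rightarrow> (letter list \<Rightarrow> complex) \<Rightarrow> free_elem" where
  "wsum X p f = (\<Sum>v\<in>words X p. Poly_Mapping.single 0 (f v) * tw v)"

lemma finite_words: "finite X \<Longrightarrow> finite (words X p)"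
  unfolding words_def by (rule finite_lists_length_eq)

lemma words_0: "words X 0 = {[]}"
  by (auto simp: words_def)

lemma words_Suc: "words X (Suc p) = (\<lambda>(y, v). y # v) ` (X \<times> words X p)"
  by (auto simp: words_def length_Suc_conv)

lemma scale_left_commute: "x * (Poly_Mapping.single 0 c * y) = Poly_Mapping.single 0 c * (x * y :: free_elem)"
  by (metis mult.assoc single_0_commute)

lemma wsum_0: "wsum X 0 f = Poly_Mapping.single 0 (f [])"
  by (simp add: wsum_def words_0)

lemma wsum_Suc: "wsum X (Suc p) f = (\<Sum>y\<in>X. tw [y] * wsum X p (\<lambda>v. f (y # v)))"
proof -
  have "wsum X (Suc p) f = (\<Sum>(y, v)\<in>X \<times> words X p. Poly_Mapping.single 0 (f (y # v)) * tw (y # v))"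
    unfolding wsum_def words_Suc
    by (subst sum.reindex) (auto simp: inj_on_def intro!: sum.cong)
  also have "\<dots> = (\<Sum>y\<in>X. \<Sum>v\<in>words X p. tw [y] * (Poly_Mapping.single 0 (f (y # v)) * tw v))"
    unfolding sum.cartesian_product[symmetric]
    by (intro sum.cong refl) (metis tw_Cons scale_left_commute)
  finally show ?thesis by (simp add: wsum_def sum_distrib_left)
qed

lemma wsum_add: "wsum X p (\<lambda>v. f v + g v) = wsum X p f + wsum X p g"
  by (simp add: wsum_def single_add distrib_right sum.distrib)

lemma wsum_scale: "wsum X p (\<lambda>v. c * f v) = Poly_Mapping.single 0 c * wsum X p f"
  by (simp add: wsum_def sum_distrib_left mult.assoc[symmetric] mult_single)

lemma wsum_zero [simp]: "wsum X p (\<lambda>v. 0) = 0"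
  by (simp add: wsum_def)

lemma wsum_sum: "wsum X p (\<lambda>v. \<Sum>a\<in>A. f a v) = (\<Sum>a\<in>A. wsum X p (f a))"
  by (induction A rule: infinite_finite_induct) (simp_all add: wsum_add)

lemma wsum_G:
  assumes "X \<subseteq> qletters" "\<And>v. f v \<noteq> 0 \<Longrightarrow> qdeg v = e"
  shows "wsum X p f \<in> G e (Suc p)"
  unfolding wsum_def
proof (rule G_sum)
  fix v assume "v \<in> words X p"
  then show "Poly_Mapping.single 0 (f v) * tw v \<in> G e (Suc p)"
    using assms by (cases "f v = 0") (auto simp: words_def intro!: G_scale tw_G)
qed

text \<open>Modulo lower terms a letter can be moved to the front of a word from each of its positions,
  so that the signed insertion of a letter amounts to a multiple of left multiplication.\<close>

lemma wsum_del:
  assumes "finite X" "X \<subseteq> qletters" "x \<in> X" "\<And>v. f v \<noteq> 0 \<Longrightarrow> qdeg v = e"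
  shows "wsum X (Suc p) (del x f) - of_nat (Suc p) * (tw [x] * wsum X p f) \<in> G (lq x + e) (Suc p)"
  using assms(4)
proof (induction p arbitrary: f e)
  case 0
  have "wsum X (Suc 0) (del x f) = (\<Sum>y\<in>X. if y = x then tw [y] * wsum X 0 f else 0)"
    unfolding wsum_Suc by (intro sum.cong refl) (simp add: wsum_0)
  then show ?case using assms(1,3) by simp
next
  case (Suc p)
  let ?f = "\<lambda>y v. f (y # v)"
  let ?s = "\<lambda>y. (- 1 :: free_elem) ^ (lpar M x * lpar M y)"
  have dec: "wsum X (Suc (Suc p)) (del x f) =
      tw [x] * wsum X (Suc p) f + (\<Sum>y\<in>X. ?s y * (tw [y] * wsum X (Suc p) (del x (?f y))))"
  proof -
    have "wsum X (Suc p) (\<lambda>v. del x f (y # v)) =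
        (if x = y then wsum X (Suc p) f else 0) + ?s y * wsum X (Suc p) (del x (?f y))" for y
      by (simp only: del.simps wsum_add wsum_scale single_0_sign) simp
    then have "wsum X (Suc (Suc p)) (del x f) =
        (\<Sum>y\<in>X. (if y = x then tw [y] * wsum X (Suc p) f else 0) +
          ?s y * (tw [y] * wsum X (Suc p) (del x (?f y))))"
      unfolding wsum_Suc[of X "Suc p"]
      by (intro sum.cong refl) (simp only: distrib_left sign_commute_left if_distrib[of "\<lambda>z. tw _ * z"] mult_zero_right eq_commute)
    then show ?thesis using assms(1,3) by (simp add: sum.distrib)
  qed
  have tm: "?s y * (tw [y] * wsum X (Suc p) (del x (?f y))) -
      of_nat (Suc p) * (tw [x] * (tw [y] * wsum X p (?f y))) \<in> G (lq x + e) (Suc (Suc p))"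
    if y: "y \<in> X" for y
  \<comment> \<open>Otherwise \<open>e - lq y\<close> would be truncated; but then no word in the
    support of \<open>f\<close> begins with \<open>y\<close>.\<close>
  proof (cases "lq y \<le> e")
    case False
    have "f (y # v) = 0" for v
      using Suc.prems[of "y # v"] False by (cases "f (y # v) = 0") auto
    then have "wsum X (Suc p) (del x (?f y)) = 0" "wsum X p (?f y) = 0"
      by (simp_all add: wsum_def)
    then show ?thesis by simp
  next
    case True
    have supp: "?f y v \<noteq> 0 \<Longrightarrow> qdeg v = e - lq y" for v using Suc.prems[of "y # v"] by auto
    have yq: "tw [y] \<in> G (lq y) (Suc 1)" using y assms(2) by (intro tw_G) auto
    have 1: "tw [y] * (wsum X (Suc p) (del x (?f y)) - of_nat (Suc p) * (tw [x] * wsum X p (?f y)))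
        \<in> G (lq y + (lq x + (e - lq y))) (1 + Suc p)"
      by (rule G_mult_left[OF yq Suc.IH[OF supp]])
    have 2: "(?s y * (tw [y] * tw [x]) - tw [x] * tw [y]) * wsum X p (?f y) \<in> G (lq x + lq y + (e - lq y)) (2 + p)"
      by (rule G_mult_right[OF tw_swap wsum_G]) (use y assms supp in auto)
    \<comment> \<open>The error is the induction hypothesis multiplied by \<open>y\<close>, plus the
      error of exchanging \<open>x\<close> and \<open>y\<close>, which occurs once for each of the
      \<open>Suc p\<close> positions behind \<open>y\<close>.\<close>
    have eq: "?s y * (tw [y] * wsum X (Suc p) (del x (?f y))) -
      of_nat (Suc p) * (tw [x] * (tw [y] * wsum X p (?f y))) =
      ?s y * (tw [y] * (wsum X (Suc p) (del x (?f y)) - of_nat (Suc p) * (tw [x] * wsum X p (?f y)))) +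
      of_nat (Suc p) * ((?s y * (tw [y] * tw [x]) - tw [x] * tw [y]) * wsum X p (?f y))"
    proof -
      have c: "of_nat (Suc p) * (?s y * Z) = ?s y * (of_nat (Suc p) * Z)"
        "tw v * (of_nat (Suc p) * Z) = of_nat (Suc p) * (tw v * Z)" for v Z
        by (metis mult.assoc mult_of_nat_commute)+
      show ?thesis by (simp only: right_diff_distrib left_diff_distrib mult.assoc c) simp
    qed
    have idx: "lq y + (lq x + (e - lq y)) = lq x + e" "lq x + lq y + (e - lq y) = lq x + e"
      "1 + Suc p = Suc (Suc p)" "2 + p = Suc (Suc p)"
      using True by simp_all
    show ?thesis
      unfolding eq by (intro G_add G_sign G_of_nat 1[unfolded idx] 2[unfolded idx])
  qed
  have "wsum X (Suc (Suc p)) (del x f) - of_nat (Suc (Suc p)) * (tw [x] * wsum X (Suc p) f) =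
     (\<Sum>y\<in>X. ?s y * (tw [y] * wsum X (Suc p) (del x (?f y))) -
      of_nat (Suc p) * (tw [x] * (tw [y] * wsum X p (?f y))))"
    unfolding dec sum_subtractf sum_distrib_left[symmetric] wsum_Suc[of X p f, symmetric]
    by (simp add: distrib_right)
  also have "\<dots> \<in> G (lq x + e) (Suc (Suc p))"
    by (rule G_sum) (rule tm)
  finally show ?case .
qed

lemma qdeg_mset: "mset v = mset w \<Longrightarrow> qdeg v = qdeg w"
  unfolding qdeg_def by (metis mset_map sum_mset_sum_list)

text \<open>All rearrangements of a word agree modulo lower terms up to their Koszul signs, and
  these signs are built into \<open>Sym\<close>. So each of them contributes the same class, whence
  the factorial.\<close>

lemma wsum_Sym:
  assumes "finite X" "X \<subseteq> qletters" "set w \<subseteq> X"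
  shows "wsum X (length w) (Sym w) - of_nat (fact (length w)) * tw w \<in> G (qdeg w) (length w)"
  using assms(3)
proof (induction w)
  case Nil
  then show ?case by (simp add: wsum_0)
next
  case (Cons x w)
  have 1: "wsum X (Suc (length w)) (del x (Sym w)) - of_nat (Suc (length w)) * (tw [x] * wsum X (length w) (Sym w))
      \<in> G (lq x + qdeg w) (Suc (length w))"
    by (rule wsum_del) (use assms Cons.prems in \<open>auto dest: Sym_nonzero qdeg_mset\<close>)
  have "tw [x] \<in> G (lq x) (Suc 1)" using Cons.prems assms(2) by (intro tw_G) auto
  then have 2: "tw [x] * (wsum X (length w) (Sym w) - of_nat (fact (length w)) * tw w) \<in> G (lq x + qdeg w) (1 + length w)"
    by (rule G_mult_left) (use Cons in auto)
  have eq: "wsum X (length (x # w)) (Sym (x # w)) - of_nat (fact (length (x # w))) * tw (x # w) =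
     (wsum X (Suc (length w)) (del x (Sym w)) - of_nat (Suc (length w)) * (tw [x] * wsum X (length w) (Sym w))) +
     of_nat (Suc (length w)) * (tw [x] * (wsum X (length w) (Sym w) - of_nat (fact (length w)) * tw w))"
  proof -
    have c: "tw [x] * (of_nat n * Z) = of_nat n * (tw [x] * Z)" for n Z
      by (metis mult.assoc mult_of_nat_commute)
    show ?thesis
      by (simp only: length_Cons Sym.simps fact_Suc of_nat_mult of_nat_id tw_Cons[of x w] right_diff_distrib mult.assoc c) simp
  qed
  show ?case
    unfolding eq unfolding qdeg_simps length_Cons
    by (intro G_add G_of_nat 1 2[unfolded plus_1_eq_Suc])
qed

end

section \<open>Degrees of operators\<close>

definition oq :: "letter option \<Rightarrow> nat" where
  "oq b = (case b of None \<Rightarrow> 0 | Some x \<Rightarrow> lq x)"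

definition sdeg :: "nat \<Rightarrow> state \<Rightarrow> nat" where
  "sdeg n s = (\<Sum>k<n. oq (s k))"

definition socc :: "nat \<Rightarrow> state \<Rightarrow> nat" where
  "socc n s = (\<Sum>k<n. if s k = None then 0 else 1)"

lemma oq_simps [simp]: "oq None = 0" "oq (Some x) = lq x"
  by (simp_all add: oq_def)

lemma sum_fun_upd:
  fixes g :: "'b \<Rightarrow> nat" and s :: "nat \<Rightarrow> 'b"
  assumes "k < n"
  shows "(\<Sum>l<n. g ((s(k := b)) l)) + g (s k) = (\<Sum>l<n. g (s l)) + g b"
proof -
  have *: "sum h {..<n} = h k + sum h ({..<n} - {k})" for h :: "nat \<Rightarrow> nat"
    using assms by (simp add: sum.remove)
  show ?thesis
    unfolding *[of "\<lambda>l. g ((s(k := b)) l)"] *[of "\<lambda>l. g (s l)"] by simp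
qed

lemma sdeg_upd: "k < n \<Longrightarrow> sdeg n (s(k := b)) + oq (s k) = sdeg n s + oq b"
  unfolding sdeg_def by (rule sum_fun_upd)

lemma socc_upd:
  "k < n \<Longrightarrow> socc n (s(k := b)) + (if s k = None then 0 else 1) = socc n s + (if b = None then 0 else 1)"
  unfolding socc_def by (rule sum_fun_upd)

definition bounded :: "nat \<Rightarrow> int \<Rightarrow> (state \<Rightarrow> complex) \<Rightarrow> bool" where
  "bounded n d f \<longleftrightarrow> (\<forall>s. f s \<noteq> 0 \<longrightarrow> int (sdeg n s) \<le> d)"

text \<open>The bounds are integers because the difference between a generator of degree 0 and its
  diagonal action lowers the degree by one.\<close>

definition raises :: "nat \<Rightarrow> int \<Rightarrow> state endo \<Rightarrow> bool" where
  "raises n e X \<longleftrightarrow> (\<forall>f d. bounded n d f \<longrightarrow> bounded n (d + e) (app X f))"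

lemma raisesD: "raises n e X \<Longrightarrow> bounded n d f \<Longrightarrow> bounded n (d + e) (app X f)"
  by (simp add: raises_def)

lemma bounded_mono: "bounded n d f \<Longrightarrow> d \<le> d' \<Longrightarrow> bounded n d' f"
  unfolding bounded_def by force

lemma raises_mono: "raises n e X \<Longrightarrow> e \<le> e' \<Longrightarrow> raises n e' X"
  unfolding raises_def by (meson add_left_mono bounded_mono)

lemma raises_0 [simp]: "raises n e 0"
  by (simp add: raises_def bounded_def app_simps)

lemma raises_1 [simp]: "raises n 0 1"
  by (simp add: raises_def app_simps)

lemma raises_add: "raises n e X \<Longrightarrow> raises n e Y \<Longrightarrow> raises n e (X + Y)"
  unfolding raises_def bounded_def app_simps by (metis add_0)

lemma raises_diff: "raises n e X \<Longrightarrow> raises n e Y \<Longrightarrow> raises n e (X - Y)"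
  unfolding raises_def bounded_def app_simps by (metis diff_0_right)

lemma raises_uminus: "raises n e X \<Longrightarrow> raises n e (- X)"
  using raises_diff[OF raises_0, of n e X] by simp

lemma raises_sum: "(\<And>a. a \<in> A \<Longrightarrow> raises n e (X a)) \<Longrightarrow> raises n e (sum X A)"
  by (induction A rule: infinite_finite_induct) (auto intro: raises_add)

lemma raises_mult: "raises n e X \<Longrightarrow> raises n e' Y \<Longrightarrow> raises n (e + e') (X * Y)"
  unfolding raises_def app_simps by (metis add.assoc add.commute)

lemma raises_cs: "raises n e X \<Longrightarrow> raises n e (cs c * X)"
  unfolding raises_def bounded_def app_simps by (metis mult_zero_right)

lemma raises_sign: "raises n e X \<Longrightarrow> raises n e ((- 1) ^ r * X)"
  by (cases "even r") (auto intro: raises_uminus)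

lemma lam_nonzero:
  assumes "app (lam M k (i, j, q)) f s \<noteq> 0"
  obtains "s k = Some (i, j, q)" "f (s(k := None)) \<noteq> 0"
  | e r where "s k = Some (i, e, r)" "q \<le> r" "f (s(k := Some (j, e, r - q))) \<noteq> 0"
proof (cases "s k")
  case None
  then show ?thesis using assms by (simp add: lam_None)
next
  case (Some x)
  obtain a e r where x: "s k = Some (a, e, r)" using Some by (cases x) auto
  show ?thesis
  proof (cases "(a, e, r) = (i, j, q) \<and> f (s(k := None)) \<noteq> 0")
    case True
    then show ?thesis using that(1) x by simp
  next
    case False
    then have "a = i" "q \<le> r" "f (s(k := Some (j, e, r - q))) \<noteq> 0"
      using assms unfolding lam_Some[where s = s and k = k, OF x] by (auto split: if_splits)
    then show ?thesis using that(2) x by simp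
  qed
qed

lemma raises_lam:
  assumes "k < n"
  shows "raises n (int (lq x)) (lam M k x)"
  unfolding raises_def bounded_def
proof (intro allI impI)
  fix f d s
  obtain i j q where x: "x = (i, j, q)" by (cases x)
  assume f: "\<forall>s. f s \<noteq> 0 \<longrightarrow> int (sdeg n s) \<le> d" and nz: "app (lam M k x) f s \<noteq> 0"
  from nz[unfolded x] show "int (sdeg n s) \<le> d + int (lq x)"
  proof (cases rule: lam_nonzero)
    case 1
    then show ?thesis using f sdeg_upd[OF assms, of s None] by (force simp: x lq_def)
  next
    case (2 e r)
    then show ?thesis using f sdeg_upd[OF assms, of s "Some (j, e, r - q)"] by (force simp: x lq_def)
  qed
qed

text \<open>The diagonal action of the current superalgebra, which is the leading part of a
  generator of the Yangian in the tensor power.\<close>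

definition Dop :: "nat \<Rightarrow> nat \<Rightarrow> letter \<Rightarrow> state endo" where
  "Dop M n x = (\<Sum>k<n. lam M k x)"

lemma raises_Dop: "n \<le> n' \<Longrightarrow> raises n' (int (lq x)) (Dop M n x)"
  unfolding Dop_def by (intro raises_sum raises_lam) auto

text \<open>A term of the coproduct with an index 0 in one factor belongs to the diagonal action. In
  the other terms the indices are a + 1 and b + 1 with sum q + 1, so their degrees add up to q - 1
  only.\<close>

lemma raises_tT_diff:
  assumes "m \<le> n" "i \<in> {1..M + N}" "j \<in> {1..M + N}"
  shows "raises n (int q - 1) (tT M N m i j $ Suc q - Dop M m (i, j, q))"
  using assms
proof (induction m arbitrary: i j q)
  case 0
  then show ?case by (simp add: Dop_def)
next
  case (Suc m)
  let ?d = "\<lambda>c. (- 1 :: state endo) ^ ((parity M i + parity M c) * (parity M c + parity M j))"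
  have IH: "raises n (int q - 1) (tT M N m i j $ Suc q - Dop M m (i, j, q))"
    if "i \<in> {1..M + N}" "j \<in> {1..M + N}" for i j q
    using Suc.IH[of i j q] Suc.prems(1) that by simp
  have T: "raises n (int q) (tT M N m i c $ Suc q)" if "c \<in> {1..M + N}" for c q
  proof -
    have "raises n (int q) (tT M N m i c $ Suc q - Dop M m (i, c, q) + Dop M m (i, c, q))"
      using Suc.prems(1) raises_Dop[of m n "(i, c, q)" M]
      by (intro raises_add raises_mono[OF IH[OF Suc.prems(2) that]]) (auto simp: lq_def)
    then show ?thesis by simp
  qed
  have L: "raises n (int q) (tL M m c j $ Suc q)" for c q
    using raises_lam[of m n "(c, j, q)" M] Suc.prems(1) by (simp add: lq_def)
  define R where "R c = ?d c * (\<Sum>a<q. tT M N m i c $ Suc a * tL M m c j $ (q - a))" for c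
  have "tT M N (Suc m) i j $ Suc q = (\<Sum>c\<in>{1..M + N}. ?d c * (tT M N m i c * tL M m c j) $ Suc q)"
    by (simp add: fps_sum_nth fps_sign_nth)
  also have "\<dots> = (\<Sum>c\<in>{1..M + N}. (if c = i then lam M m (i, j, q) else 0) +
      (if c = j then tT M N m i j $ Suc q else 0) + R c)"
  proof (intro sum.cong refl)
    fix c assume c: "c \<in> {1..M + N}"
    have "(tT M N m i c * tL M m c j) $ Suc q =
      tT M N m i c $ 0 * tL M m c j $ Suc q + (\<Sum>a\<le>q. tT M N m i c $ Suc a * tL M m c j $ (q - a))"
      unfolding fps_mult_nth atLeast0AtMost sum.atMost_Suc_shift by simp
    also have "(\<Sum>a\<le>q. tT M N m i c $ Suc a * tL M m c j $ (q - a)) =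
       (\<Sum>a<q. tT M N m i c $ Suc a * tL M m c j $ (q - a)) + tT M N m i c $ Suc q * tL M m c j $ 0"
      by (simp add: lessThan_Suc_atMost[symmetric])
    finally show "?d c * (tT M N m i c * tL M m c j) $ Suc q =
       (if c = i then lam M m (i, j, q) else 0) + (if c = j then tT M N m i j $ Suc q else 0) + R c"
      using Suc.prems(2) by (auto simp: tT_0 R_def distrib_left)
  qed
  also have "\<dots> = lam M m (i, j, q) + tT M N m i j $ Suc q + (\<Sum>c\<in>{1..M + N}. R c)"
    using Suc.prems by (simp add: sum.distrib)
  finally have eq: "tT M N (Suc m) i j $ Suc q - Dop M (Suc m) (i, j, q) =
     (tT M N m i j $ Suc q - Dop M m (i, j, q)) + (\<Sum>c\<in>{1..M + N}. R c)"
    by (simp add: Dop_def)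
  have "raises n (int q - 1) (tT M N m i c $ Suc a * tL M m c j $ (q - a))" if "c \<in> {1..M + N}" "a < q" for c a
  proof -
    obtain b where b: "q - a = Suc b" using \<open>a < q\<close> by (metis Suc_diff_Suc)
    show ?thesis
      unfolding b using b raises_mult[OF T[OF that(1), of a] L[of b c]]
      by (elim raises_mono) auto
  qed
  then have "raises n (int q - 1) (R c)" if "c \<in> {1..M + N}" for c
    unfolding R_def using that by (intro raises_sign raises_sum) auto
  then show ?case
    unfolding eq using IH Suc.prems by (intro raises_add raises_sum) auto
qed

lemma raises_tT:
  assumes "m \<le> n" "i \<in> {1..M + N}" "j \<in> {1..M + N}"
  shows "raises n (int q) (tT M N m i j $ Suc q)"
proof -
  have "raises n (int q) (tT M N m i j $ Suc q - Dop M m (i, j, q) + Dop M m (i, j, q))"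
    using raises_Dop[OF assms(1), of "(i, j, q)" M]
    by (intro raises_add raises_mono[OF raises_tT_diff[OF assms]]) (auto simp: lq_def)
  then show ?thesis by simp
qed

section \<open>The vacuum expansion and the basis theorem\<close>

definition vac :: "state \<Rightarrow> complex" where
  "vac s = (if s = (\<lambda>_. None) then 1 else 0)"

lemma bounded_vac: "bounded n 0 vac"
  by (auto simp: bounded_def vac_def sdeg_def)

definition reading :: "nat \<Rightarrow> state \<Rightarrow> letter list" where
  "reading n s = List.map_filter s [0..<n]"

lemma reading_0 [simp]: "reading 0 s = []"
  by (simp add: reading_def map_filter_def)

lemma reading_Suc: "reading (Suc n) s = reading n s @ (case s n of None \<Rightarrow> [] | Some x \<Rightarrow> [x])"
  by (simp add: reading_def map_filter_def split: option.split)

lemma reading_cong: "(\<And>k. k < n \<Longrightarrow> s k = t k) \<Longrightarrow> reading n s = reading n t"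
  by (induction n) (simp_all add: reading_Suc)

lemma reading_upd [simp]: "n \<le> k \<Longrightarrow> reading n (s(k := b)) = reading n s"
  by (rule reading_cong) auto

lemma length_reading: "length (reading n s) = socc n s"
  by (induction n) (simp_all add: reading_Suc socc_def split: option.split)

lemma spar_reading: "spar M s n = sum_list (map (lpar M) (reading n s))"
  by (induction n) (simp_all add: reading_Suc spar_def opar_def split: option.split)

lemma del_append:
  "del M x f (v @ [y]) = del M x (\<lambda>v'. f (v' @ [y])) v +
    (if x = y then (- 1) ^ (lpar M x * sum_list (map (lpar M) v)) * f v else 0)"
  by (induction v arbitrary: f) (simp_all add: algebra_simps power_add)

text \<open>Emptying an occupied site deletes its letter from the word that is read off, and the
  sign of the site operator is the sign of moving this letter to the front.\<close>

lemma del_reading: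
  "(\<Sum>k<n. if s k = Some x then (- 1) ^ (lpar M x * spar M s k) * g (reading n (s(k := None))) else 0) =
    del M x g (reading n s)"
proof (induction n arbitrary: g)
  case (Suc n)
  let ?t = "case s n of None \<Rightarrow> [] | Some x \<Rightarrow> [x]"
  have "(\<Sum>k<n. if s k = Some x then (- 1) ^ (lpar M x * spar M s k) * g (reading (Suc n) (s(k := None))) else 0) =
    (\<Sum>k<n. if s k = Some x then (- 1) ^ (lpar M x * spar M s k) * g (reading n (s(k := None)) @ ?t) else 0)"
    by (intro sum.cong refl) (auto simp: reading_Suc)
  also have "\<dots> = del M x (\<lambda>v. g (v @ ?t)) (reading n s)"
    by (rule Suc.IH)
  finally show ?case
    by (cases "s n") (auto simp: reading_Suc del_append spar_reading)
qed simp

definition Dword :: "nat \<Rightarrow> nat \<Rightarrow> letter list \<Rightarrow> state endo" where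
  "Dword M n w = prod_list (map (Dop M n) w)"

text \<open>Each factor either occupies an empty site or multiplies the letter of an occupied one.
  As many occupied sites as letters of \<open>w\<close> therefore arise only if every factor creates
  its letter, and then the sum over the sites is the signed symmetrization.\<close>

lemma Dword_vac:
  "(app (Dword M n w) vac s \<noteq> 0 \<longrightarrow> socc n s \<le> length w) \<and>
   (socc n s = length w \<longrightarrow> (\<forall>k\<ge>n. s k = None) \<longrightarrow> app (Dword M n w) vac s = Sym M w (reading n s))"
proof (induction w arbitrary: s)
  case Nil
  have empty: "s = (\<lambda>_. None)" if "socc n s = 0" "\<forall>k\<ge>n. s k = None"
  proof
    fix k
    have "\<forall>k\<in>{..<n}. (if s k = None then 0 else 1 :: nat) = 0"
      using that(1) unfolding socc_def by (simp only: sum_eq_0_iff finite_lessThan)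
    then show "s k = None" using that(2) by (metis lessThan_iff not_less one_neq_zero)
  qed
  have reading: "reading n s = []" if "socc n s = 0"
    using that length_reading[of n s] by simp
  have v: "app (Dword M n []) vac = vac" by (simp add: Dword_def app_simps)
  show ?case
    unfolding v
  proof (intro conjI impI)
    assume "vac s \<noteq> 0"
    then have "s = (\<lambda>_. None)" unfolding vac_def by presburger
    then show "socc n s \<le> length []" by (simp only: socc_def) simp
  next
    assume "socc n s = length []" "\<forall>k\<ge>n. s k = None"
    then have "s = (\<lambda>_. None)" "reading n s = []" using empty reading by simp_all
    then have "vac s = 1" "Sym M [] (reading n s) = 1" by (simp_all only: vac_def Sym.simps if_True refl)
    then show "vac s = Sym M [] (reading n s)" by simp
  qed
next
  case (Cons x w)
  let ?f = "app (Dword M n w) vac"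
  have IH0: "?f t = 0" if "length w < socc n t" for t
    using Cons.IH[of t] that by (metis linorder_not_less)
  have IH1: "?f t = Sym M w (reading n t)" if "socc n t = length w" "\<forall>k\<ge>n. t k = None" for t
    using Cons.IH[of t] that by blast
  have step: "app (Dword M n (x # w)) vac s =
      (\<Sum>k<n. if s k = Some x then (- 1) ^ (lpar M x * spar M s k) * ?f (s(k := None)) else 0)"
    if occ: "length w < socc n s" for s
  proof -
    obtain i j q where x: "x = (i, j, q)" by (cases x)
    have "app (lam M k x) ?f s =
        (if s k = Some x then (- 1) ^ (lpar M x * spar M s k) * ?f (s(k := None)) else 0)" if k: "k < n" for k
    proof (cases "s k")
      case None
      then show ?thesis by (simp add: lam_None)
    next
      case (Some y)
      obtain a e r where y: "s k = Some (a, e, r)" using Some by (cases y) auto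
      \<comment> \<open>A multiplication leaves the site occupied, so its source has more occupied
        sites than \<open>w\<close> can create.\<close>
      have "socc n (s(k := Some b)) = socc n s" for b
        using socc_upd[OF k, of s "Some b"] y by simp
      then have "?f (s(k := Some b)) = 0" for b
        using occ by (intro IH0) simp
      then show ?thesis unfolding x lam_Some[where s = s and k = k, OF y] by (auto simp: y lpar_def)
    qed
    then show ?thesis
      by (simp add: Dword_def Dop_def times_endo.rep_eq app_sum)
  qed
  have dec: "socc n (s(k := None)) + 1 = socc n s" if "k < n" "s k = Some x" for k
    using socc_upd[OF that(1), of s None] that(2) by simp
  show ?case
  proof (intro conjI impI)
    assume nz: "app (Dword M n (x # w)) vac s \<noteq> 0"
    show "socc n s \<le> length (x # w)"
    proof (rule ccontr)
      assume big: "\<not> socc n s \<le> length (x # w)"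
      have "app (Dword M n (x # w)) vac s = 0"
        unfolding step[OF less_trans[OF lessI big[unfolded not_le length_Cons]]]
      proof (intro sum.neutral ballI)
        fix k assume k: "k \<in> {..<n}"
        show "(if s k = Some x then (- 1) ^ (lpar M x * spar M s k) * ?f (s(k := None)) else 0) = 0"
          using dec[of k] k big by (auto intro!: IH0)
      qed
      then show False using nz by simp
    qed
  next
    assume occ: "socc n s = length (x # w)" and none: "\<forall>k\<ge>n. s k = None"
    have "app (Dword M n (x # w)) vac s =
      (\<Sum>k<n. if s k = Some x then (- 1) ^ (lpar M x * spar M s k) * Sym M w (reading n (s(k := None))) else 0)"
    proof (subst step)
      show "length w < socc n s" using occ by simp
      show "(\<Sum>k<n. if s k = Some x then (- 1) ^ (lpar M x * spar M s k) * ?f (s(k := None)) else 0) =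
        (\<Sum>k<n. if s k = Some x then (- 1) ^ (lpar M x * spar M s k) * Sym M w (reading n (s(k := None))) else 0)"
      proof (intro sum.cong refl)
        fix k assume "k \<in> {..<n}"
        then show "(if s k = Some x then (- 1) ^ (lpar M x * spar M s k) * ?f (s(k := None)) else 0) =
          (if s k = Some x then (- 1) ^ (lpar M x * spar M s k) * Sym M w (reading n (s(k := None))) else 0)"
          using dec[of k] occ none IH1[of "s(k := None)"] by auto
      qed
    qed
    also have "\<dots> = Sym M (x # w) (reading n s)"
      unfolding del_reading by simp
    finally show "app (Dword M n (x # w)) vac s = Sym M (x # w) (reading n s)" .
  qed
qed

context
  fixes M N :: nat
begin

definition psi :: "nat \<Rightarrow> free_elem \<Rightarrow> state \<Rightarrow> complex" where
  "psi n x = app (beta M N n x) vac"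

lemma psi_add: "psi n (x + y) s = psi n x s + psi n y s"
  and psi_diff: "psi n (x - y) s = psi n x s - psi n y s"
  and psi_scale: "psi n (Poly_Mapping.single 0 c * x) s = c * psi n x s"
  and psi_sum: "psi n (sum f A) s = (\<Sum>a\<in>A. psi n (f a) s)"
  by (simp_all add: psi_def beta_add beta_diff beta_scale beta_sum app_simps app_sum)

lemma psi_YI: "x \<in> yangian_ideal M N \<Longrightarrow> psi n x s = 0"
  by (simp add: psi_def beta_YI app_simps)

lemma beta_tw_Cons:
  assumes "x \<in> qletters M N"
  shows "beta M N n (tw (x # w)) = (case x of (i, j, q) \<Rightarrow> tT M N n i j $ Suc q) * beta M N n (tw w)"
proof -
  obtain i j q where x: "x = (i, j, q)" by (cases x)
  have t: "beta M N n (tw [x]) = tT M N n i j $ Suc q"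
    unfolding x free_T_Suc[symmetric] using assms by (subst beta_free_T) (auto simp: x qletters_def nat_add_distrib)
  show ?thesis unfolding tw_Cons[of x w] beta_mult t by (simp add: x)
qed

lemma raises_tw:
  assumes "set w \<subseteq> qletters M N"
  shows "raises n (int (qdeg w)) (beta M N n (tw w)) \<and>
    raises n (int (qdeg w) - 1) (beta M N n (tw w) - Dword M n w)"
  using assms
proof (induction w)
  case Nil
  then show ?case by (simp add: beta_1 Dword_def)
next
  case (Cons x w)
  obtain i j q where x: "x = (i, j, q)" by (cases x)
  have ij: "i \<in> {1..M + N}" "j \<in> {1..M + N}" using Cons.prems by (auto simp: x qletters_def)
  let ?T = "tT M N n i j $ Suc q"
  have b: "beta M N n (tw (x # w)) = ?T * beta M N n (tw w)"
    using beta_tw_Cons[of x n w] Cons.prems by (simp add: x)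
  have eq: "beta M N n (tw (x # w)) - Dword M n (x # w) =
      (?T - Dop M n x) * beta M N n (tw w) + Dop M n x * (beta M N n (tw w) - Dword M n w)"
    unfolding b by (simp add: Dword_def algebra_simps)
  note T = raises_tT[OF order_refl ij, of n q] raises_tT_diff[OF order_refl ij, of n q]
    raises_Dop[OF order_refl, of n x M]
  have 1: "raises n (int q + int (qdeg w)) (beta M N n (tw (x # w)))"
    unfolding b using T Cons by (intro raises_mult) auto
  have 2: "raises n (int q - 1 + int (qdeg w)) ((?T - Dop M n x) * beta M N n (tw w))"
    using T Cons by (intro raises_mult) (auto simp: x)
  have 3: "raises n (int (lq x) + (int (qdeg w) - 1)) (Dop M n x * (beta M N n (tw w) - Dword M n w))"
    using T Cons by (intro raises_mult) auto
  have d: "int (qdeg (x # w)) = int q + int (qdeg w)" by (simp add: x lq_def)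
  have e: "int q - 1 + int (qdeg w) = int q + int (qdeg w) - 1"
    "int (lq x) + (int (qdeg w) - 1) = int q + int (qdeg w) - 1" by (simp_all add: x lq_def)
  show ?case
    unfolding d eq using 1 raises_add[OF 2[unfolded e] 3[unfolded e]] by blast
qed

text \<open>The difference between a word and its diagonal action reaches only degrees below
  \<open>qdeg w\<close>, so it does not contribute at \<open>s\<close>.\<close>

lemma psi_tw_Dword:
  assumes "set w \<subseteq> qletters M N" "qdeg w \<le> sdeg n s"
  shows "psi n (tw w) s = app (Dword M n w) vac s"
proof -
  have "bounded n (0 + (int (qdeg w) - 1)) (app (beta M N n (tw w) - Dword M n w) vac)"
    by (rule raisesD[OF conjunct2[OF raises_tw[OF assms(1)]] bounded_vac])
  then have "app (beta M N n (tw w) - Dword M n w) vac s = 0"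
    using assms(2) unfolding bounded_def by force
  then show ?thesis by (simp add: psi_def app_simps)
qed

lemma psi_tw_low:
  assumes "set w \<subseteq> qletters M N" "qdeg w < sdeg n s \<or> qdeg w = sdeg n s \<and> length w < socc n s"
  shows "psi n (tw w) s = 0"
proof (cases "qdeg w < sdeg n s")
  case True
  have "bounded n (0 + int (qdeg w)) (app (beta M N n (tw w)) vac)"
    by (rule raisesD[OF conjunct1[OF raises_tw[OF assms(1)]] bounded_vac])
  then show ?thesis using True unfolding bounded_def psi_def by force
next
  case False
  then show ?thesis
    using assms Dword_vac[of M n w s] by (subst psi_tw_Dword) auto
qed

section \<open>Symbols and faithfulness of the representations\<close>

definition state_of :: "letter list \<Rightarrow> state" where
  "state_of v = (\<lambda>k. if k < length v then Some (v ! k) else None)"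

lemma reading_state_of: "n \<le> length v \<Longrightarrow> reading n (state_of v) = take n v"
  by (induction n) (simp_all add: reading_Suc state_of_def take_Suc_conv_app_nth)

lemma state_of_None: "length v \<le> k \<Longrightarrow> state_of v k = None"
  by (simp add: state_of_def)

lemma sdeg_state_of: "sdeg (length v) (state_of v) = qdeg v"
  by (simp add: sdeg_def state_of_def qdeg_def sum_list_sum_nth atLeast0LessThan)

lemma socc_state_of: "socc (length v) (state_of v) = length v"
  by (simp add: socc_def state_of_def)

lemma psi_tw_top:
  assumes "set w \<subseteq> qletters M N" "length v = length w" "qdeg v = qdeg w"
  shows "psi (length v) (tw w) (state_of v) = Sym M w v"
proof -
  have "psi (length v) (tw w) (state_of v) = app (Dword M (length v) w) vac (state_of v)"
    using assms(3) sdeg_state_of[of v] by (intro psi_tw_Dword[OF assms(1)]) simp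
  also have "\<dots> = Sym M w (reading (length v) (state_of v))"
    using Dword_vac[of M "length v" w "state_of v"] socc_state_of[of v] assms(2) state_of_None[of v] by simp
  finally show ?thesis by (simp add: reading_state_of)
qed

lemma free_elem_tw_sum:
  assumes "y \<in> FC M N"
  obtains W c where "finite W" "\<And>w. w \<in> W \<Longrightarrow> set w \<subseteq> qletters M N \<and> gword w \<in> Poly_Mapping.keys y"
    "y = (\<Sum>w\<in>W. Poly_Mapping.single 0 (c w) * tw w)"
proof -
  define W where "W = {w. gword w \<in> Poly_Mapping.keys y}"
  have inj: "inj gword"
    by (auto simp: inj_def gword_def intro!: list.inj_map_strong dest!: map_injective[rotated])
  have img: "gword ` W = Poly_Mapping.keys y"
    using assms unfolding W_def FC_def by (auto elim!: gword_surj)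
  have fin: "finite W"
    using inj img by (metis finite_imageD finite_keys inj_on_subset subset_UNIV)
  have "y = (\<Sum>u\<in>gword ` W. Poly_Mapping.single u (Poly_Mapping.lookup y u))"
    unfolding img by (rule poly_mapping_sum_singles)
  also have "\<dots> = (\<Sum>w\<in>W. Poly_Mapping.single 0 (Poly_Mapping.lookup y (gword w)) * tw w)"
    using inj by (subst sum.reindex) (auto intro: inj_on_subset simp: tw_def mult_single)
  finally have "y = (\<Sum>w\<in>W. Poly_Mapping.single 0 (Poly_Mapping.lookup y (gword w)) * tw w)" .
  moreover have "set w \<subseteq> qletters M N \<and> gword w \<in> Poly_Mapping.keys y" if "w \<in> W" for w
    using that assms in_range_gword[of M N w] unfolding W_def FC_def by auto
  ultimately show thesis using that[of W "\<lambda>w. Poly_Mapping.lookup y (gword w)"] fin by blast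
qed

lemma low_gword: "low d p (gword w) \<longleftrightarrow> qdeg w < d \<or> qdeg w = d \<and> length w < p"
  by (simp add: low_def wdeg_gword wlen_gword)

lemma psi_G:
  assumes "x \<in> G M N d p" "d < sdeg n s \<or> d = sdeg n s \<and> p \<le> socc n s"
  shows "psi n x s = 0"
proof -
  obtain y where y: "y \<in> FC M N" "x - y \<in> yangian_ideal M N" "\<forall>w\<in>Poly_Mapping.keys y. low d p w"
    using assms(1) unfolding G_def by blast
  obtain W c where W: "finite W" "\<And>w. w \<in> W \<Longrightarrow> set w \<subseteq> qletters M N \<and> gword w \<in> Poly_Mapping.keys y"
    "y = (\<Sum>w\<in>W. Poly_Mapping.single 0 (c w) * tw w)"
    using free_elem_tw_sum[OF y(1)] by metis
  have "psi n (tw w) s = 0" if "w \<in> W" for w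
  proof (rule psi_tw_low)
    show "set w \<subseteq> qletters M N" using W(2) that by blast
    have "low d p (gword w)" using W(2) that y(3) by blast
    then show "qdeg w < sdeg n s \<or> qdeg w = sdeg n s \<and> length w < socc n s"
      using assms(2) by (auto simp: low_gword)
  qed
  then have "psi n y s = 0" by (simp add: W(3) psi_sum psi_scale)
  moreover have "psi n x s - psi n y s = 0" using psi_YI[OF y(2)] by (simp add: psi_diff)
  ultimately show ?thesis by simp
qed

text \<open>Read off in the power with exactly \<open>p\<close> factors, at states in which every
  site is occupied. Words of smaller degree, or of the same degree and smaller length, do not reach
  these states.\<close>

definition symbol :: "nat \<Rightarrow> nat \<Rightarrow> free_elem \<Rightarrow> letter list \<Rightarrow> complex" where
  "symbol d p x v = (if qdeg v = d \<and> length v = p then psi p x (state_of v) else 0)"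

lemma symbol_reconstruct:
  assumes "x \<in> G M N d (Suc p)"
  obtains X where "finite X" "X \<subseteq> qletters M N"
    "\<And>X'. finite X' \<Longrightarrow> X \<subseteq> X' \<Longrightarrow> X' \<subseteq> qletters M N \<Longrightarrow>
       wsum X' p (symbol d p x) - of_nat (fact p) * x \<in> G M N d p"
proof -
  obtain y where y: "y \<in> FC M N" "x - y \<in> yangian_ideal M N" "\<forall>w\<in>Poly_Mapping.keys y. low d (Suc p) w"
    using assms unfolding G_def by blast
  obtain W c where W: "finite W" "\<And>w. w \<in> W \<Longrightarrow> set w \<subseteq> qletters M N \<and> gword w \<in> Poly_Mapping.keys y"
    "y = (\<Sum>w\<in>W. Poly_Mapping.single 0 (c w) * tw w)"
    using free_elem_tw_sum[OF y(1)] by metis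
  define W1 where "W1 = {w \<in> W. qdeg w = d \<and> length w = p}"
  define z where "z = (\<Sum>w\<in>W1. Poly_Mapping.single 0 (c w) * tw w)"
  have W1: "finite W1" "W1 \<subseteq> W" using W(1) by (auto simp: W1_def)
  have wl: "low d (Suc p) (gword w)" if "w \<in> W" for w using W(2) that y(3) by blast
  have "y - z = (\<Sum>w\<in>W - W1. Poly_Mapping.single 0 (c w) * tw w)"
    unfolding W(3) z_def by (simp add: sum_diff[OF W(1) W1(2)])
  moreover have "tw w \<in> G M N d p" if "w \<in> W - W1" for w
    using wl[of w] W(2)[of w] that by (intro tw_G) (auto simp: low_gword W1_def)
  ultimately have yz: "y - z \<in> G M N d p" by (auto intro!: G_sum G_scale)
  have xz: "x - z \<in> G M N d p"
    using G_add[OF G_YI[OF y(2)] yz] by simp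
  have sym: "symbol d p x v = (\<Sum>w\<in>W1. c w * Sym M w v)" for v
  proof (cases "qdeg v = d \<and> length v = p")
    case True
    have "psi p (x - z) (state_of v) = 0"
      using psi_G[OF xz, of p "state_of v"] True sdeg_state_of[of v] socc_state_of[of v] by simp
    then have "symbol d p x v = psi p z (state_of v)" using True by (simp add: symbol_def psi_diff)
    also have "\<dots> = (\<Sum>w\<in>W1. c w * psi p (tw w) (state_of v))"
      by (simp add: z_def psi_sum psi_scale)
    also have "\<dots> = (\<Sum>w\<in>W1. c w * Sym M w v)"
    proof (intro sum.cong refl)
      fix w assume "w \<in> W1"
      then show "c w * psi p (tw w) (state_of v) = c w * Sym M w v"
        using psi_tw_top[of w v] True W(2)[of w] by (auto simp: W1_def)
    qed
    finally show ?thesis .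
  next
    case False
    have "Sym M w v = 0" if "w \<in> W1" for w
    proof (rule ccontr)
      assume "Sym M w v \<noteq> 0"
      then have "mset v = mset w" by (rule Sym_nonzero)
      then show False using False that qdeg_mset[of v w] mset_eq_length[of v w] by (auto simp: W1_def)
    qed
    then show ?thesis using False by (auto simp: symbol_def intro!: sum.neutral)
  qed
  show thesis
  proof (rule that[of "\<Union>(set ` W1)"])
    show "finite (\<Union>(set ` W1))" using W1 by auto
    show "\<Union>(set ` W1) \<subseteq> qletters M N" using W(2) W1(2) by fast
    fix X' assume X': "finite X'" "\<Union>(set ` W1) \<subseteq> X'" "X' \<subseteq> qletters M N"
    have "wsum X' p (symbol d p x) = (\<Sum>w\<in>W1. Poly_Mapping.single 0 (c w) * wsum X' p (Sym M w))"
      unfolding sym[abs_def] wsum_sum wsum_scale ..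
    then have eq: "wsum X' p (symbol d p x) - of_nat (fact p) * z =
        (\<Sum>w\<in>W1. Poly_Mapping.single 0 (c w) * (wsum X' p (Sym M w) - of_nat (fact p) * tw w))"
      by (simp only: z_def right_diff_distrib sum_subtractf sum_distrib_left scale_left_commute)
    have "wsum X' p (Sym M w) - of_nat (fact p) * tw w \<in> G M N d p" if "w \<in> W1" for w
      using wsum_Sym[OF X'(1,3), of w] X'(2) that by (auto simp: W1_def)
    then have "wsum X' p (symbol d p x) - of_nat (fact p) * z \<in> G M N d p"
      unfolding eq by (intro G_sum G_scale)
    from G_diff[OF this G_of_nat[OF xz, of "fact p"]]
    show "wsum X' p (symbol d p x) - of_nat (fact p) * x \<in> G M N d p"
      by (simp add: right_diff_distrib)
  qed
qed

lemma of_nat_scale: "Poly_Mapping.single 0 (1 / of_nat n) * (of_nat n * x) = x" if "n \<noteq> 0" for x :: free_elem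
proof -
  have e: "(of_nat n :: free_elem) = Poly_Mapping.single 0 (of_nat n)"
    by (induction n) (simp_all add: single_add)
  have "Poly_Mapping.single 0 (1 / of_nat n) * (of_nat n :: free_elem) = 1"
    unfolding e mult_single using that by simp
  then show ?thesis by (simp add: mult.assoc[symmetric])
qed

text \<open>Reconstruction from the zero symbol shows that \<open>fact p\<close> times the element
  is lower, and the factorial is invertible. This is the independence part of the basis
  theorem.\<close>

lemma symbol_zero:
  assumes "x \<in> G M N d (Suc p)" "\<And>v. symbol d p x v = 0"
  shows "x \<in> G M N d p"
proof -
  obtain X where X: "finite X" "X \<subseteq> qletters M N" "wsum X p (symbol d p x) - of_nat (fact p) * x \<in> G M N d p"
    using symbol_reconstruct[OF assms(1)] by (metis order_refl)
  have "symbol d p x = (\<lambda>v. 0)" using assms(2) by auto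
  then have "wsum X p (symbol d p x) = 0" by (simp add: wsum_def)
  then have "of_nat (fact p) * x \<in> G M N d p" using G_uminus[OF X(3)] by simp
  from G_scale[OF this, of "1 / of_nat (fact p)"] show ?thesis
    unfolding of_nat_scale[OF fact_nonzero] .
qed

lemma G_0_Suc:
  assumes "x \<in> G M N (Suc d) 0"
  obtains p where "x \<in> G M N d p"
proof -
  obtain y where y: "y \<in> FC M N" "x - y \<in> yangian_ideal M N" "\<forall>w\<in>Poly_Mapping.keys y. low (Suc d) 0 w"
    using assms unfolding G_def by blast
  define p where "p = Suc (Max (insert 0 (wlen ` Poly_Mapping.keys y)))"
  have "wlen w < p" if "w \<in> Poly_Mapping.keys y" for w
    using that by (auto simp: p_def less_Suc_eq_le)
  then have "low d p w" if "w \<in> Poly_Mapping.keys y" for w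
    using that y(3) by (auto simp: low_def less_Suc_eq)
  then show thesis using that[of p] G_I[OF y(1) G_FC[OF assms] y(2)] by blast
qed

lemma FC_G:
  assumes "x \<in> FC M N"
  obtains d p where "x \<in> G M N d p"
proof -
  define d where "d = Suc (Max (insert 0 (wdeg ` Poly_Mapping.keys x)))"
  have "wdeg w < d" if "w \<in> Poly_Mapping.keys x" for w
    using that by (auto simp: d_def less_Suc_eq_le)
  then have "x \<in> G M N d 0"
    using assms by (intro G_I[of x]) (auto simp: low_def)
  then show thesis by (rule that)
qed

lemma G_00: "x \<in> G M N 0 0 \<longleftrightarrow> x \<in> yangian_ideal M N"
proof
  assume "x \<in> G M N 0 0"
  then obtain y where y: "y \<in> FC M N" "x - y \<in> yangian_ideal M N" "\<forall>w\<in>Poly_Mapping.keys y. low 0 0 w"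
    unfolding G_def by blast
  then have "Poly_Mapping.keys y = {}" by (auto simp: low_def)
  then show "x \<in> yangian_ideal M N" using y(2) by simp
qed (rule G_YI)

text \<open>Descent along the lexicographic order. Below degree \<open>Suc d\<close> and length 0
  there is no largest pair, so \<open>drop\<close> uses a length bound belonging to the given
  element. In \<open>step\<close> the hypothesis covers all lower elements, because it will be
  applied to a difference.\<close>

lemma G_induct [consumes 1, case_names bottom drop step]:
  assumes "x \<in> G M N d p"
    and bottom: "\<And>x. x \<in> yangian_ideal M N \<Longrightarrow> P x 0 0"
    and drop: "\<And>x d p. x \<in> G M N (Suc d) 0 \<Longrightarrow> x \<in> G M N d p \<Longrightarrow> P x d p \<Longrightarrow> P x (Suc d) 0"
    and step: "\<And>x d p. x \<in> G M N d (Suc p) \<Longrightarrow> (\<And>y. y \<in> G M N d p \<Longrightarrow> P y d p) \<Longrightarrow> P x d (Suc p)"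
  shows "P x d p"
  using assms(1)
proof (induction d arbitrary: p x)
  case 0
  then show ?case
    by (induction p arbitrary: x) (auto intro: bottom step simp: G_00)
next
  case (Suc d)
  show ?case using Suc.prems
  proof (induction p arbitrary: x)
    case 0
    then obtain p where "x \<in> G M N d p" by (rule G_0_Suc)
    then show ?case using 0 drop Suc.IH by blast
  qed (auto intro: step)
qed

text \<open>Start from any bound for \<open>x\<close>. As long as it lies above the desired one, the
  hypothesis makes the symbol vanish at all words, and the bound can be lowered.\<close>

lemma psi_criterion:
  assumes "x \<in> FC M N"
    and "\<And>n s. (\<forall>k\<ge>n. s k = None) \<Longrightarrow> d < sdeg n s \<or> d = sdeg n s \<and> p \<le> socc n s \<Longrightarrow> psi n x s = 0"
  shows "x \<in> G M N d p"
proof -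
  obtain D P where "x \<in> G M N D P" using FC_G[OF assms(1)] by blast
  then show ?thesis using assms(2)
  proof (induction rule: G_induct)
    case (bottom x)
    then show ?case by (simp add: G_YI)
  next
    case (step x D P)
    show ?case
    proof (cases "d < D \<or> d = D \<and> p \<le> P")
      case True
      have "symbol D P x v = 0" for v
      proof (cases "qdeg v = D \<and> length v = P")
        case v: True
        have "psi (length v) x (state_of v) = 0"
          using v True by (intro step.prems) (auto simp: sdeg_state_of socc_state_of state_of_None)
        then show ?thesis using v by (simp add: symbol_def)
      qed (auto simp: symbol_def)
      then have "x \<in> G M N D P" using symbol_zero step.hyps by blast
      then show ?thesis using step by blast
    next
      case False
      then show ?thesis using step.hyps by (elim G_mono) auto
    qed
  qed blast
qed

lemma YI_criterion:
  assumes "x \<in> FC M N" "\<And>n s. (\<forall>k\<ge>n. s k = None) \<Longrightarrow> psi n x s = 0"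
  shows "x \<in> yangian_ideal M N"
  using psi_criterion[of x 0 0] assms by (simp add: G_00)

end

section \<open>The inverse series and the central series\<close>

text \<open>The letter ij with z^q replaced by a polynomial in z; powers of z - c can then be
  handled by polynomial algebra instead of explicit binomial sums.\<close>

definition lamp :: "nat \<Rightarrow> nat \<Rightarrow> nat \<Rightarrow> nat \<Rightarrow> complex poly \<Rightarrow> state endo" where
  "lamp M k i j p = (\<Sum>q\<le>degree p. cs (coeff p q) * lam M k (i, j, q))"

lemma lamp_bound: "degree p \<le> D \<Longrightarrow> lamp M k i j p = (\<Sum>q\<le>D. cs (coeff p q) * lam M k (i, j, q))"
  unfolding lamp_def by (rule sum.mono_neutral_left) (auto simp: coeff_eq_0)

lemma lamp_0 [simp]: "lamp M k i j 0 = 0"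
  by (simp add: lamp_def)

lemma lamp_add: "lamp M k i j (p + p') = lamp M k i j p + lamp M k i j p'"
proof -
  define D where "D = max (degree p) (degree p')"
  have "degree p \<le> D" "degree p' \<le> D" "degree (p + p') \<le> D"
    by (auto simp: D_def degree_add_le)
  then show ?thesis
    by (simp add: lamp_bound[of _ D] cs_add distrib_right sum.distrib)
qed

lemma lamp_sum: "lamp M k i j (sum f A) = (\<Sum>a\<in>A. lamp M k i j (f a))"
  by (induction A rule: infinite_finite_induct) (simp_all add: lamp_add)

lemma lamp_smult: "lamp M k i j (smult c p) = cs c * lamp M k i j p"
  by (subst lamp_bound[of _ "degree p"]) (auto simp: lamp_def degree_smult_le cs_mult sum_distrib_left mult.assoc)

lemma lamp_diff: "lamp M k i j (p - p') = lamp M k i j p - lamp M k i j p'"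
  using lamp_add[of M k i j p "smult (-1) p'"] lamp_smult[of M k i j "-1" p'] by (simp add: cs_minus)

lemma lamp_monom: "lamp M k i j (monom c q) = cs c * lam M k (i, j, q)"
proof (subst lamp_bound[of _ q])
  have "(\<Sum>r\<le>q. cs (coeff (monom c q) r) * lam M k (i, j, r)) =
      (\<Sum>r\<le>q. if r = q then cs c * lam M k (i, j, q) else 0)"
    by (intro sum.cong refl) auto
  then show "(\<Sum>r\<le>q. cs (coeff (monom c q) r) * lam M k (i, j, r)) = cs c * lam M k (i, j, q)" by simp
qed (rule degree_monom_le)

lemma lamp_mult:
  "lamp M k i j p * lamp M k j' l p' =
    (if j = j' then (- 1) ^ (parity M i * parity M j + parity M i * parity M l + parity M j * parity M l) *
       lamp M k i l (p * p') else 0)" (is "_ = (if _ then ?s * _ else 0)")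
proof -
  have "lamp M k i j p * lamp M k j' l p' = (\<Sum>q\<le>degree p. \<Sum>q'\<le>degree p'.
      cs (coeff p q * coeff p' q') * (lam M k (i, j, q) * lam M k (j', l, q')))"
    by (simp add: lamp_def sum_product cs_mult mult.assoc cs_commute_left[of "lam M k x" for x])
  also have "\<dots> = (if j = j' then ?s * (\<Sum>q\<le>degree p. \<Sum>q'\<le>degree p'.
      cs (coeff p q * coeff p' q') * lam M k (i, l, q + q')) else 0)"
    by (simp add: lam_mult sum_distrib_left sign_commute_left[of "cs c" for c])
  also have "(\<Sum>q\<le>degree p. \<Sum>q'\<le>degree p'. cs (coeff p q * coeff p' q') * lam M k (i, l, q + q')) =
      lamp M k i l (\<Sum>q\<le>degree p. \<Sum>q'\<le>degree p'. monom (coeff p q) q * monom (coeff p' q') q')"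
    by (simp add: lamp_sum mult_monom lamp_monom)
  also have "(\<Sum>q\<le>degree p. \<Sum>q'\<le>degree p'. monom (coeff p q) q * monom (coeff p' q') q') = p * p'"
    unfolding sum_product[symmetric] poly_as_sum_of_monoms ..
  finally show ?thesis .
qed

lemma raises_lamp:
  assumes "k < n" "degree p \<le> d"
  shows "raises n (int d) (lamp M k i j p)"
  unfolding lamp_def
proof (intro raises_sum raises_cs)
  fix q assume "q \<in> {..degree p}"
  then show "raises n (int d) (lam M k (i, j, q))"
    using assms(2) by (intro raises_mono[OF raises_lam[OF assms(1)]]) (simp add: lq_def)
qed

subsection \<open>The shift of the formal variable\<close>

definition shift_fps :: "complex \<Rightarrow> nat \<Rightarrow> complex fps" where
  "shift_fps c r = fps_X ^ r * Abs_fps (\<lambda>n. (- of_nat r gchoose n) * c ^ n)"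

lemma shift_fps_nth:
  "shift_fps c r $ n = (if n < r then 0 else (- of_nat r gchoose (n - r)) * c ^ (n - r))"
  by (simp add: shift_fps_def fps_X_power_mult_nth)

text \<open>The law of exponents for powers of u + c, which is the Vandermonde convolution with
  negative upper entries. It makes the shift of a series multiplicative.\<close>

lemma shift_fps_add: "shift_fps c (a + b) = shift_fps c a * shift_fps c b"
proof -
  have "Abs_fps (\<lambda>n. (- of_nat a gchoose n) * c ^ n) * Abs_fps (\<lambda>n. (- of_nat b gchoose n) * c ^ n) =
      Abs_fps (\<lambda>n. (- of_nat (a + b) gchoose n) * c ^ n)"
  proof (rule fps_ext)
    fix n
    have "(\<Sum>k=0..n. (- of_nat a gchoose k) * c ^ k * ((- of_nat b gchoose (n - k)) * c ^ (n - k))) =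
        (\<Sum>k=0..n. (- of_nat a gchoose k) * (- of_nat b gchoose (n - k)) * c ^ n)"
      by (intro sum.cong refl) (simp add: power_add[symmetric] mult_ac)
    also have "\<dots> = (- of_nat a + - of_nat b gchoose n) * c ^ n"
      unfolding sum_distrib_right[symmetric] gbinomial_Vandermonde ..
    finally show "(Abs_fps (\<lambda>n. (- of_nat a gchoose n) * c ^ n) * Abs_fps (\<lambda>n. (- of_nat b gchoose n) * c ^ n)) $ n =
        Abs_fps (\<lambda>n. (- of_nat (a + b) gchoose n) * c ^ n) $ n"
      by (simp add: fps_mult_nth)
  qed
  then show ?thesis
    unfolding shift_fps_def by (simp add: power_add mult_ac)
qed

definition shift :: "complex \<Rightarrow> 's endo fps \<Rightarrow> 's endo fps" where
  "shift c f = Abs_fps (\<lambda>n. \<Sum>r\<le>n. cs (shift_fps c r $ n) * f $ r)"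

lemma shift_nth: "n \<le> m \<Longrightarrow> shift c f $ n = (\<Sum>r\<le>m. cs (shift_fps c r $ n) * f $ r)"
  unfolding shift_def fps_nth_Abs_fps by (rule sum.mono_neutral_left) (auto simp: shift_fps_nth)

lemma shift_add: "shift c (f + g) = shift c f + shift c g"
  by (rule fps_ext) (simp add: shift_def distrib_left sum.distrib)

lemma shift_0 [simp]: "shift c 0 = 0"
  by (rule fps_ext) (simp add: shift_def)

lemma shift_sum: "shift c (sum f A) = (\<Sum>a\<in>A. shift c (f a))"
  by (induction A rule: infinite_finite_induct) (simp_all add: shift_add)

lemma shift_sign: "shift c ((- 1) ^ n * f) = (- 1) ^ n * shift c f"
proof -
  have "shift c (- f) = - shift c f"
    by (rule fps_ext) (simp add: shift_def sum_negf)
  then show ?thesis by (cases "even n") auto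
qed

lemma shift_1 [simp]: "shift c 1 = 1"
proof (rule fps_ext)
  fix n
  have "shift c 1 $ n = (\<Sum>r\<le>n. if r = 0 then cs (shift_fps c 0 $ n) else 0)"
    unfolding shift_def fps_nth_Abs_fps by (intro sum.cong refl) auto
  also have "\<dots> = 1 $ n"
    by (cases n) (simp_all add: shift_fps_nth)
  finally show "shift c 1 $ n = (1 :: 'a endo fps) $ n" .
qed

lemma shift_mult: "shift c (f * g) = shift c f * shift c g"
proof (rule fps_ext)
  fix n
  have H: "(\<Sum>m\<le>n. cs (shift_fps c a $ m) * cs (shift_fps c b $ (n - m))) = cs (shift_fps c (a + b) $ n)" for a b
    by (simp add: shift_fps_add fps_mult_nth cs_sum cs_mult atLeast0AtMost)
  have "(shift c f * shift c g) $ n =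
     (\<Sum>m\<le>n. (\<Sum>a\<le>n. cs (shift_fps c a $ m) * f $ a) * (\<Sum>b\<le>n. cs (shift_fps c b $ (n - m)) * g $ b))"
    unfolding fps_mult_nth atLeast0AtMost by (intro sum.cong refl) (simp add: shift_nth[of _ n])
  also have "\<dots> = (\<Sum>m\<le>n. \<Sum>a\<le>n. \<Sum>b\<le>n. cs (shift_fps c a $ m) * cs (shift_fps c b $ (n - m)) * (f $ a * g $ b))"
    unfolding sum_product by (simp add: mult.assoc cs_commute_left[of "f $ a" for a])
  also have "\<dots> = (\<Sum>a\<le>n. \<Sum>b\<le>n. cs (shift_fps c (a + b) $ n) * (f $ a * g $ b))"
    unfolding H[symmetric] sum_distrib_right
    by (rule trans[OF sum.swap]) (intro sum.cong refl sum.swap)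
  also have "\<dots> = (\<Sum>(a, b)\<in>{..n} \<times> {..n}. cs (shift_fps c (a + b) $ n) * (f $ a * g $ b))"
    by (simp add: sum.cartesian_product)
  also have "\<dots> = (\<Sum>(a, b)\<in>{(a, b). a + b \<le> n}. cs (shift_fps c (a + b) $ n) * (f $ a * g $ b))"
  proof (rule sum.mono_neutral_right)
    have "cs (shift_fps c (a + b) $ n) * (f $ a * g $ b) = 0" if "\<not> a + b \<le> n" for a b
      using that by (simp add: shift_fps_nth)
    then show "\<forall>i\<in>{..n} \<times> {..n} - {(a, b). a + b \<le> n}.
        (case i of (a, b) \<Rightarrow> cs (shift_fps c (a + b) $ n) * (f $ a * g $ b)) = 0" by auto
  qed auto
  also have "\<dots> = (\<Sum>r\<le>n. \<Sum>a\<le>r. cs (shift_fps c (a + (r - a)) $ n) * (f $ a * g $ (r - a)))"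
    by (rule sum.triangle_reindex_eq)
  also have "\<dots> = shift c (f * g) $ n"
    unfolding shift_def by (simp add: fps_mult_nth atLeast0AtMost sum_distrib_left)
  finally show "shift c (f * g) $ n = (shift c f * shift c g) $ n" by simp
qed

lemma linear_poly_power:
  "[:- c, 1:] ^ n = (\<Sum>q\<le>n. monom (of_nat (n choose q) * (- c) ^ (n - q)) q :: 'a::comm_ring_1 poly)"
proof -
  have *: "[:- c, 1:] = monom 1 1 + [:- c:]" by (simp add: monom_altdef)
  have "[:- c:] ^ m = [:(- c) ^ m:]" for m
    by (induction m) (simp_all add: one_pCons)
  moreover have "(monom 1 1 :: 'a poly) ^ q = monom 1 q" for q
    by (simp add: monom_power)
  ultimately show ?thesis
    unfolding * binomial_ring
    by (intro sum.cong refl) (simp add: mult.commute of_nat_poly smult_monom mult.assoc[symmetric] monom_0[symmetric] mult_monom)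
qed

text \<open>Replacing u by u + c in E/(u - z) replaces z by z - c, so the coefficients become powers
  of z - c.\<close>

lemma shift_tL:
  "shift c (tL M k i j) $ n = (case n of 0 \<Rightarrow> if i = j then 1 else 0 | Suc n \<Rightarrow> lamp M k i j ([:- c, 1:] ^ n))"
proof (cases n)
  case 0
  then show ?thesis by (simp add: shift_def shift_fps_nth)
next
  case (Suc n')
  have co: "shift_fps c (Suc q) $ Suc n' = of_nat (n' choose q) * (- c) ^ (n' - q)" if "q \<le> n'" for q
  proof -
    \<comment> \<open>Negation of the upper entry turns the binomial coefficient of the shift into
      an ordinary one.\<close>
    have "(- of_nat (Suc q) gchoose (n' - q) :: complex) =
        (- 1) ^ (n' - q) * ((of_nat (Suc q) + of_nat (n' - q) - 1) gchoose (n' - q))"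
      by (rule gbinomial_minus)
    also have "(of_nat (Suc q) + of_nat (n' - q) - 1 :: complex) = of_nat n'"
      using that by (simp add: of_nat_diff)
    also have "(of_nat n' gchoose (n' - q) :: complex) = of_nat (n' choose q)"
      using that by (simp add: binomial_gbinomial[symmetric] binomial_symmetric[symmetric])
    finally show ?thesis
      using that by (simp add: shift_fps_nth power_minus[of c] mult_ac)
  qed
  have "shift c (tL M k i j) $ Suc n' = cs (shift_fps c 0 $ Suc n') * tL M k i j $ 0 +
      (\<Sum>q\<le>n'. cs (shift_fps c (Suc q) $ Suc n') * lam M k (i, j, q))"
    unfolding shift_def by (simp only: fps_nth_Abs_fps sum.atMost_Suc_shift tL_Suc)
  also have "shift_fps c 0 $ Suc n' = 0"
    by (simp add: shift_fps_nth)
  also have "(\<Sum>q\<le>n'. cs (shift_fps c (Suc q) $ Suc n') * lam M k (i, j, q)) =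
      (\<Sum>q\<le>n'. lamp M k i j (monom (of_nat (n' choose q) * (- c) ^ (n' - q)) q))"
    by (intro sum.cong refl) (simp only: co lamp_monom atMost_iff)
  finally show ?thesis by (simp add: Suc linear_poly_power lamp_sum)
qed

subsection \<open>One site\<close>

context
  fixes M N :: nat
begin

definition kap :: complex where "kap = of_nat M - of_nat N"

lemma sum_sign_parity: "(\<Sum>k\<in>{1..M + N}. (- 1) ^ parity M k) = (of_nat M - of_nat N :: 'a::ring_1)"
proof -
  have "(\<Sum>k\<in>{1..M + N}. (- 1) ^ parity M k) = (\<Sum>k\<in>{1..M} \<union> {M + 1..M + N}. (- 1 :: 'a) ^ parity M k)"
    by (rule sum.cong) auto
  also have "\<dots> = (\<Sum>k\<in>{1..M}. (- 1) ^ parity M k) + (\<Sum>k\<in>{M + 1..M + N}. (- 1 :: 'a) ^ parity M k)"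
    by (rule sum.union_disjoint) auto
  also have "(\<Sum>k\<in>{1..M}. (- 1 :: 'a) ^ parity M k) = (\<Sum>k\<in>{1..M}. 1)"
    by (rule sum.cong) (auto simp: parity_def)
  also have "(\<Sum>k\<in>{M + 1..M + N}. (- 1 :: 'a) ^ parity M k) = (\<Sum>k\<in>{M + 1..M + N}. - 1)"
    by (rule sum.cong) (auto simp: parity_def)
  finally show ?thesis by simp
qed

text \<open>The series 1 - E/(u - z + kap). As E contracts with itself to kap E, the product of 1 +
  a E and 1 - b E is 1 exactly if a - b = kap a b, that is, 1/b = 1/a + kap, here with 1/a = u -
  z.\<close>

definition tLi :: "nat \<Rightarrow> nat \<Rightarrow> nat \<Rightarrow> state endo fps" where
  "tLi k i j = Abs_fps (\<lambda>n. case n of 0 \<Rightarrow> if i = j then 1 else 0 | Suc n \<Rightarrow> - lamp M k i j ([:- kap, 1:] ^ n))"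

lemma tLi_0 [simp]: "tLi k i j $ 0 = (if i = j then 1 else 0)"
  and tLi_Suc [simp]: "tLi k i j $ Suc n = - lamp M k i j ([:- kap, 1:] ^ n)"
  by (simp_all add: tLi_def)

lemma fps_mult_Suc_split:
  "(f * g) $ Suc n = f $ 0 * g $ Suc n + f $ Suc n * g $ 0 + (\<Sum>a<n. f $ Suc a * g $ (n - a))"
  for f g :: "'a::ring_1 fps"
proof -
  have "(f * g) $ Suc n = f $ 0 * g $ Suc n + (\<Sum>a\<le>n. f $ Suc a * g $ (n - a))"
    unfolding fps_mult_nth atLeast0AtMost sum.atMost_Suc_shift by simp
  then show ?thesis by (simp add: lessThan_Suc_atMost[symmetric] add_ac)
qed

lemma tL_tLi:
  assumes "i \<in> {1..M + N}" "j \<in> {1..M + N}"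
  shows "(\<Sum>k\<in>{1..M + N}. (- 1) ^ ((parity M i + parity M k) * (parity M k + parity M j)) *
    (tL M m i k * tLi m k j)) = (if i = j then 1 else 0)" (is "?l = _")
proof (rule fps_ext)
  fix n
  let ?s = "\<lambda>k. (- 1 :: state endo) ^ ((parity M i + parity M k) * (parity M k + parity M j))"
  show "?l $ n = (if i = j then 1 else 0) $ n"
  proof (cases n)
    case 0
    have "?l $ 0 = (\<Sum>k\<in>{1..M + N}. if k = i then if i = j then 1 else 0 else 0)"
      unfolding fps_sum_nth fps_sign_nth by (intro sum.cong refl) auto
    then show ?thesis using assms 0 by simp
  next
    case (Suc n')
    let ?z = "[:- kap, 1:]"
    have "?s k * (tL M m i k * tLi m k j) $ Suc n' = (if k = i then - lamp M m i j (?z ^ n') else 0) +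
        (if k = j then lam M m (i, j, n') else 0) -
        (- 1) ^ parity M k * (\<Sum>a<n'. lamp M m i j (monom 1 a * ?z ^ (n' - Suc a)))" for k
    proof -
      have "?s k * (lam M m (i, k, a) * tLi m k j $ (n' - a)) =
          - ((- 1) ^ parity M k * lamp M m i j (monom 1 a * ?z ^ (n' - Suc a)))" if "a < n'" for a
      proof -
        have b: "n' - a = Suc (n' - Suc a)" using that by simp
        have sg: "(- 1 :: state endo) ^ ((parity M i + parity M k) * (parity M k + parity M j)) *
            (- 1) ^ (parity M i * parity M k + parity M i * parity M j + parity M k * parity M j) = (- 1) ^ parity M k"
          by (cases rule: parity_eq_cases[of M i]; cases rule: parity_eq_cases[of M j];
              cases rule: parity_eq_cases[of M k]; simp)
        have "lam M m (i, k, a) * tLi m k j $ (n' - a) = - (lamp M m i k (monom 1 a) * lamp M m k j (?z ^ (n' - Suc a)))"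
          unfolding b by (simp add: lamp_monom)
        also have "?s k * \<dots> = - ((- 1) ^ parity M k * lamp M m i j (monom 1 a * ?z ^ (n' - Suc a)))"
          unfolding lamp_mult sg[symmetric] by (simp add: mult.assoc)
        finally show ?thesis .
      qed
      then have "(\<Sum>a<n'. ?s k * (lam M m (i, k, a) * tLi m k j $ (n' - a))) =
          - ((- 1) ^ parity M k * (\<Sum>a<n'. lamp M m i j (monom 1 a * ?z ^ (n' - Suc a))))"
        by (simp add: sum_distrib_left sum_negf)
      then show ?thesis
        by (simp add: fps_mult_Suc_split distrib_left sum_distrib_left)
    qed
    then have "?l $ Suc n' = - lamp M m i j (?z ^ n') + lam M m (i, j, n') -
        (\<Sum>k\<in>{1..M + N}. (- 1) ^ parity M k) * (\<Sum>a<n'. lamp M m i j (monom 1 a * ?z ^ (n' - Suc a)))"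
      unfolding fps_sum_nth fps_sign_nth using assms
      by (simp only: sum_subtractf sum.distrib sum_distrib_right sum.delta finite_atLeastAtMost if_True)
    also have "(\<Sum>k\<in>{1..M + N}. (- 1) ^ parity M k) = (cs kap :: state endo)"
      unfolding sum_sign_parity kap_def cs_diff cs_of_nat ..
    also have "cs kap * (\<Sum>a<n'. lamp M m i j (monom 1 a * ?z ^ (n' - Suc a))) =
        lamp M m i j (smult kap (\<Sum>a<n'. monom 1 a * ?z ^ (n' - Suc a)))"
      by (simp add: lamp_smult lamp_sum)
    \<comment> \<open>The factor \<open>kap\<close> from the contraction is the difference of z and
      z - kap, so the sum telescopes.\<close>
    also have "smult kap (\<Sum>a<n'. monom 1 a * ?z ^ (n' - Suc a)) = monom 1 n' - ?z ^ n'"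
    proof -
      have "(monom 1 1 :: complex poly) ^ n' - ?z ^ n' =
          (monom 1 1 - ?z) * (\<Sum>a<n'. ?z ^ (n' - Suc a) * monom 1 1 ^ a)"
        by (rule power_diff_sumr2)
      also have "monom 1 1 - ?z = [:kap:]" by (simp add: monom_altdef)
      finally show ?thesis by (simp add: monom_power mult.commute)
    qed
    finally show ?thesis
      by (simp add: Suc lamp_diff lamp_monom)
  qed
qed

text \<open>In the signed basis of letters this supertrace is left multiplication by the scalar
  matrix p(z).\<close>

definition lamI :: "nat \<Rightarrow> complex poly \<Rightarrow> state endo" where
  "lamI k p = (\<Sum>c\<in>{1..M + N}. (- 1) ^ parity M c * lamp M k c c p)"

text \<open>The expansion of 1 - I/(u - w)^2 with w = z - kap; the coefficient of u^(-n) of the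
  fraction is (n - 1) w^(n - 2). The values at 0 and 1 are separate because \<open>n - 2\<close> is
  truncated there.\<close>

definition site_Z :: "nat \<Rightarrow> state endo fps" where
  "site_Z k = Abs_fps (\<lambda>n. if n = 0 then 1 else if n = 1 then 0 else - (of_nat (n - 1) * lamI k ([:- kap, 1:] ^ (n - 2))))"

text \<open>After the shift both series have the same denominator u - z + kap, so the terms linear
  in E cancel. The quadratic term contracts in the opposite order, which leaves a scalar matrix and
  only the diagonal entries.\<close>

lemma shift_tL_tLi:
  assumes "i \<in> {1..M + N}" "j \<in> {1..M + N}"
  shows "(\<Sum>k\<in>{1..M + N}. shift kap (tL M m k j) * tLi m i k) = (if i = j then site_Z m else 0)" (is "?l = _")
proof (rule fps_ext)
  fix n
  show "?l $ n = (if i = j then site_Z m else 0) $ n"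
  proof (cases n)
    case 0
    have "?l $ 0 = (\<Sum>k\<in>{1..M + N}. if k = i then if i = j then 1 else 0 else 0)"
      unfolding fps_sum_nth by (intro sum.cong refl) (auto simp: shift_tL)
    then show ?thesis using assms 0 by (simp add: site_Z_def)
  next
    case (Suc n')
    let ?z = "[:- kap, 1:]"
    have "(shift kap (tL M m k j) * tLi m i k) $ Suc n' = (if k = j then - lamp M m i j (?z ^ n') else 0) +
        (if k = i then lamp M m i j (?z ^ n') else 0) -
        (if i = j then (- 1) ^ parity M k * (of_nat n' * lamp M m k k (?z ^ (n' - 1))) else 0)" for k
    proof -
      have "shift kap (tL M m k j) $ Suc a * tLi m i k $ (n' - a) =
          - (if i = j then (- 1) ^ parity M k * lamp M m k k (?z ^ (n' - 1)) else 0)" if "a < n'" for a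
      proof -
        have b: "n' - a = Suc (n' - Suc a)" "a + (n' - Suc a) = n' - 1" using that by auto
        have sg: "(- 1 :: state endo) ^ (parity M k * parity M j + parity M k * parity M k + parity M j * parity M k) =
            (- 1) ^ parity M k"
          by (cases rule: parity_eq_cases[of M j]; cases rule: parity_eq_cases[of M k]; simp)
        show ?thesis
          unfolding b(1) by (auto simp: shift_tL lamp_mult sg power_add[symmetric] b(2))
      qed
      then have "(\<Sum>a<n'. shift kap (tL M m k j) $ Suc a * tLi m i k $ (n' - a)) =
          - (if i = j then (- 1) ^ parity M k * (of_nat n' * lamp M m k k (?z ^ (n' - 1))) else 0)"
        by (simp add: sign_commute_left[of "of_nat n" for n])
      then show ?thesis
        by (simp add: fps_mult_Suc_split shift_tL)
    qed
    then have "?l $ Suc n' = - lamp M m i j (?z ^ n') + lamp M m i j (?z ^ n') -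
        (if i = j then of_nat n' * lamI m (?z ^ (n' - 1)) else 0)"
      unfolding fps_sum_nth using assms
      by (simp add: sum_subtractf sum.distrib lamI_def sum_distrib_left sign_commute_left[of "of_nat n" for n])
    then show ?thesis by (simp add: Suc site_Z_def)
  qed
qed

subsection \<open>Several sites\<close>

primrec tTi :: "nat \<Rightarrow> nat \<Rightarrow> nat \<Rightarrow> state endo fps" where
  "tTi 0 = (\<lambda>i j. if i = j then 1 else 0)"
| "tTi (Suc m) = (\<lambda>i j. \<Sum>c\<in>{1..M + N}.
     (- 1) ^ ((parity M i + parity M c) * (parity M c + parity M j)) * (tLi m i c * tTi m c j))"

primrec tZ :: "nat \<Rightarrow> state endo fps" where
  "tZ 0 = 1"
| "tZ (Suc m) = tZ m * site_Z m"

text \<open>The factors of \<open>tTi\<close> stand in reverse order, so the two series of the last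
  site meet in the middle and collapse to the identity.\<close>

lemma tT_tTi:
  assumes "i \<in> {1..M + N}" "j \<in> {1..M + N}"
  shows "(\<Sum>k\<in>{1..M + N}. (- 1) ^ ((parity M i + parity M k) * (parity M k + parity M j)) *
    (tT M N m i k * tTi m k j)) = (if i = j then 1 else 0)"
  using assms
proof (induction m arbitrary: i j)
  case 0
  have "(\<Sum>k\<in>{1..M + N}. (- 1) ^ ((parity M i + parity M k) * (parity M k + parity M j)) *
    (tT M N 0 i k * tTi 0 k j)) = (\<Sum>k\<in>{1..M + N}. if k = i then if i = j then 1 else 0 else 0)"
    by (intro sum.cong refl) auto
  then show ?case using 0 by simp
next
  case (Suc m)
  let ?s = "\<lambda>i k j. (- 1 :: state endo fps) ^ ((parity M i + parity M k) * (parity M k + parity M j))"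
  define e where "e a d = (- 1 :: state endo fps) ^ (parity M i * parity M j + parity M i * parity M a + parity M a +
      parity M d + parity M j * parity M d + parity M a * parity M d)" for a d
  have sg: "?s i k j * (?s i a k * ?s k d j) = e a d * ?s a k d" for a d k
    unfolding e_def power_add[symmetric]
    by (cases rule: parity_eq_cases[of M i]; cases rule: parity_eq_cases[of M j]; cases rule: parity_eq_cases[of M k];
        cases rule: parity_eq_cases[of M a]; cases rule: parity_eq_cases[of M d]; simp)
  note pull = sign_commute_left[of "tT M N m i k" for i k] sign_commute_left[of "tL M m i k" for i k]
    sign_commute_left[of "tLi m i k" for i k]
  have "(\<Sum>k\<in>{1..M + N}. ?s i k j * (tT M N (Suc m) i k * tTi (Suc m) k j)) =
    (\<Sum>k\<in>{1..M + N}. \<Sum>a\<in>{1..M + N}. \<Sum>d\<in>{1..M + N}.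
      e a d * (tT M N m i a * (?s a k d * (tL M m a k * tLi m k d) * tTi m d j)))"
  proof (intro sum.cong refl)
    fix k
    have "?s i k j * (?s i a k * (tT M N m i a * tL M m a k) * (?s k d j * (tLi m k d * tTi m d j))) =
        e a d * (tT M N m i a * (?s a k d * (tL M m a k * tLi m k d) * tTi m d j))" for a d
    proof -
      have "?s i k j * (?s i a k * (tT M N m i a * tL M m a k) * (?s k d j * (tLi m k d * tTi m d j))) =
        (?s i k j * (?s i a k * ?s k d j)) * (tT M N m i a * (tL M m a k * (tLi m k d * tTi m d j)))"
        by (simp only: mult.assoc pull)
      also have "\<dots> = e a d * (tT M N m i a * (?s a k d * (tL M m a k * tLi m k d) * tTi m d j))"
        unfolding sg by (simp only: mult.assoc pull)
      finally show ?thesis .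
    qed
    then show "?s i k j * (tT M N (Suc m) i k * tTi (Suc m) k j) =
      (\<Sum>a\<in>{1..M + N}. \<Sum>d\<in>{1..M + N}. e a d * (tT M N m i a * (?s a k d * (tL M m a k * tLi m k d) * tTi m d j)))"
      unfolding tT.simps tTi.simps sum_product unfolding sum_distrib_left by (simp only:)
  qed
  also have "\<dots> = (\<Sum>a\<in>{1..M + N}. \<Sum>d\<in>{1..M + N}. \<Sum>k\<in>{1..M + N}.
      e a d * (tT M N m i a * (?s a k d * (tL M m a k * tLi m k d) * tTi m d j)))"
    by (rule trans[OF sum.swap]) (intro sum.cong refl sum.swap)
  also have "\<dots> = (\<Sum>a\<in>{1..M + N}. \<Sum>d\<in>{1..M + N}. e a d * (tT M N m i a * ((if a = d then 1 else 0) * tTi m d j)))"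
    unfolding sum_distrib_left[symmetric] sum_distrib_right[symmetric]
    by (intro sum.cong refl) (simp only: tL_tLi)
  also have "\<dots> = (\<Sum>a\<in>{1..M + N}. \<Sum>d\<in>{1..M + N}. if d = a then e a a * (tT M N m i a * tTi m a j) else 0)"
    by (intro sum.cong refl) auto
  also have "\<dots> = (\<Sum>a\<in>{1..M + N}. e a a * (tT M N m i a * tTi m a j))"
    by (intro sum.cong refl) simp
  also have "\<dots> = (\<Sum>a\<in>{1..M + N}. ?s i a j * (tT M N m i a * tTi m a j))"
  proof (intro sum.cong refl)
    fix a
    have "e a a = ?s i a j"
      unfolding e_def by (cases rule: parity_eq_cases[of M i]; cases rule: parity_eq_cases[of M j];
          cases rule: parity_eq_cases[of M a]; simp)
    then show "e a a * (tT M N m i a * tTi m a j) = ?s i a j * (tT M N m i a * tTi m a j)" by simp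
  qed
  also have "\<dots> = (if i = j then 1 else 0)"
    by (rule Suc.IH[OF Suc.prems])
  finally show ?case .
qed

lemma fps_supercommute:
  fixes f g :: "'a::ring_1 fps"
  assumes "\<And>a b. f $ a * g $ b = (- 1) ^ n * (g $ b * f $ a)"
  shows "f * g = (- 1) ^ n * (g * f)"
proof (rule fps_ext)
  fix r
  have "(f * g) $ r = (- 1) ^ n * (\<Sum>a=0..r. g $ (r - a) * f $ a)"
    by (simp add: fps_mult_nth assms sum_distrib_left)
  also have "(\<Sum>a=0..r. g $ (r - a) * f $ a) = (g * f) $ r"
    unfolding fps_mult_nth by (rule sum.reindex_bij_witness[of _ "\<lambda>a. r - a" "\<lambda>a. r - a"]) auto
  finally show "(f * g) $ r = ((- 1) ^ n * (g * f)) $ r" by (simp add: fps_sign_nth)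
qed

lemma lamp_supercommutes:
  assumes "site_supercommutes M I k \<pi> Y" "i \<in> I" "j \<in> I"
  shows "lamp M k i j p * Y = (- 1) ^ ((parity M i + parity M j) * \<pi>) * (Y * lamp M k i j p)"
proof -
  have "cs c * lam M k (i, j, q) * Y = (- 1) ^ ((parity M i + parity M j) * \<pi>) * (Y * (cs c * lam M k (i, j, q)))" for c q
    using assms unfolding site_supercommutes_def
    by (simp add: mult.assoc cs_commute_left[of Y] sign_commute_left[of "cs c"])
  then show ?thesis by (simp add: lamp_def sum_distrib_left sum_distrib_right)
qed

lemma tTi_supercommutes:
  assumes "\<And>k. k < m \<Longrightarrow> site_supercommutes M {1..M + N} k \<pi> Y" "i \<in> {1..M + N}" "j \<in> {1..M + N}"
  shows "tTi m i j $ n * Y = (- 1) ^ ((parity M i + parity M j) * \<pi>) * (Y * tTi m i j $ n)"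
  using assms
proof (induction m arbitrary: i j n)
  case (Suc m)
  have L: "tLi m i c $ a * Y = (- 1) ^ ((parity M i + parity M c) * \<pi>) * (Y * tLi m i c $ a)"
    if "c \<in> {1..M + N}" for c a
    using lamp_supercommutes[OF Suc.prems(1)[OF lessI] Suc.prems(2) that] by (cases a) auto
  show ?case
    unfolding tTi.simps by (rule fps_product_supercommutes) (use L Suc in auto)
qed simp

lemma site_supercommutes_lamp:
  assumes "k \<noteq> m"
  shows "site_supercommutes M I k (parity M c + parity M j) (lamp M m c j p)"
proof -
  have "lam M k x * (cs a * lam M m (c, j, q)) =
      (- 1) ^ (lpar M x * (parity M c + parity M j)) * (cs a * lam M m (c, j, q) * lam M k x)" for x a q
    using lam_lam_commute[OF assms, of M x "(c, j, q)"]
    by (simp add: lpar_def mult.assoc cs_commute_left[of "lam M k x"] sign_commute_left[of "cs a"])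
  then have "lam M k x * lamp M m c j p =
      (- 1) ^ (lpar M x * (parity M c + parity M j)) * (lamp M m c j p * lam M k x)" for x
    by (simp add: lamp_def sum_distrib_left sum_distrib_right)
  then show ?thesis by (simp add: site_supercommutes_def lpar_def)
qed

text \<open>Z is group-like. The factor \<open>tTi\<close> of the first sites is moved to the left
  past both series of the last site, with which it supercommutes; the inner sum then closes by
  induction, and a sum over one site remains.\<close>

lemma shift_tT_tTi:
  assumes "i \<in> {1..M + N}" "j \<in> {1..M + N}"
  shows "(\<Sum>k\<in>{1..M + N}. shift kap (tT M N m k j) * tTi m i k) = (if i = j then tZ m else 0)"
  using assms
proof (induction m arbitrary: i j)
  case 0
  have "(\<Sum>k\<in>{1..M + N}. shift kap (tT M N 0 k j) * tTi 0 i k) =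
      (\<Sum>k\<in>{1..M + N}. if k = i then if i = j then 1 else 0 else 0)"
    by (intro sum.cong refl) auto
  then show ?case using 0 by simp
next
  case (Suc m)
  let ?s = "\<lambda>i k j. (- 1 :: state endo fps) ^ ((parity M i + parity M k) * (parity M k + parity M j))"
  let ?U = "\<lambda>k c. shift kap (tT M N m k c)" and ?V = "\<lambda>c. shift kap (tL M m c j)"
  define e where "e c d = (- 1 :: state endo fps) ^ (parity M c + parity M c * parity M j + parity M d * parity M c +
      parity M d * parity M j)" for c d
  have VT: "?V c * tTi m d k = (- 1) ^ ((parity M d + parity M k) * (parity M c + parity M j)) * (tTi m d k * ?V c)"
    if "d \<in> {1..M + N}" "k \<in> {1..M + N}" for c d k
  proof (rule fps_supercommute)
    fix a b
    have "site_supercommutes M {1..M + N} l (parity M c + parity M j) (?V c $ a)" if "l < m" for l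
      using site_supercommutes_lamp[of l m "{1..M+N}" c j] that
      by (cases a) (auto simp: shift_tL site_supercommutes_def)
    then have "tTi m d k $ b * ?V c $ a = (- 1) ^ ((parity M d + parity M k) * (parity M c + parity M j)) * (?V c $ a * tTi m d k $ b)"
      using that by (intro tTi_supercommutes) auto
    then show "?V c $ a * tTi m d k $ b = (- 1) ^ ((parity M d + parity M k) * (parity M c + parity M j)) * (tTi m d k $ b * ?V c $ a)"
      by (simp add: sign_square)
  qed
  have LT: "tLi m i d * tTi m d k = (- 1) ^ ((parity M d + parity M k) * (parity M i + parity M d)) * (tTi m d k * tLi m i d)"
    if "d \<in> {1..M + N}" "k \<in> {1..M + N}" for d k
  proof (rule fps_supercommute)
    fix a b
    have "site_supercommutes M {1..M + N} l (parity M i + parity M d) (tLi m i d $ a)" if "l < m" for l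
      using site_supercommutes_lamp[of l m "{1..M+N}" i d] that
      by (cases a) (auto simp: site_supercommutes_def)
    then have "tTi m d k $ b * tLi m i d $ a = (- 1) ^ ((parity M d + parity M k) * (parity M i + parity M d)) * (tLi m i d $ a * tTi m d k $ b)"
      using that by (intro tTi_supercommutes) auto
    then show "tLi m i d $ a * tTi m d k $ b = (- 1) ^ ((parity M d + parity M k) * (parity M i + parity M d)) * (tTi m d k $ b * tLi m i d $ a)"
      by (simp add: sign_square)
  qed
  note pull = sign_commute_left[of "shift c A" for c and A :: "state endo fps"] sign_commute_left[of "tTi m i k" for i k]
    sign_commute_left[of "tLi m i k" for i k]
  have "(\<Sum>k\<in>{1..M + N}. shift kap (tT M N (Suc m) k j) * tTi (Suc m) i k) =
    (\<Sum>k\<in>{1..M + N}. \<Sum>c\<in>{1..M + N}. \<Sum>d\<in>{1..M + N}. e c d * (?U k c * tTi m d k * (?V c * tLi m i d)))"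
  proof (intro sum.cong refl)
    fix k assume k: "k \<in> {1..M + N}"
    have fct: "?s k c j * (?U k c * ?V c) * (?s i d k * (tLi m i d * tTi m d k)) = e c d * (?U k c * tTi m d k * (?V c * tLi m i d))"
      if d: "d \<in> {1..M + N}" for c d
    proof -
      have sg: "?s k c j * (?s i d k * ((- 1) ^ ((parity M d + parity M k) * (parity M i + parity M d)) *
          (- 1) ^ ((parity M d + parity M k) * (parity M c + parity M j)))) = e c d"
        unfolding e_def power_add[symmetric]
        by (cases rule: parity_eq_cases[of M i]; cases rule: parity_eq_cases[of M j]; cases rule: parity_eq_cases[of M k];
          cases rule: parity_eq_cases[of M c]; cases rule: parity_eq_cases[of M d]; simp)
      have "?V c * (tLi m i d * tTi m d k) = (- 1) ^ ((parity M d + parity M k) * (parity M i + parity M d)) *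
          ((?V c * tTi m d k) * tLi m i d)"
        unfolding LT[OF d k] by (simp only: mult.assoc pull)
      also have "\<dots> = (- 1) ^ ((parity M d + parity M k) * (parity M i + parity M d)) *
          ((- 1) ^ ((parity M d + parity M k) * (parity M c + parity M j)) * (tTi m d k * (?V c * tLi m i d)))"
        unfolding VT[OF d k] by (simp only: mult.assoc)
      finally have 1: "?V c * (tLi m i d * tTi m d k) = \<dots>" .
      have "?s k c j * (?U k c * ?V c) * (?s i d k * (tLi m i d * tTi m d k)) =
          ?s k c j * (?s i d k * (?U k c * (?V c * (tLi m i d * tTi m d k))))"
        by (simp only: mult.assoc pull)
      also have "\<dots> = ?s k c j * (?s i d k * ((- 1) ^ ((parity M d + parity M k) * (parity M i + parity M d)) *
          (- 1) ^ ((parity M d + parity M k) * (parity M c + parity M j)))) * (?U k c * tTi m d k * (?V c * tLi m i d))"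
        unfolding 1 by (simp only: mult.assoc pull)
      finally show ?thesis unfolding sg .
    qed
    show "shift kap (tT M N (Suc m) k j) * tTi (Suc m) i k =
      (\<Sum>c\<in>{1..M + N}. \<Sum>d\<in>{1..M + N}. e c d * (?U k c * tTi m d k * (?V c * tLi m i d)))"
      unfolding tT.simps tTi.simps shift_sum shift_sign unfolding shift_mult sum_product
      by (intro sum.cong refl fct)
  qed
  also have "\<dots> = (\<Sum>c\<in>{1..M + N}. \<Sum>d\<in>{1..M + N}. \<Sum>k\<in>{1..M + N}. e c d * (?U k c * tTi m d k * (?V c * tLi m i d)))"
    by (rule trans[OF sum.swap]) (intro sum.cong refl sum.swap)
  also have "\<dots> = (\<Sum>c\<in>{1..M + N}. \<Sum>d\<in>{1..M + N}. e c d * ((if d = c then tZ m else 0) * (?V c * tLi m i d)))"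
    unfolding sum_distrib_left[symmetric] sum_distrib_right[symmetric]
    by (intro sum.cong refl) (simp only: Suc.IH)
  also have "\<dots> = (\<Sum>c\<in>{1..M + N}. \<Sum>d\<in>{1..M + N}. if d = c then tZ m * (?V c * tLi m i c) else 0)"
  proof (intro sum.cong refl)
    fix c d
    have "e c c = 1"
      unfolding e_def by (cases rule: parity_eq_cases[of M c]; cases rule: parity_eq_cases[of M j]; simp)
    then show "e c d * ((if d = c then tZ m else 0) * (?V c * tLi m i d)) =
        (if d = c then tZ m * (?V c * tLi m i c) else 0)" by auto
  qed
  also have "\<dots> = (\<Sum>c\<in>{1..M + N}. tZ m * (?V c * tLi m i c))"
    by (intro sum.cong refl) simp
  also have "\<dots> = (if i = j then tZ (Suc m) else 0)"
    unfolding sum_distrib_left[symmetric] shift_tL_tLi[OF Suc.prems] by simp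
  finally show ?case .
qed

end

text \<open>The constant term of \<open>A\<close> is the identity, so the coefficients of the
  unknown matrix are determined recursively. This identifies the image of the given inverse with the
  explicit one.\<close>

lemma right_inverse_unique:
  fixes A X Y :: "nat \<Rightarrow> nat \<Rightarrow> 'a::ring_1 fps"
  assumes fin: "finite I" and A0: "\<And>i j. i \<in> I \<Longrightarrow> j \<in> I \<Longrightarrow> A i j $ 0 = (if i = j then 1 else 0)"
    and eq: "\<And>i j. i \<in> I \<Longrightarrow> j \<in> I \<Longrightarrow>
      (\<Sum>k\<in>I. (- 1) ^ ((parity M i + parity M k) * (parity M k + parity M j)) * (A i k * X k j)) =
      (\<Sum>k\<in>I. (- 1) ^ ((parity M i + parity M k) * (parity M k + parity M j)) * (A i k * Y k j))"
    and "i \<in> I" "j \<in> I"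
  shows "X i j = Y i j"
proof -
  have "\<forall>i\<in>I. X i j $ n = Y i j $ n" for n
  proof (induction n rule: less_induct)
    case (less n)
    show ?case
    proof
      fix i assume i: "i \<in> I"
      have tm: "(A i k * X k j) $ n - (A i k * Y k j) $ n = (if k = i then X i j $ n - Y i j $ n else 0)"
        if k: "k \<in> I" for k
      proof -
        have "(A i k * X k j) $ n - (A i k * Y k j) $ n = (\<Sum>a=0..n. A i k $ a * (X k j $ (n - a) - Y k j $ (n - a)))"
          by (simp add: fps_mult_nth sum_subtractf right_diff_distrib)
        also have "\<dots> = (\<Sum>a=0..n. if a = 0 then A i k $ 0 * (X k j $ n - Y k j $ n) else 0)"
          using less.IH k by (intro sum.cong refl) auto
        finally show ?thesis using A0[OF i k] by auto
      qed
      have "0 = (\<Sum>k\<in>I. (- 1) ^ ((parity M i + parity M k) * (parity M k + parity M j)) *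
          ((A i k * X k j) $ n - (A i k * Y k j) $ n))"
        using arg_cong[OF eq[OF i \<open>j \<in> I\<close>], of "\<lambda>f. f $ n"]
        by (simp add: fps_sum_nth fps_sign_nth right_diff_distrib sum_subtractf)
      also have "\<dots> = (\<Sum>k\<in>I. if k = i then X i j $ n - Y i j $ n else 0)"
        by (intro sum.cong refl) (auto simp: tm)
      finally show "X i j $ n = Y i j $ n" using fin i by simp
    qed
  qed
  then show ?thesis using \<open>i \<in> I\<close> by (auto intro: fps_ext)
qed

context
  fixes M N :: nat
begin

section \<open>Properties of the central series\<close>

lemma site_Z_0: "site_Z M N k $ 0 = 1" and site_Z_1: "site_Z M N k $ Suc 0 = 0"
  and site_Z_2: "site_Z M N k $ Suc (Suc n) = cs (- of_nat (Suc n)) * lamI M N k ([:- kap M N, 1:] ^ n)"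
  by (simp_all add: site_Z_def cs_minus cs_of_nat del: of_nat_Suc)

lemma tZ_0: "tZ M N m $ 0 = 1"
  by (induction m) (simp_all add: site_Z_0)

lemma tZ_1: "tZ M N m $ Suc 0 = 0"
  by (induction m) (simp_all add: fps_mult_nth site_Z_0 site_Z_1 tZ_0)

lemma lamI_commutes:
  assumes "site_supercommutes M {1..M + N} k \<pi> Y"
  shows "lamI M N k p * Y = Y * lamI M N k p"
proof -
  have "(- 1) ^ parity M c * lamp M k c c p * Y = Y * ((- 1) ^ parity M c * lamp M k c c p)" if "c \<in> {1..M + N}" for c
  proof -
    have "lamp M k c c p * Y = Y * lamp M k c c p"
      using lamp_supercommutes[OF assms that that] by simp
    then show ?thesis by (simp only: mult.assoc sign_commute_left[of Y])
  qed
  then show ?thesis by (simp add: lamI_def sum_distrib_left sum_distrib_right)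
qed

text \<open>Only even operators at each site occur in \<open>tZ\<close>, so no sign appears,
  whatever the parity of \<open>Y\<close>. Applied to the grading operator this gives evenness of
  the coefficients of Z.\<close>

lemma tZ_commutes:
  assumes "\<And>k. k < m \<Longrightarrow> site_supercommutes M {1..M + N} k \<pi> Y"
  shows "tZ M N m $ n * Y = Y * tZ M N m $ n"
  using assms
proof (induction m arbitrary: n)
  case 0
  then show ?case by simp
next
  case (Suc m)
  have Z: "site_Z M N m $ a * Y = Y * site_Z M N m $ a" for a
  proof -
    consider "a = 0" | "a = Suc 0" | b where "a = Suc (Suc b)" by (metis not0_implies_Suc)
    then show ?thesis
    proof cases
      case (3 b)
      have "lamI M N m ([:- kap M N, 1:] ^ b) * Y = Y * lamI M N m ([:- kap M N, 1:] ^ b)"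
        by (rule lamI_commutes) (use Suc.prems in blast)
      then show ?thesis unfolding 3 site_Z_2 by (simp only: mult.assoc cs_commute_left[of Y])
    qed (simp_all add: site_Z_0 site_Z_1)
  qed
  have "tZ M N m $ a * site_Z M N m $ b * Y = Y * (tZ M N m $ a * site_Z M N m $ b)" for a b
  proof -
    have "tZ M N m $ a * Y = Y * tZ M N m $ a" by (rule Suc.IH) (use Suc.prems in simp)
    then show ?thesis using Z[of b] by (metis mult.assoc)
  qed
  then show ?case by (simp add: fps_mult_nth sum_distrib_left sum_distrib_right)
qed

text \<open>At the same site a scalar matrix commutes with every matrix, and polynomials in z
  commute; at other sites evenness removes the signs.\<close>

lemma lamI_site_supercommutes: "site_supercommutes M {1..M + N} k 0 (lamI M N l p)"
proof -
  have "lam M k (i, j, q) * lamI M N l p = lamI M N l p * lam M k (i, j, q)"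
    if ij: "i \<in> {1..M + N}" "j \<in> {1..M + N}" for i j q
  proof (cases "k = l")
    case False
    have "lam M k (i, j, q) * lamp M l c c p = lamp M l c c p * lam M k (i, j, q)" if "c \<in> {1..M + N}" for c
      using site_supercommutes_lamp[OF False, of M "{1..M + N}" c c p] that ij
      by (auto simp: site_supercommutes_def mult_2[symmetric] simp del: mult_2)
    then show ?thesis
      by (simp add: lamI_def sum_distrib_left sum_distrib_right mult.assoc sign_commute_left[of "lam M k x" for x])
  next
    case True
    have lam: "lam M l (i, j, q) = lamp M l i j (monom 1 q)" by (simp add: lamp_monom)
    have "lam M l (i, j, q) * lamI M N l p = (\<Sum>c\<in>{1..M + N}. if c = j then lamp M l i j (monom 1 q * p) else 0)"
      unfolding lamI_def sum_distrib_left
    proof (intro sum.cong refl)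
      fix c
      have "(- 1 :: state endo) ^ parity M j * (- 1) ^ (parity M i * parity M j + parity M i * parity M j + parity M j * parity M j) = 1"
        unfolding power_add[symmetric] by (cases rule: parity_eq_cases[of M j]) (auto simp flip: mult_2)
      then show "lam M l (i, j, q) * ((- 1) ^ parity M c * lamp M l c c p) =
          (if c = j then lamp M l i j (monom 1 q * p) else 0)"
        unfolding lam sign_commute_left lamp_mult by (auto simp: mult.assoc[symmetric])
    qed
    moreover have "lamI M N l p * lam M l (i, j, q) = (\<Sum>c\<in>{1..M + N}. if c = i then lamp M l i j (p * monom 1 q) else 0)"
      unfolding lamI_def sum_distrib_right
    proof (intro sum.cong refl)
      fix c
      have "(- 1 :: state endo) ^ parity M i * (- 1) ^ (parity M i * parity M i + parity M i * parity M j + parity M i * parity M j) = 1"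
        unfolding power_add[symmetric] by (cases rule: parity_eq_cases[of M i]) (auto simp flip: mult_2)
      then show "(- 1) ^ parity M c * lamp M l c c p * lam M l (i, j, q) =
          (if c = i then lamp M l i j (p * monom 1 q) else 0)"
        unfolding lam mult.assoc lamp_mult by (auto simp: mult.assoc[symmetric])
    qed
    ultimately show ?thesis using ij True by (simp add: mult.commute)
  qed
  then show ?thesis unfolding site_supercommutes_def mult_zero_right power_0 mult_1_left by blast
qed

lemma site_supercommutes_0_mult:
  assumes "site_supercommutes M I k 0 X" "site_supercommutes M I k 0 Y"
  shows "site_supercommutes M I k 0 (X * Y)"
  unfolding site_supercommutes_def mult_zero_right power_0 mult_1_left
proof (intro ballI allI)
  fix i j q assume "i \<in> I" "j \<in> I"
  then have x: "lam M k (i, j, q) * X = X * lam M k (i, j, q)" and y: "lam M k (i, j, q) * Y = Y * lam M k (i, j, q)"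
    using assms by (simp_all add: site_supercommutes_def)
  have "lam M k (i, j, q) * (X * Y) = X * (lam M k (i, j, q) * Y)"
    unfolding mult.assoc[symmetric] x ..
  then show "lam M k (i, j, q) * (X * Y) = X * Y * lam M k (i, j, q)"
    unfolding y mult.assoc .
qed

lemma site_supercommutes_sum:
  assumes "\<And>a. a \<in> A \<Longrightarrow> site_supercommutes M I k \<pi> (X a)"
  shows "site_supercommutes M I k \<pi> (sum X A)"
  using assms unfolding site_supercommutes_def by (simp add: sum_distrib_left sum_distrib_right)

lemma tZ_site_supercommutes: "site_supercommutes M {1..M + N} k 0 (tZ M N m $ n)"
proof (induction m arbitrary: n)
  case 0
  then show ?case by (simp add: site_supercommutes_def)
next
  case (Suc m)
  have "site_supercommutes M {1..M + N} k 0 (site_Z M N m $ a)" for a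
  proof -
    consider "a = 0" | "a = Suc 0" | b where "a = Suc (Suc b)" by (metis not0_implies_Suc)
    then show ?thesis
    proof cases
      case (3 b)
      have "site_supercommutes M {1..M + N} k 0 (cs c)" for c
        unfolding site_supercommutes_def mult_zero_right power_0 mult_1_left
        using cs_commute[of c, symmetric] by blast
      from site_supercommutes_0_mult[OF this lamI_site_supercommutes] show ?thesis
        unfolding 3 site_Z_2 .
    qed (simp_all add: site_Z_0 site_Z_1 site_supercommutes_def)
  qed
  then show ?case
    unfolding tZ.simps fps_mult_nth by (intro site_supercommutes_sum site_supercommutes_0_mult Suc.IH)
qed

lemma raises_lamI: "k < n \<Longrightarrow> degree p \<le> d \<Longrightarrow> raises n (int d) (lamI M N k p)"
  unfolding lamI_def by (intro raises_sum raises_sign raises_lamp)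

definition lead_op :: "nat \<Rightarrow> nat \<Rightarrow> state endo" where
  "lead_op m r = (\<Sum>c\<in>{1..M + N}. (- 1) ^ parity M c * Dop M m (c, c, r))"

lemma lead_op_Suc: "lead_op (Suc m) r = lead_op m r + lamI M N m (monom 1 r)"
  by (simp add: lead_op_def lamI_def Dop_def distrib_left sum.distrib lamp_monom)

lemma raises_lead_op: "m \<le> n \<Longrightarrow> raises n (int r) (lead_op m r)"
  unfolding lead_op_def using raises_Dop[of m n "(c, c, r)" M for c]
  by (intro raises_sum raises_sign) (simp add: lq_def)

lemma raises_of_nat: "raises n e X \<Longrightarrow> raises n e (of_nat r * X)"
  using raises_cs[of n e X "of_nat r"] by (simp add: cs_of_nat)

lemma lamI_diff: "lamI M N k (p - p') = lamI M N k p - lamI M N k p'"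
  by (simp add: lamI_def lamp_diff right_diff_distrib sum_subtractf)

lemma degree_linear_power_diff:
  "[:- c, 1:] ^ r - monom 1 r = (0 :: 'a::idom poly) \<or> degree ([:- c, 1:] ^ r - monom 1 r) < r"
proof (cases r)
  case (Suc r')
  have co: "coeff ([:- c, 1:] ^ r) r = 1"
    using lead_coeff_power[of "[:- c, 1:]" r] by (simp add: degree_power_eq)
  have "degree ([:- c, 1:] ^ r - monom 1 r) \<le> r'"
  proof (rule degree_le, intro allI impI)
    fix i assume "r' < i"
    then show "coeff ([:- c, 1:] ^ r - monom 1 r) i = 0"
      using co Suc by (cases "i = r") (auto simp: coeff_eq_0 degree_power_eq)
  qed
  then show ?thesis using Suc by simp
qed simp

text \<open>In the product of the site series a single nontrivial factor contributes -(r + 1) I (z -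
  kap)^r, whose top part is that of I z^r. Every further nontrivial factor uses up two powers of 1/u
  and so lowers the degree.\<close>

lemma raises_tZ_diff:
  assumes "m \<le> n"
  shows "raises n (int r - 1) (tZ M N m $ Suc (Suc r) + of_nat (Suc r) * lead_op m r)"
  using assms
proof (induction m arbitrary: r)
  case 0
  then show ?case by (simp add: lead_op_def Dop_def)
next
  case (Suc m)
  have m: "m < n" "m \<le> n" using Suc.prems by auto
  have Z: "raises n (int r) (tZ M N m $ Suc (Suc r))" for r
  proof -
    have "raises n (int r) ((tZ M N m $ Suc (Suc r) + of_nat (Suc r) * lead_op m r) - of_nat (Suc r) * lead_op m r)"
      using Suc.IH[OF m(2), of r] raises_lead_op[OF m(2), of r]
      by (intro raises_diff raises_of_nat) (auto elim: raises_mono)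
    then show ?thesis by simp
  qed
  have site_Z: "raises n (int r) (site_Z M N m $ Suc (Suc r))" for r
    unfolding site_Z_2 by (intro raises_cs raises_lamI m) (simp add: degree_power_eq)
  have zd: "raises n (int r - 1) (site_Z M N m $ Suc (Suc r) + of_nat (Suc r) * lamI M N m (monom 1 r))"
  proof -
    have eq: "site_Z M N m $ Suc (Suc r) + of_nat (Suc r) * lamI M N m (monom 1 r) =
        - (of_nat (Suc r) * lamI M N m ([:- kap M N, 1:] ^ r - monom 1 r))"
      unfolding site_Z_2 lamI_diff cs_minus cs_of_nat by (simp add: right_diff_distrib del: of_nat_Suc)
    show ?thesis
      using degree_linear_power_diff[of "kap M N" r]
    proof
      assume "[:- kap M N, 1:] ^ r - monom 1 r = 0"
      then show ?thesis unfolding eq by (simp add: lamI_def)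
    next
      assume deg: "degree ([:- kap M N, 1:] ^ r - monom 1 r) < r"
      then have "raises n (int (r - 1)) (lamI M N m ([:- kap M N, 1:] ^ r - monom 1 r))"
        using m by (intro raises_lamI) auto
      moreover have "int (r - 1) = int r - 1" using deg by simp
      ultimately show ?thesis unfolding eq by (intro raises_uminus raises_of_nat) simp
    qed
  qed
  have "(tZ M N m * site_Z M N m) $ Suc (Suc r) = site_Z M N m $ Suc (Suc r) + tZ M N m $ Suc (Suc r) +
      (\<Sum>a<Suc r. tZ M N m $ Suc a * site_Z M N m $ (Suc r - a))"
    by (simp add: fps_mult_Suc_split tZ_0 site_Z_0)
  then have eq: "tZ M N (Suc m) $ Suc (Suc r) + of_nat (Suc r) * lead_op (Suc m) r =
      (tZ M N m $ Suc (Suc r) + of_nat (Suc r) * lead_op m r) +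
      (site_Z M N m $ Suc (Suc r) + of_nat (Suc r) * lamI M N m (monom 1 r)) +
      (\<Sum>a<Suc r. tZ M N m $ Suc a * site_Z M N m $ (Suc r - a))"
    unfolding lead_op_Suc tZ.simps by (simp only: distrib_left) (simp add: add_ac)
  \<comment> \<open>The coefficients of 1/u vanish in both series, so in a nonzero term both indices
    are at least 2.\<close>
  have mid: "raises n (int r - 1) (tZ M N m $ Suc a * site_Z M N m $ (Suc r - a))" if "a < Suc r" for a
  proof (cases "a = 0 \<or> a = r")
    case True
    then have "tZ M N m $ Suc a * site_Z M N m $ (Suc r - a) = 0"
      by (auto simp: tZ_1 site_Z_1 Suc_diff_le)
    then show ?thesis by (simp only: raises_0)
  next
    case False
    then obtain a' where a': "a = Suc a'" by (cases a) auto
    define b' where "b' = r - Suc a"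
    have b': "Suc r - a = Suc (Suc b')" using False that unfolding b'_def by arith
    have "int a' + int b' \<le> int r - 1" using a' b' that by linarith
    then show ?thesis
      unfolding a' b'[unfolded a'] using raises_mult[OF Z[of a'] site_Z[of b']] by (rule raises_mono[rotated])
  qed
  show ?case
    unfolding eq by (rule raises_add[OF raises_add[OF Suc.IH[OF m(2)] zd] raises_sum]) (simp add: mid)
qed

section \<open>Supercommutation with the representations\<close>

lemma beta_word_supercommutes:
  assumes "\<And>k. k < n \<Longrightarrow> site_supercommutes M {1..M + N} k \<pi> Y" "in_range M N w"
  shows "beta M N n (Poly_Mapping.single w 1) * Y =
    (- 1) ^ (word_parity M w * \<pi>) * (Y * beta M N n (Poly_Mapping.single w 1))"
proof -
  let ?par = "\<lambda>ls. (\<Sum>(i, j, r)\<leftarrow>ls. parity M i + parity M j)"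
  let ?ev = "\<lambda>ls. prod_list (map (\<lambda>(i, j, r). tT M N n i j $ r) ls)"
  have "?ev ls * Y = (- 1) ^ (?par ls * \<pi>) * (Y * ?ev ls)" if "set ls \<subseteq> yangian_letters M N" for ls
    using that
  proof (induction ls)
    case (Cons x ls)
    obtain i j r where x: "x = (i, j, r)" by (cases x)
    have ij: "i \<in> {1..M + N}" "j \<in> {1..M + N}" using Cons.prems by (auto simp: x yangian_letters_def)
    have T: "tT M N n i j $ r * Y = (- 1) ^ ((parity M i + parity M j) * \<pi>) * (Y * tT M N n i j $ r)"
      by (rule tT_supercommutes[OF assms(1) ij])
    have "?ev (x # ls) * Y = tT M N n i j $ r * (?ev ls * Y)" by (simp add: x mult.assoc)
    also have "\<dots> = (- 1) ^ (?par ls * \<pi>) * (tT M N n i j $ r * Y * ?ev ls)"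
      using Cons by (simp add: sign_commute_left[of "tT M N n i j $ r"] mult.assoc)
    also have "\<dots> = (- 1) ^ (?par ls * \<pi> + (parity M i + parity M j) * \<pi>) * (Y * (tT M N n i j $ r * ?ev ls))"
      unfolding T by (simp only: power_add mult.assoc)
    finally show ?case by (simp add: x add.commute algebra_simps)
  qed simp
  moreover have "(- 1 :: state endo) ^ (word_parity M w * \<pi>) = (- 1) ^ (?par (letters w) * \<pi>)"
    unfolding word_parity_def by (rule sign_cong) auto
  ultimately show ?thesis
    using assms(2) by (simp add: beta_def evalf_single evalw_def in_range_def)
qed

lemma beta_supercommutes:
  assumes "\<And>k. k < n \<Longrightarrow> site_supercommutes M {1..M + N} k \<pi> Y" "x \<in> FC M N" "homogeneous M p x"
  shows "beta M N n x * Y = (- 1) ^ (p * \<pi>) * (Y * beta M N n x)"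
proof -
  let ?c = "Poly_Mapping.lookup x"
  have "beta M N n x = (\<Sum>w\<in>Poly_Mapping.keys x. cs (?c w) * beta M N n (Poly_Mapping.single w 1))"
    by (simp add: beta_def evalf_def evalf_single)
  moreover have "cs (?c w) * beta M N n (Poly_Mapping.single w 1) * Y =
      (- 1) ^ (p * \<pi>) * (Y * (cs (?c w) * beta M N n (Poly_Mapping.single w 1)))"
    if "w \<in> Poly_Mapping.keys x" for w
    using beta_word_supercommutes[OF assms(1), of n w] assms(2,3) that
    by (simp add: FC_def homogeneous_def mult.assoc cs_commute_left[of Y] sign_commute_left[of "cs c" for c])
  ultimately show ?thesis by (simp add: sum_distrib_left sum_distrib_right)
qed

lemma beta_commutes:
  assumes "\<And>k. k < n \<Longrightarrow> site_supercommutes M {1..M + N} k 0 Y" "x \<in> FC M N"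
  shows "beta M N n x * Y = Y * beta M N n x"
proof -
  have "beta M N n (hp M p x) * Y = Y * beta M N n (hp M p x)" for p
    using beta_supercommutes[OF assms(1) FC_hp[OF assms(2)] homogeneous_hp, of n p] by simp
  then have "beta M N n (hp M 0 x + hp M 1 x) * Y = Y * beta M N n (hp M 0 x + hp M 1 x)"
    by (simp only: beta_add distrib_left distrib_right)
  then show ?thesis by (simp only: hp_split)
qed

section \<open>The grading operator and parities of vacuum expansions\<close>

lift_definition theta :: "nat \<Rightarrow> state endo" is "\<lambda>n f s. (- 1) ^ spar M s n * f s"
  by (auto simp: algebra_simps)

lemma theta_site_supercommutes:
  assumes "k < n"
  shows "site_supercommutes M I k 1 (theta n)"
proof -
  have "lam M k (i, j, q) * theta n = (- 1) ^ (parity M i + parity M j) * (theta n * lam M k (i, j, q))" for i j q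
  proof (rule endo_eqI, unfold app_sign)
    fix f s
    show "app (lam M k (i, j, q) * theta n) f s = (- 1) ^ (parity M i + parity M j) * app (theta n * lam M k (i, j, q)) f s"
    proof (cases "s k")
      case None
      then show ?thesis by (simp add: times_endo.rep_eq lam_None theta.rep_eq)
    next
      case (Some x)
      obtain a e r where y: "s k = Some (a, e, r)" using Some by (cases x) auto
      note sp = spar_upd_less[OF assms, of M s, unfolded y]
      have 1: "(- 1 :: complex) ^ spar M (s(k := None)) n = (- 1) ^ (parity M i + parity M j) * (- 1) ^ spar M s n"
        if "(a, e, r) = (i, j, q)"
      proof -
        have "spar M (s(k := None)) n + (parity M i + parity M j + spar M s n) = 2 * spar M s n"
          using sp[of None] that by (simp add: opar_def lpar_def)
        then show ?thesis
          unfolding power_add[symmetric] by (intro sign_cong) (metis dvd_triv_left)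
      qed
      have 2: "(- 1 :: complex) ^ spar M (s(k := Some (j, e, r - q))) n = (- 1) ^ (parity M i + parity M j) * (- 1) ^ spar M s n"
        if "a = i"
      proof -
        have "spar M (s(k := Some (j, e, r - q))) n + (parity M i + parity M j + spar M s n) =
            2 * (spar M s n + parity M j)"
          using sp[of "Some (j, e, r - q)"] that by (simp add: opar_def lpar_def)
        then show ?thesis
          unfolding power_add[symmetric] by (intro sign_cong) (metis dvd_triv_left)
      qed
      show ?thesis
        unfolding times_endo.rep_eq theta.rep_eq lam_Some[where s = s and k = k, OF y] using 1 2
        by (auto simp: algebra_simps)
    qed
  qed
  then show ?thesis by (simp add: site_supercommutes_def)
qed

lemma theta_vac: "app (theta n) vac = vac"
proof
  fix s
  have "spar M (\<lambda>_. None) n = 0" by (simp add: spar_def opar_def)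
  then show "app (theta n) vac s = vac s" by (cases "s = (\<lambda>_. None)") (simp_all add: theta.rep_eq vac_def)
qed

text \<open>The grading operator fixes the vacuum, so an operator of parity \<open>p\<close> takes
  the vacuum to states of parity \<open>p\<close>.\<close>

lemma even_operator_vac:
  assumes "X * theta n = (- 1) ^ p * (theta n * X)" "odd (spar M s n + p)"
  shows "app X vac s = 0"
proof -
  have "app X vac s = app (X * theta n) vac s" by (simp add: times_endo.rep_eq theta_vac)
  also have "\<dots> = (- 1) ^ p * ((- 1) ^ spar M s n * app X vac s)"
    unfolding assms(1) app_sign by (simp add: times_endo.rep_eq theta.rep_eq)
  also have "\<dots> = - app X vac s"
    using assms(2) by (cases "even p") auto
  finally show ?thesis by simp
qed

lemma psi_parity:
  assumes "x \<in> FC M N" "homogeneous M p x" "odd (spar M s n + p)"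
  shows "psi M N n x s = 0"
  unfolding psi_def
proof (rule even_operator_vac[OF _ assms(3)])
  show "beta M N n x * theta n = (- 1) ^ p * (theta n * beta M N n x)"
    using beta_supercommutes[OF theta_site_supercommutes assms(1,2), of n] by simp
qed

section \<open>Representatives of the central elements\<close>

lemma series_mult_Yg:
  assumes "\<And>m. f m = cls M N (f' m)" "\<And>m. g m = cls M N (g' m)" "\<And>m. f' m \<in> FC M N" "\<And>m. g' m \<in> FC M N"
  shows "series_mult (yangian M N) f g n = cls M N (\<Sum>m\<le>n. f' m * g' (n - m))"
  unfolding series_mult_def by (rule finsum_Yg') (simp_all add: assms mult_Yg)

lemma beta_series:
  assumes "\<And>m. beta M N l (f m) = F $ m" "\<And>m. beta M N l (g m) = H $ m"
  shows "beta M N l (\<Sum>m\<le>n. f m * g (n - m)) = (F * H) $ n"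
  by (simp add: beta_sum beta_mult assms fps_mult_nth atLeast0AtMost)

lemma beta_cls:
  assumes "x \<in> FC M N" "y \<in> FC M N" "cls M N x = cls M N y"
  shows "beta M N l x = beta M N l y"
  using assms beta_YI[of "x - y" M N l] by (simp add: cls_eq_iff beta_diff)

text \<open>In every tensor power the given series form a right inverse of \<open>tT\<close>, hence
  coincide with the explicit one.\<close>

lemma beta_T':
  assumes inv: "tensor_inverse M N (yangian M N) (yangian_T M N) T'"
    and t: "\<And>i j n. i \<in> {1..M + N} \<Longrightarrow> j \<in> {1..M + N} \<Longrightarrow> T' i j n = cls M N (t i j n) \<and> t i j n \<in> FC M N"
    and ij: "i \<in> {1..M + N}" "j \<in> {1..M + N}"
  shows "beta M N l (t i j n) = tTi M N l i j $ n"
proof -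
  define X where "X i j = Abs_fps (\<lambda>n. beta M N l (t i j n))" for i j
  let ?s = "\<lambda>i k j. (- 1 :: state endo fps) ^ ((parity M i + parity M k) * (parity M k + parity M j))"
  have "(\<Sum>k\<in>{1..M + N}. ?s i k j * (tT M N l i k * X k j)) = (if i = j then 1 else 0)"
    if ij: "i \<in> {1..M + N}" "j \<in> {1..M + N}" for i j
  proof (rule fps_ext)
    fix n
    let ?e = "\<lambda>p k. Poly_Mapping.single 0 ((- 1) ^ (p * (parity M k + parity M j))) *
      (\<Sum>m\<le>n. hp M p (free_T i k (int m)) * t k j (n - m))"
    have inF: "?e p k \<in> FC M N" if "k \<in> {1..M + N}" for p k
      using ij that t by (intro FC_scale FC_sum FC_mult FC_hp FC_free_T) auto
    have "tensor_mult M N (yangian M N) (yangian_T M N) T' i j n = cls M N (\<Sum>k\<in>{1..M + N}. \<Sum>p\<in>{0, 1}. ?e p k)"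
      unfolding tensor_mult_def
    proof (intro finsum_Yg' FC_sum inF)
      fix k p assume k: "k \<in> {1..M + N}"
      have "series_mult (yangian M N) (\<lambda>m. hpart (yangian M N) p (yangian_T M N i k m)) (T' k j) n =
          cls M N (\<Sum>m\<le>n. hp M p (free_T i k (int m)) * t k j (n - m))"
        using ij k t FC_free_T[OF ij(1) k]
        by (intro series_mult_Yg) (auto simp: yangian_T_def cls_def[symmetric] hpart_Yg)
      then show "(- 1) ^ (p * (parity M k + parity M j)) \<odot>\<^bsub>yangian M N\<^esub>
          series_mult (yangian M N) (\<lambda>m. hpart (yangian M N) p (yangian_T M N i k m)) (T' k j) n = cls M N (?e p k)"
        using ij k t by (simp add: smult_Yg FC_sum FC_free_T)
    qed auto
    moreover have "tensor_one (yangian M N) i j n = cls M N (if i = j \<and> n = 0 then 1 else 0)"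
      by (simp add: tensor_one_def one_Yg zero_Yg)
    ultimately have "cls M N (\<Sum>k\<in>{1..M + N}. \<Sum>p\<in>{0, 1}. ?e p k) = cls M N (if i = j \<and> n = 0 then 1 else 0)"
      using inv ij unfolding tensor_inverse_def by metis
    then have "beta M N l (\<Sum>k\<in>{1..M + N}. \<Sum>p\<in>{0, 1}. ?e p k) = beta M N l (if i = j \<and> n = 0 then 1 else 0)"
      using inF by (intro beta_cls FC_sum) auto
    moreover have "beta M N l (\<Sum>p\<in>{0, 1}. ?e p k) = (?s i k j * (tT M N l i k * X k j)) $ n" if k: "k \<in> {1..M + N}" for k
    proof -
      \<comment> \<open>Parity components are indexed by 0 and 1, whereas the sum of the two
        parities can be 2.\<close>
      define \<pi> where "\<pi> = (parity M i + parity M k) mod 2"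
      have \<pi>: "\<pi> \<in> {0, 1}" by (auto simp: \<pi>_def)
      have "?e p k = (if p = \<pi> then Poly_Mapping.single 0 ((- 1) ^ (\<pi> * (parity M k + parity M j))) *
          (\<Sum>m\<le>n. free_T i k (int m) * t k j (n - m)) else 0)" for p
        using hp_homogeneous[OF homogeneous_free_T[of M i k]] by (auto simp: \<pi>_def)
      then have "(\<Sum>p\<in>{0, 1}. ?e p k) = Poly_Mapping.single 0 ((- 1) ^ (\<pi> * (parity M k + parity M j))) *
          (\<Sum>m\<le>n. free_T i k (int m) * t k j (n - m))"
        using \<pi> by auto
      moreover have "beta M N l (\<Sum>m\<le>n. free_T i k (int m) * t k j (n - m)) = (tT M N l i k * X k j) $ n"
        by (rule beta_series) (use ij in \<open>auto simp: X_def beta_free_T\<close>)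
      moreover have "(- 1 :: complex) ^ (\<pi> * (parity M k + parity M j)) =
          (- 1) ^ ((parity M i + parity M k) * (parity M k + parity M j))"
        unfolding \<pi>_def by (rule sign_cong) auto
      ultimately show ?thesis
        by (simp only: beta_scale fps_sign_nth cs_sign)
    qed
    ultimately show "(\<Sum>k\<in>{1..M + N}. ?s i k j * (tT M N l i k * X k j)) $ n = (if i = j then 1 else 0) $ n"
      unfolding beta_sum[of M N l _ "{1..M + N}"] fps_sum_nth by (auto simp: beta_0 beta_1)
  qed
  then have "X i j = tTi M N l i j"
    using ij by (intro right_inverse_unique[of "{1..M + N}" "tT M N l" M X "tTi M N l"]) (simp_all only: tT_tTi tT_0 finite_atLeastAtMost)
  then show ?thesis by (metis X_def fps_nth_Abs_fps)
qed

lemma beta_Z: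
  assumes inv: "tensor_inverse M N (yangian M N) (yangian_T M N) T'"
    and Zid: "Z_identities M N T' Z"
    and z: "\<And>n. Z n = cls M N (z n)" "\<And>n. z n \<in> FC M N"
    and ne: "M \<noteq> 0 \<or> N \<noteq> 0"
  shows "beta M N l (z n) = tZ M N l $ n"
proof -
  have "\<exists>t. \<forall>i\<in>{1..M + N}. \<forall>j\<in>{1..M + N}. \<forall>n. T' i j n = cls M N (t i j n) \<and> t i j n \<in> FC M N"
  proof -
    have "\<exists>x. i \<in> {1..M + N} \<longrightarrow> j \<in> {1..M + N} \<longrightarrow> T' i j n = cls M N x \<and> x \<in> FC M N" for i j n
      using inv unfolding tensor_inverse_def carrier_Yg by blast
    then show ?thesis by metis
  qed
  then obtain t where t: "\<And>i j n. i \<in> {1..M + N} \<Longrightarrow> j \<in> {1..M + N} \<Longrightarrow> T' i j n = cls M N (t i j n) \<and> t i j n \<in> FC M N"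
    by blast
  \<comment> \<open>One diagonal entry determines Z; the entry with index 1 exists because
    \<open>M\<close> and \<open>N\<close> are not both zero.\<close>
  have one: "(1 :: nat) \<in> {1..M + N}" using ne by auto
  let ?c = "of_nat M - of_nat N :: complex"
  define sT where "sT k n = (\<Sum>r\<le>n. Poly_Mapping.single 0 (((- of_nat r) gchoose (n - r)) * ?c ^ (n - r)) * free_T k 1 (int r))" for k n
  have sT: "sT k n \<in> FC M N" if "k \<in> {1..M + N}" for k n
    unfolding sT_def using that one by (intro FC_sum FC_scale FC_free_T) auto
  have ss: "series_shift (yangian M N) ?c (yangian_T M N k 1) n = cls M N (sT k n)" if "k \<in> {1..M + N}" for k n
    unfolding series_shift_def sT_def using that one
    by (intro finsum_Yg' FC_scale FC_free_T) (auto simp: yangian_T_def cls_def[symmetric] smult_Yg FC_free_T)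
  let ?e = "\<lambda>k. \<Sum>m\<le>n. sT k m * t 1 k (n - m)"
  have inF: "?e k \<in> FC M N" if "k \<in> {1..M + N}" for k
    using that t one sT by (intro FC_sum FC_mult) auto
  have a: "(\<Oplus>\<^bsub>yangian M N\<^esub>k\<in>{1..M + N}. series_mult (yangian M N)
             (series_shift (yangian M N) ?c (yangian_T M N k 1)) (T' 1 k) n) = cls M N (\<Sum>k\<in>{1..M + N}. ?e k)"
  proof (intro finsum_Yg' inF)
    fix k assume k: "k \<in> {1..M + N}"
    show "series_mult (yangian M N) (series_shift (yangian M N) ?c (yangian_T M N k 1)) (T' 1 k) n = cls M N (?e k)"
      using k t one sT by (intro series_mult_Yg ss) auto
  qed auto
  have eq: "cls M N (\<Sum>k\<in>{1..M + N}. ?e k) = cls M N (z n)"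
    using Zid[unfolded Z_identities_def, rule_format, OF one one, of n] unfolding a z(1)
    by (simp only: if_True refl)
  have b1: "beta M N l (\<Sum>k\<in>{1..M + N}. ?e k) = beta M N l (z n)"
    by (rule beta_cls[OF FC_sum[OF inF] z(2) eq])
  have b2: "beta M N l (?e k) = (shift (kap M N) (tT M N l k 1) * tTi M N l 1 k) $ n" if k: "k \<in> {1..M + N}" for k
  proof (rule beta_series)
    show "beta M N l (t 1 k m) = tTi M N l 1 k $ m" for m
      by (rule beta_T'[OF inv t one k])
    show "beta M N l (sT k m) = shift (kap M N) (tT M N l k 1) $ m" for m
      unfolding sT_def beta_sum beta_scale shift_def fps_nth_Abs_fps
      by (intro sum.cong refl) (use k in \<open>auto simp: beta_free_T shift_fps_nth kap_def\<close>)
  qed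
  have "beta M N l (z n) = (\<Sum>k\<in>{1..M + N}. shift (kap M N) (tT M N l k 1) * tTi M N l 1 k) $ n"
    unfolding b1[symmetric] beta_sum[of M N l _ "{1..M + N}"] fps_sum_nth by (intro sum.cong refl b2)
  also have "\<dots> = tZ M N l $ n"
    unfolding shift_tT_tTi[OF one one] by simp
  finally show ?thesis .
qed

end

section \<open>Leading terms of the central elements\<close>

lemma beta_of_nat: "beta M N n (of_nat r) = of_nat r"
  by (induction r) (simp_all add: beta_add beta_0 beta_1)

text \<open>Coefficients are indexed by lists of indices, since the factors do not commute in the
  free algebra. The bound \<open>D\<close> keeps the sums finite.\<close>

primrec ordered_poly :: "(nat \<Rightarrow> free_elem) \<Rightarrow> nat \<Rightarrow> nat \<Rightarrow> (nat list \<Rightarrow> complex) \<Rightarrow> free_elem" where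
  "ordered_poly A D 0 F = Poly_Mapping.single 0 (F [])"
| "ordered_poly A D (Suc P) F = (\<Sum>q\<le>D. A q * ordered_poly A D P (\<lambda>qs. F (q # qs)))"

lemma ordered_poly_zero [simp]: "ordered_poly A D P (\<lambda>qs. 0) = 0"
  by (induction P) simp_all

lemma ordered_poly_single:
  "set qs \<subseteq> {..D} \<Longrightarrow> ordered_poly A D (length qs) (\<lambda>qs'. if qs' = qs then 1 else 0) = prod_list (map A qs)"
proof (induction qs)
  case (Cons q qs)
  have "ordered_poly A D (length qs) (\<lambda>qs'. if q' # qs' = q # qs then 1 else 0) =
      (if q' = q then prod_list (map A qs) else 0)" for q'
    using Cons by (cases "q' = q") simp_all
  then have "ordered_poly A D (length (q # qs)) (\<lambda>qs'. if qs' = q # qs then 1 else 0) =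
      (\<Sum>q'\<le>D. if q' = q then A q * prod_list (map A qs) else 0)"
    unfolding length_Cons ordered_poly.simps by (intro sum.cong refl) auto
  then show ?case using Cons.prems by simp
qed simp

text \<open>The coefficients that arise when an ordered polynomial in supertraces is expanded into
  words; symbols of central elements will be recognized in this form.\<close>

fun diagonal_symbol :: "nat \<Rightarrow> (nat list \<Rightarrow> complex) \<Rightarrow> letter list \<Rightarrow> complex" where
  "diagonal_symbol M F [] = F []"
| "diagonal_symbol M F ((a, b, q) # v) = (if a = b then (- 1) ^ parity M a * diagonal_symbol M (\<lambda>qs. F (q # qs)) v else 0)"

lemma diagonal_symbol_scale: "diagonal_symbol M (\<lambda>qs. c * F qs) v = c * diagonal_symbol M F v"
  by (induction M F v rule: diagonal_symbol.induct) simp_all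

lemma diagonal_symbol_nonzero: "diagonal_symbol M F v \<noteq> 0 \<Longrightarrow> F (map lq v) \<noteq> 0"
  by (induction M F v rule: diagonal_symbol.induct) (auto simp: lq_def split: if_splits)

lemma diagonal_symbol_const: "diagonal_symbol M F (map (\<lambda>q. (c, c, q)) qs) = (- 1) ^ (parity M c * length qs) * F qs"
  by (induction qs arbitrary: F) (simp_all add: power_add)

context
  fixes M N :: nat
begin

definition lead :: "nat \<Rightarrow> free_elem" where
  "lead r = (\<Sum>c\<in>{1..M + N}. (- 1) ^ parity M c * tw [(c, c, r)])"

lemma lead_G: "lead q \<in> G M N q 2"
  unfolding lead_def by (intro G_sum G_sign tw_G) (auto simp: qletters_def lq_def)

lemma ordered_poly_G:
  assumes "\<And>q. A q \<in> G M N q 2" "\<And>qs. F qs \<noteq> 0 \<Longrightarrow> sum_list qs = d"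
  shows "ordered_poly A D P F \<in> G M N d (Suc P)"
  using assms(2)
proof (induction P arbitrary: F d)
  case 0
  show ?case
  proof (cases "F [] = 0")
    case False
    then have "d = 0" using "0.prems"[of "[]"] by simp
    have "Poly_Mapping.single 0 (F []) * tw [] \<in> G M N 0 (Suc 0)"
      by (intro G_scale tw_G) auto
    then show ?thesis by (simp add: \<open>d = 0\<close>)
  qed simp
next
  case (Suc P)
  show ?case unfolding ordered_poly.simps
  proof (rule G_sum)
    fix q
    show "A q * ordered_poly A D P (\<lambda>qs. F (q # qs)) \<in> G M N d (Suc (Suc P))"
    proof (cases "q \<le> d")
      case True
      have "ordered_poly A D P (\<lambda>qs. F (q # qs)) \<in> G M N (d - q) (Suc P)"
        using Suc.prems by (intro Suc.IH) force
      from G_mult_left[OF assms(1)[of q, unfolded numeral_2_eq_2] this]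
      show ?thesis using True by simp
    next
      case False
      then have "(\<lambda>qs. F (q # qs)) = (\<lambda>qs. 0)"
        using Suc.prems[of "q # qs" for qs] by fastforce
      then show ?thesis by simp
    qed
  qed
qed

text \<open>Factors are replaced one at a time, and each replacement costs a term of smaller
  degree.\<close>

lemma ordered_poly_diff:
  assumes A: "\<And>q. A q \<in> G M N q 2" and B: "\<And>q. B q \<in> G M N q 2" and AB: "\<And>q. A q - B q \<in> G M N q 0"
    and "\<And>qs. F qs \<noteq> 0 \<Longrightarrow> sum_list qs = d"
  shows "ordered_poly A D P F - ordered_poly B D P F \<in> G M N d P"
  using assms(4)
proof (induction P arbitrary: F d)
  case 0
  then show ?case by simp
next
  case (Suc P)
  have "A q * ordered_poly A D P (\<lambda>qs. F (q # qs)) - B q * ordered_poly B D P (\<lambda>qs. F (q # qs)) \<in> G M N d (Suc P)" for q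
  proof (cases "q \<le> d")
    case True
    have supp: "sum_list qs = d - q" if "F (q # qs) \<noteq> 0" for qs
      using Suc.prems[OF that] by simp
    have 1: "(A q - B q) * ordered_poly A D P (\<lambda>qs. F (q # qs)) \<in> G M N (q + (d - q)) (0 + P)"
      by (rule G_mult_right[OF AB ordered_poly_G[OF A supp]])
    have 2: "B q * (ordered_poly A D P (\<lambda>qs. F (q # qs)) - ordered_poly B D P (\<lambda>qs. F (q # qs))) \<in> G M N (q + (d - q)) (1 + P)"
      by (rule G_mult_left[OF B[of q, unfolded numeral_2_eq_2 One_nat_def[symmetric]] Suc.IH[OF supp]])
    have eq: "A q * ordered_poly A D P (\<lambda>qs. F (q # qs)) - B q * ordered_poly B D P (\<lambda>qs. F (q # qs)) =
        (A q - B q) * ordered_poly A D P (\<lambda>qs. F (q # qs)) +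
        B q * (ordered_poly A D P (\<lambda>qs. F (q # qs)) - ordered_poly B D P (\<lambda>qs. F (q # qs)))"
      by (simp add: algebra_simps)
    show ?thesis
      unfolding eq using True by (intro G_add G_mono[OF 1] G_mono[OF 2]) auto
  next
    case False
    then have "(\<lambda>qs. F (q # qs)) = (\<lambda>qs. 0)"
      using Suc.prems[of "q # qs" for qs] by fastforce
    then show ?thesis by simp
  qed
  then show ?case
    unfolding ordered_poly.simps sum_subtractf[symmetric] by (intro G_sum)
qed

text \<open>All matrix indices are present in each degree, so the sums that define the supertraces
  are complete within this alphabet.\<close>

definition box :: "nat \<Rightarrow> letter set" where
  "box D = {1..M + N} \<times> {1..M + N} \<times> {..D}"

lemma finite_box: "finite (box D)" and box_qletters: "box D \<subseteq> qletters M N"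
  by (auto simp: box_def qletters_def)

lemma box_sum: "(\<Sum>y\<in>box D. f y) = (\<Sum>a\<in>{1..M + N}. \<Sum>b\<in>{1..M + N}. \<Sum>q\<le>D. f (a, b, q))"
  by (simp add: box_def sum.cartesian_product split_def)

lemma wsum_diagonal_symbol: "wsum (box D) P (diagonal_symbol M F) = ordered_poly lead D P F"
proof (induction P arbitrary: F)
  case 0
  then show ?case by (simp add: wsum_0)
next
  case (Suc P)
  have "wsum (box D) (Suc P) (diagonal_symbol M F) =
      (\<Sum>a\<in>{1..M + N}. \<Sum>b\<in>{1..M + N}. \<Sum>q\<le>D. tw [(a, b, q)] * wsum (box D) P (\<lambda>v. diagonal_symbol M F ((a, b, q) # v)))"
    unfolding wsum_Suc box_sum ..
  also have "\<dots> = (\<Sum>a\<in>{1..M + N}. \<Sum>q\<le>D. (- 1) ^ parity M a * tw [(a, a, q)] * ordered_poly lead D P (\<lambda>qs. F (q # qs)))"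
  proof (rule sum.cong[OF refl])
    fix a assume a: "a \<in> {1..M + N}"
    have "(\<Sum>q\<le>D. tw [(a, b, q)] * wsum (box D) P (\<lambda>v. diagonal_symbol M F ((a, b, q) # v))) =
        (if b = a then \<Sum>q\<le>D. (- 1) ^ parity M a * tw [(a, a, q)] * ordered_poly lead D P (\<lambda>qs. F (q # qs)) else 0)" for b
      by (auto simp: wsum_scale single_0_sign Suc.IH mult.assoc sign_commute_left[of "tw v" for v] intro!: sum.cong)
    then show "(\<Sum>b\<in>{1..M + N}. \<Sum>q\<le>D. tw [(a, b, q)] * wsum (box D) P (\<lambda>v. diagonal_symbol M F ((a, b, q) # v))) =
        (\<Sum>q\<le>D. (- 1) ^ parity M a * tw [(a, a, q)] * ordered_poly lead D P (\<lambda>qs. F (q # qs)))"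
      using a by simp
  qed
  also have "\<dots> = ordered_poly lead D (Suc P) F"
    unfolding ordered_poly.simps lead_def sum_distrib_right by (rule sum.swap)
  finally show ?case .
qed

lemma G_hp: "x \<in> G M N d p \<Longrightarrow> hp M e x \<in> G M N d p"
proof -
  assume x: "x \<in> G M N d p"
  then obtain y where y: "y \<in> FC M N" "x - y \<in> yangian_ideal M N" "\<forall>w\<in>Poly_Mapping.keys y. low d p w"
    unfolding G_def by blast
  show ?thesis
  proof (rule G_I[of "hp M e y"])
    show "hp M e x - hp M e y \<in> yangian_ideal M N" unfolding hp_diff[symmetric] by (rule YI_hp[OF y(2)])
    show "low d p w" if "w \<in> Poly_Mapping.keys (hp M e y)" for w
      using that keys_hp[of M e y] y(3) by blast
  qed (use y G_FC[OF x] in auto)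
qed

lemma raises_G:
  assumes "x \<in> G M N d p"
  shows "raises n (int d) (beta M N n x)"
proof -
  obtain y where y: "y \<in> FC M N" "x - y \<in> yangian_ideal M N" "\<forall>w\<in>Poly_Mapping.keys y. low d p w"
    using assms unfolding G_def by blast
  obtain W c where W: "finite W" "\<And>w. w \<in> W \<Longrightarrow> set w \<subseteq> qletters M N \<and> gword w \<in> Poly_Mapping.keys y"
    "y = (\<Sum>w\<in>W. Poly_Mapping.single 0 (c w) * tw w)"
    using free_elem_tw_sum[OF y(1)] by metis
  have "raises n (int d) (beta M N n (tw w))" if w: "w \<in> W" for w
  proof -
    have "low d p (gword w)" using W(2)[OF w] y(3) by blast
    then have "int (qdeg w) \<le> int d" by (auto simp: low_gword)
    moreover have "raises n (int (qdeg w)) (beta M N n (tw w))" using raises_tw W(2)[OF w] by blast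
    ultimately show ?thesis by (rule raises_mono[rotated])
  qed
  then have "raises n (int d) (beta M N n y)"
    unfolding W(3) beta_sum beta_scale by (intro raises_sum raises_cs)
  moreover have "beta M N n x = beta M N n y" using beta_YI[OF y(2)] by (simp add: beta_diff)
  ultimately show ?thesis by simp
qed

section \<open>Symbols of central elements\<close>

definition free_supercomm :: "free_elem \<Rightarrow> free_elem \<Rightarrow> free_elem" where
  "free_supercomm x y = (\<Sum>p\<in>{0, 1}. \<Sum>p'\<in>{0, 1}. hp M p x * hp M p' y - (- 1) ^ (p * p') * (hp M p' y * hp M p x))"

lemma free_supercomm_FC: "x \<in> FC M N \<Longrightarrow> y \<in> FC M N \<Longrightarrow> free_supercomm x y \<in> FC M N"
  unfolding free_supercomm_def by (intro FC_sum FC_diff FC_sign FC_mult FC_hp)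

lemma free_supercomm_diff: "free_supercomm (x - x') y = free_supercomm x y - free_supercomm x' y"
  unfolding free_supercomm_def by (simp add: hp_diff algebra_simps)

lemma supercentre_Yg:
  assumes "x \<in> FC M N"
  shows "cls M N x \<in> supercentre (yangian M N) \<longleftrightarrow> (\<forall>y\<in>FC M N. free_supercomm x y \<in> yangian_ideal M N)"
proof -
  have "supercomm (yangian M N) (cls M N x) (cls M N y) = \<zero>\<^bsub>yangian M N\<^esub> \<longleftrightarrow> free_supercomm x y \<in> yangian_ideal M N"
    if "y \<in> FC M N" for y
    unfolding supercomm_Yg[OF assms that] zero_Yg free_supercomm_def[symmetric]
    using free_supercomm_FC[OF assms that] by (simp add: cls_eq_iff)
  then show ?thesis
    using assms unfolding supercentre_def carrier_Yg by auto
qed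

text \<open>From the adjoined unit both multiplications create the same letter; their other terms
  take a letter at site \<open>k\<close> as source, where the vacuum vanishes.\<close>

lemma lam_rho_vac: "app (rho M k x) vac = app (lam M k x) vac"
proof
  fix s
  obtain i j q where x: "x = (i, j, q)" by (cases x)
  have no: "vac (s(k := Some b)) = 0" for b
    using fun_cong[of "s(k := Some b)" "\<lambda>_. None" k] by (auto simp: vac_def)
  show "app (rho M k x) vac s = app (lam M k x) vac s"
  proof (cases "s k")
    case None
    then show ?thesis by (simp add: lam_None rho_None)
  next
    case (Some y)
    obtain a e r where y: "s k = Some (a, e, r)" using Some by (cases y) auto
    show ?thesis
      unfolding x lam_Some[where s = s and k = k, OF y] rho_Some[where s = s and k = k, OF y] by (simp add: no)
  qed
qed

lemma rho_site_supercommutes: "site_supercommutes M I k (lpar M y) (rho M l y)"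
  unfolding site_supercommutes_def using lam_rho_commute[of M k _ l y] by (auto simp: lpar_def)

text \<open>Multiplying a central element by \<open>y\<close> on the right and applying it to the vacuum is, up to lower
  terms, the same as right multiplication; centrality identifies it with left multiplication.\<close>

lemma central_ad:
  assumes x: "x \<in> G M N d (Suc p)" and y: "(k, l, t) \<in> qletters M N"
    and cent: "free_supercomm x (tw [(k, l, t)]) \<in> yangian_ideal M N" and u: "sdeg P u = d + t"
  shows "(\<Sum>e\<in>{0, 1}. (- 1) ^ (e * (parity M k + parity M l)) *
     (app (\<Sum>n<P. rho M n (k, l, t)) (psi M N P (hp M e x)) u -
      app (Dop M P (k, l, t)) (psi M N P (hp M e x)) u)) = 0"
proof -
  let ?y = "(k, l, t)" and ?\<pi> = "parity M k + parity M l"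
  let ?T = "beta M N P (tw [?y])" and ?D = "Dop M P ?y" and ?R = "\<Sum>n<P. rho M n ?y"
  let ?X = "\<lambda>e. beta M N P (hp M e x)"
  have xF: "x \<in> FC M N" by (rule G_FC[OF x])
  have yF: "tw [?y] \<in> FC M N" using y by (intro tw_FC) simp
  have TD: "raises P (int t - 1) (?T - ?D)"
    using raises_tw[of "[?y]" M N P] y by (simp add: Dword_def lq_def)
  have X: "raises P (int d) (?X e)" for e by (rule raises_G[OF G_hp[OF x]])
  \<comment> \<open>Degree \<open>d + t\<close> is out of reach if the generator is replaced by its
    error term, which has degree at most \<open>t - 1\<close>.\<close>
  have z1: "app (?X e * (?T - ?D)) vac u = 0" and z2: "app ((?T - ?D) * ?X e) vac u = 0" for e
  proof -
    have "bounded P (0 + (int d + (int t - 1))) (app (?X e * (?T - ?D)) vac)"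
      by (rule raisesD[OF raises_mult[OF X TD] bounded_vac])
    then show "app (?X e * (?T - ?D)) vac u = 0" using u unfolding bounded_def by force
    have "bounded P (0 + ((int t - 1) + int d)) (app ((?T - ?D) * ?X e) vac)"
      by (rule raisesD[OF raises_mult[OF TD X] bounded_vac])
    then show "app ((?T - ?D) * ?X e) vac u = 0" using u unfolding bounded_def by force
  qed
  have DR: "app ?D vac = app ?R vac"
    by (rule ext) (simp add: Dop_def app_sum lam_rho_vac)
  have XR: "?X e * ?R = (- 1) ^ (e * ?\<pi>) * (?R * ?X e)" for e
  proof -
    have "?X e * rho M n ?y = (- 1) ^ (e * lpar M ?y) * (rho M n ?y * ?X e)" for n
      by (rule beta_supercommutes[OF rho_site_supercommutes FC_hp[OF xF] homogeneous_hp])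
    then show ?thesis by (simp add: sum_distrib_left sum_distrib_right lpar_def)
  qed
  have XT: "app (?X e * ?T) vac u = (- 1) ^ (e * ?\<pi>) * app ?R (psi M N P (hp M e x)) u" for e
  proof -
    have "app (?X e * ?T) vac u = app (?X e * (?T - ?D)) vac u + app (?X e) (app ?D vac) u"
      by (simp add: right_diff_distrib app_simps)
    also have "\<dots> = app (?X e * ?R) vac u"
      unfolding z1 DR by (simp add: times_endo.rep_eq)
    also have "\<dots> = (- 1) ^ (e * ?\<pi>) * app ?R (psi M N P (hp M e x)) u"
      unfolding XR app_sign by (simp add: times_endo.rep_eq psi_def)
    finally show ?thesis .
  qed
  have TX: "app (?T * ?X e) vac u = app ?D (psi M N P (hp M e x)) u" for e
  proof -
    have "app (?T * ?X e) vac u = app ((?T - ?D) * ?X e) vac u + app (?D * ?X e) vac u"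
      by (simp add: left_diff_distrib app_simps)
    then show ?thesis unfolding z2 by (simp add: times_endo.rep_eq psi_def)
  qed
  have hy: "hp M p' (tw [?y]) = (if p' = ?\<pi> mod 2 then tw [?y] else 0)" for p'
    unfolding free_T_Suc[symmetric] by (rule hp_homogeneous[OF homogeneous_free_T])
  have sg: "(- 1 :: free_elem) ^ (e * (?\<pi> mod 2)) = (- 1) ^ (e * ?\<pi>)" for e
    by (rule sign_cong) auto
  have sc: "free_supercomm x (tw [?y]) = (\<Sum>e\<in>{0, 1}. hp M e x * tw [?y] - (- 1) ^ (e * ?\<pi>) * (tw [?y] * hp M e x))"
    unfolding free_supercomm_def
  proof (rule sum.cong[OF refl])
    fix e
    have "(\<Sum>p'\<in>{0, 1}. hp M e x * hp M p' (tw [?y]) - (- 1) ^ (e * p') * (hp M p' (tw [?y]) * hp M e x)) =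
      (\<Sum>p'\<in>{0, 1}. if p' = ?\<pi> mod 2 then hp M e x * tw [?y] - (- 1) ^ (e * (?\<pi> mod 2)) * (tw [?y] * hp M e x) else 0)"
      unfolding hy by (intro sum.cong refl) auto
    also have "\<dots> = hp M e x * tw [?y] - (- 1) ^ (e * (?\<pi> mod 2)) * (tw [?y] * hp M e x)"
      by (subst sum.delta) auto
    finally show "(\<Sum>p'\<in>{0, 1}. hp M e x * hp M p' (tw [?y]) - (- 1) ^ (e * p') * (hp M p' (tw [?y]) * hp M e x)) =
      hp M e x * tw [?y] - (- 1) ^ (e * ?\<pi>) * (tw [?y] * hp M e x)" unfolding sg .
  qed
  have "0 = psi M N P (free_supercomm x (tw [?y])) u" using psi_YI[OF cent] by simp
  also have "\<dots> = (\<Sum>e\<in>{0, 1}. app (?X e * ?T) vac u - (- 1) ^ (e * ?\<pi>) * app (?T * ?X e) vac u)"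
    unfolding sc psi_sum psi_diff
    by (intro sum.cong refl) (simp only: psi_def beta_mult beta_sign app_sign)
  finally show ?thesis
    unfolding XT TX by (simp only: right_diff_distrib)
qed

lemma site_op_zero: "(\<And>b. f (s(k := b)) = 0) \<Longrightarrow> app (site_op M k \<pi> x c \<sigma>) f s = 0"
  by (simp add: site_op.rep_eq)

lemma state_of_upd: "(state_of (v1 @ x # v2))(length v1 := Some y) = state_of (v1 @ y # v2)"
  by (rule ext) (auto simp: state_of_def nth_append nth_Cons split: nat.splits)

text \<open>One position receives an extra degree larger than \<open>d\<close>. In top degree only a
  multiplication at this position can remove it, so \<open>central_ad\<close> compares left and
  right multiplication there, with all other letters fixed.\<close>

lemma central_switch:
  assumes x: "x \<in> G M N d (Suc p)" and cent: "\<And>y. y \<in> FC M N \<Longrightarrow> free_supercomm x y \<in> yangian_ideal M N"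
    and idx: "{a, b, k, l} \<subseteq> {1..M + N}" and deg: "qdeg (v1 @ (a, b, q) # v2) = d"
  defines "P \<equiv> Suc (length v1 + length v2)"
  defines "f \<equiv> \<lambda>e w. psi M N P (hp M e x) (state_of w)"
  shows "(\<Sum>e\<in>{0, 1}. (- 1) ^ (e * (parity M k + parity M l)) *
     ((if b = l then (- 1) ^ ((parity M k + parity M l) * (parity M a + parity M k) + parity M a * parity M k +
         parity M a * parity M l + parity M k * parity M l) * f e (v1 @ (a, k, q) # v2) else 0) -
      (if a = k then (- 1) ^ (parity M k * parity M l + parity M k * parity M b + parity M l * parity M b) *
         f e (v1 @ (l, b, q) # v2) else 0))) = 0"
proof -
  define t where "t = Suc d"
  define u where "u = state_of (v1 @ (a, b, q + t) # v2)"
  let ?n = "length v1"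
  have len: "length (v1 @ (a, b, q + t) # v2) = P" by (simp add: P_def)
  have u: "sdeg P u = d + t"
    using sdeg_state_of[of "v1 @ (a, b, q + t) # v2"] deg unfolding u_def len by (simp add: qdeg_def lq_def)
  have un: "u ?n = Some (a, b, q + t)" "?n < P" by (simp_all add: u_def state_of_def P_def)
  have upd: "u(?n := Some c) = state_of (v1 @ c # v2)" for c
    unfolding u_def by (rule state_of_upd)
  have y: "(k, l, t) \<in> qletters M N" using idx by (simp add: qletters_def)
  have bd: "psi M N P (hp M e x) s = 0" if "d < sdeg P s" for e s
    by (rule psi_G[OF G_hp[OF x]]) (use that in blast)
  \<comment> \<open>If another site is changed, the letter of degree \<open>q + t\<close> remains
    and alone exceeds \<open>d\<close>.\<close>
  have other: "psi M N P (hp M e x) (u(n := c)) = 0" if "n \<noteq> ?n" for e n c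
  proof (rule bd)
    have "oq ((u(n := c)) ?n) \<le> sdeg P (u(n := c))"
      unfolding sdeg_def by (rule member_le_sum) (use un in auto)
    then show "d < sdeg P (u(n := c))" using that un by (simp add: lq_def t_def)
  qed
  let ?S = "(- 1 :: complex) ^ ((parity M k + parity M l) * spar M u ?n)"
  have R: "app (\<Sum>n<P. rho M n (k, l, t)) (psi M N P (hp M e x)) u - app (Dop M P (k, l, t)) (psi M N P (hp M e x)) u =
     ?S * ((if b = l then (- 1) ^ ((parity M k + parity M l) * (parity M a + parity M k) + parity M a * parity M k +
         parity M a * parity M l + parity M k * parity M l) * f e (v1 @ (a, k, q) # v2) else 0) -
      (if a = k then (- 1) ^ (parity M k * parity M l + parity M k * parity M b + parity M l * parity M b) *
         f e (v1 @ (l, b, q) # v2) else 0))" for e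
  proof -
    have "app (\<Sum>n<P. rho M n (k, l, t)) (psi M N P (hp M e x)) u =
        (\<Sum>n<P. if n = ?n then app (rho M ?n (k, l, t)) (psi M N P (hp M e x)) u else 0)"
      unfolding app_sum by (intro sum.cong refl) (auto simp: rho_def intro!: site_op_zero other)
    then have 1: "app (\<Sum>n<P. rho M n (k, l, t)) (psi M N P (hp M e x)) u = app (rho M ?n (k, l, t)) (psi M N P (hp M e x)) u"
      using un(2) by simp
    have "app (Dop M P (k, l, t)) (psi M N P (hp M e x)) u =
        (\<Sum>n<P. if n = ?n then app (lam M ?n (k, l, t)) (psi M N P (hp M e x)) u else 0)"
      unfolding Dop_def app_sum by (intro sum.cong refl) (auto simp: lam_def intro!: site_op_zero other)
    then have 2: "app (Dop M P (k, l, t)) (psi M N P (hp M e x)) u = app (lam M ?n (k, l, t)) (psi M N P (hp M e x)) u"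
      using un(2) by simp
    have i: "q + t - t = q" "(t \<le> q + t) = True" by simp_all
    show ?thesis
      unfolding 1 2 lam_Some[where s = u and k = "?n", OF un(1)] rho_Some[where s = u and k = "?n", OF un(1)] upd f_def i
      by (simp only: simp_thms right_diff_distrib[symmetric] add_diff_cancel_left)
  qed
  have "(\<Sum>e\<in>{0, 1}. (- 1) ^ (e * (parity M k + parity M l)) * (?S *
     ((if b = l then (- 1) ^ ((parity M k + parity M l) * (parity M a + parity M k) + parity M a * parity M k +
         parity M a * parity M l + parity M k * parity M l) * f e (v1 @ (a, k, q) # v2) else 0) -
      (if a = k then (- 1) ^ (parity M k * parity M l + parity M k * parity M b + parity M l * parity M b) *
         f e (v1 @ (l, b, q) # v2) else 0)))) = 0"
    using central_ad[OF x y cent u] tw_FC[of "[(k, l, t)]" M N] y unfolding R by simp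
  then have "?S * (\<Sum>e\<in>{0, 1}. (- 1) ^ (e * (parity M k + parity M l)) *
     ((if b = l then (- 1) ^ ((parity M k + parity M l) * (parity M a + parity M k) + parity M a * parity M k +
         parity M a * parity M l + parity M k * parity M l) * f e (v1 @ (a, k, q) # v2) else 0) -
      (if a = k then (- 1) ^ (parity M k * parity M l + parity M k * parity M b + parity M l * parity M b) *
         f e (v1 @ (l, b, q) # v2) else 0))) = 0"
    unfolding sum_distrib_left by (simp only: mult.left_commute[of ?S])
  then show ?thesis by simp
qed

lemma psi_hp:
  assumes "x \<in> FC M N" "e \<in> {0, 1}"
  shows "psi M N n (hp M e x) s = (if even (spar M s n + e) then psi M N n x s else 0)"
proof -
  have odd: "psi M N n (hp M e x) s = 0" if "odd (spar M s n + e)" for e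
    by (rule psi_parity[OF FC_hp[OF assms(1)] homogeneous_hp that])
  have "psi M N n x s = psi M N n (hp M 0 x) s + psi M N n (hp M 1 x) s"
    unfolding psi_add[symmetric] hp_split ..
  then show ?thesis
    using assms(2) odd[of 0] odd[of 1] by (cases "even (spar M s n)") auto
qed

lemma spar_state_of: "spar M (state_of v) (length v) = sum_list (map (lpar M) v)"
  unfolding spar_reading by (simp add: reading_state_of)

lemma even_add_iff_mod_2: "(e :: nat) < 2 \<Longrightarrow> even (n + e) \<longleftrightarrow> e = n mod 2"
  by presburger

text \<open>A matrix that commutes with all matrix units is scalar: here this is applied to a single
  letter of a word. In the signed basis of letters the diagonal entries of a scalar matrix differ by
  the signs of the supertrace.\<close>

lemma central_symbol:
  assumes x: "x \<in> G M N d (Suc P)" and cent: "\<And>y. y \<in> FC M N \<Longrightarrow> free_supercomm x y \<in> yangian_ideal M N"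
    and idx: "a \<in> {1..M + N}" "c \<in> {1..M + N}"
  shows "a \<noteq> c \<Longrightarrow> symbol M N d P x (v1 @ (a, c, q) # v2) = 0"
    and "(- 1) ^ parity M a * symbol M N d P x (v1 @ (a, a, q) # v2) =
         (- 1) ^ parity M c * symbol M N d P x (v1 @ (c, c, q) # v2)"
proof -
  have xF: "x \<in> FC M N" by (rule G_FC[OF x])
  have deg: "qdeg (v1 @ (a, b, q) # v2) = d \<longleftrightarrow> qdeg (v1 @ (a, c, q) # v2) = d" for a b
    by (simp add: qdeg_def lq_def)
  have deg2: "qdeg (v1 @ (a, b, q) # v2) = qdeg (v1 @ (a', b', q) # v2)" for a b a' b'
    by (simp add: qdeg_def lq_def)
  have sp: "spar M (state_of (v1 @ (a, b, q) # v2)) (Suc (length v1 + length v2)) =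
      sum_list (map (lpar M) v1) + (parity M a + parity M b) + sum_list (map (lpar M) v2)" for a b
    using spar_state_of[of "v1 @ (a, b, q) # v2"] by (simp add: lpar_def)
  let ?P = "Suc (length v1 + length v2)"
  let ?f = "\<lambda>w. psi M N ?P x (state_of w)"
  {
    assume ac: "a \<noteq> c"
    show "symbol M N d P x (v1 @ (a, c, q) # v2) = 0"
    proof (cases "qdeg (v1 @ (a, c, q) # v2) = d \<and> P = ?P")
      case True
      \<comment> \<open>The tested matrix unit is cc: on the right it preserves the letter ac, on
        the left it annihilates it.\<close>
      have "(\<Sum>e\<in>{0, 1}. psi M N ?P (hp M e x) (state_of (v1 @ (a, c, q) # v2))) = 0"
        using central_switch[OF x cent, of a c c c v1 q v2] idx ac True
        by (cases rule: parity_eq_cases[of M a]; cases rule: parity_eq_cases[of M c]) (auto simp: neg_eq_iff_add_eq_0 add.commute)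
      then have "?f (v1 @ (a, c, q) # v2) = 0"
        using hp_split[of M x] psi_add[of M N ?P "hp M 0 x" "hp M 1 x"] by simp
      then show ?thesis using True by (simp add: symbol_def)
    qed (auto simp: symbol_def)
  }
  show "(- 1) ^ parity M a * symbol M N d P x (v1 @ (a, a, q) # v2) =
         (- 1) ^ parity M c * symbol M N d P x (v1 @ (c, c, q) # v2)"
  proof (cases "qdeg (v1 @ (a, c, q) # v2) = d \<and> P = ?P")
    case True
    \<comment> \<open>The parity of the state selects one parity component of \<open>x\<close>, and
      it is the same for all diagonal letters at this position.\<close>
    define \<epsilon> where "\<epsilon> = spar M (state_of (v1 @ (a, a, q) # v2)) ?P mod 2"
    have ev: "even (spar M (state_of (v1 @ (b, b, q) # v2)) ?P + e) \<longleftrightarrow> e = \<epsilon>" if "e \<in> {0, 1}" for e b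
    proof -
      have "even (spar M (state_of (v1 @ (b, b, q) # v2)) ?P + e) \<longleftrightarrow>
          even (spar M (state_of (v1 @ (a, a, q) # v2)) ?P + e)" by (simp add: sp)
      also have "\<dots> \<longleftrightarrow> e = \<epsilon>" 
        unfolding \<epsilon>_def by (rule even_add_iff_mod_2) (use that in auto)
      finally show ?thesis .
    qed
    have g: "psi M N ?P (hp M e x) (state_of (v1 @ (b, b, q) # v2)) = (if e = \<epsilon> then ?f (v1 @ (b, b, q) # v2) else 0)"
      if "e \<in> {0, 1}" for e b
      using psi_hp[OF xF that] ev[OF that] by simp
    have s1: "(- 1 :: complex) ^ ((parity M a + parity M c) * (parity M a + parity M a) + parity M a * parity M a +
         parity M a * parity M c + parity M a * parity M c) = (- 1) ^ parity M a"
      by (cases rule: parity_eq_cases[of M a]; cases rule: parity_eq_cases[of M c]) auto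
    have s2: "(- 1 :: complex) ^ (parity M a * parity M c + parity M a * parity M c + parity M c * parity M c) = (- 1) ^ parity M c"
      by (cases rule: parity_eq_cases[of M a]; cases rule: parity_eq_cases[of M c]) auto
    \<comment> \<open>The letter ac is reached from aa by right multiplication with ac, and from cc
      by left multiplication.\<close>
    have "(\<Sum>e\<in>{0, 1}. (- 1) ^ (e * (parity M a + parity M c)) *
       ((- 1) ^ parity M a * psi M N ?P (hp M e x) (state_of (v1 @ (a, a, q) # v2)) -
        (- 1) ^ parity M c * psi M N ?P (hp M e x) (state_of (v1 @ (c, c, q) # v2)))) = 0"
      using central_switch[OF x cent, of a c a c v1 q v2] idx True
      unfolding s1 s2 by (simp only: if_True simp_thms) simp
    moreover have "\<epsilon> = 0 \<or> \<epsilon> = 1" by (auto simp: \<epsilon>_def)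
    ultimately have "(- 1) ^ (\<epsilon> * (parity M a + parity M c)) *
       ((- 1) ^ parity M a * ?f (v1 @ (a, a, q) # v2) - (- 1) ^ parity M c * ?f (v1 @ (c, c, q) # v2)) = 0"
      by (elim disjE) (simp_all add: g)
    then have "(- 1) ^ parity M a * ?f (v1 @ (a, a, q) # v2) = (- 1) ^ parity M c * ?f (v1 @ (c, c, q) # v2)"
      by simp
    then show ?thesis
      using True deg2[of a c a a] deg2[of a c c c] by (simp add: symbol_def)
  next
    case False
    then show ?thesis
      using deg2[of a c a a] deg2[of a c c c] by (auto simp: symbol_def)
  qed
qed

text \<open>The letters are replaced from left to right by diagonal letters with index
  \<open>o1\<close>; each replacement contributes the quotient of two supertrace signs.\<close>

lemma diagonal_form:
  fixes \<phi> :: "letter list \<Rightarrow> complex"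
  assumes nd: "\<And>v1 a c q v2. a \<in> {1..M + N} \<Longrightarrow> c \<in> {1..M + N} \<Longrightarrow> a \<noteq> c \<Longrightarrow> \<phi> (v1 @ (a, c, q) # v2) = 0"
    and sw: "\<And>v1 a c q v2. a \<in> {1..M + N} \<Longrightarrow> c \<in> {1..M + N} \<Longrightarrow>
      (- 1) ^ parity M a * \<phi> (v1 @ (a, a, q) # v2) = (- 1) ^ parity M c * \<phi> (v1 @ (c, c, q) # v2)"
    and o1: "o1 \<in> {1..M + N}" and "set v2 \<subseteq> qletters M N"
  shows "\<phi> (v1 @ v2) =
    diagonal_symbol M (\<lambda>qs. (- 1) ^ (parity M o1 * length qs) * \<phi> (v1 @ map (\<lambda>q. (o1, o1, q)) qs)) v2"
  using assms(4)
proof (induction v2 arbitrary: v1)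
  case Nil
  then show ?case by simp
next
  case (Cons x v2)
  obtain a c q where x: "x = (a, c, q)" by (cases x)
  have ac: "a \<in> {1..M + N}" "c \<in> {1..M + N}" using Cons.prems by (auto simp: x qletters_def)
  show ?case
  proof (cases "a = c")
    case False
    then show ?thesis using nd[OF ac] by (simp add: x)
  next
    case True
    have s: "(- 1) ^ parity M a * ((- 1) ^ parity M a * r) = r" for r :: complex
      by (rule sign_square)
    have "\<phi> (v1 @ x # v2) = (- 1) ^ parity M a * ((- 1) ^ parity M a * \<phi> (v1 @ (a, a, q) # v2))"
      unfolding s by (simp add: x True)
    also have "\<dots> = (- 1) ^ parity M a * ((- 1) ^ parity M o1 * \<phi> ((v1 @ [(o1, o1, q)]) @ v2))"
      unfolding sw[OF ac(1) o1] by simp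
    also have "\<phi> ((v1 @ [(o1, o1, q)]) @ v2) =
        diagonal_symbol M (\<lambda>qs. (- 1) ^ (parity M o1 * length qs) * \<phi> ((v1 @ [(o1, o1, q)]) @ map (\<lambda>q. (o1, o1, q)) qs)) v2"
      by (rule Cons.IH) (use Cons.prems in simp)
    finally show ?thesis
      using diagonal_symbol_scale[of M "(- 1) ^ parity M o1"
          "\<lambda>qs. (- 1) ^ (parity M o1 * length qs) * \<phi> (v1 @ (o1, o1, q) # map (\<lambda>q. (o1, o1, q)) qs)" v2]
      by (simp add: x True power_add mult.assoc)
  qed
qed

end

text \<open>The subalgebra \<open>B\<close> ensures that the intersection is taken over a nonempty
  family and stays inside the carrier.\<close>

lemma generated_subalgebra_unital:
  assumes "unital_subalgebra B A" "S \<subseteq> B"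
  shows "unital_subalgebra (generated_subalgebra A S) A" "generated_subalgebra A S \<subseteq> B"
proof -
  show sub: "generated_subalgebra A S \<subseteq> B"
    using assms by (auto simp: generated_subalgebra_def)
  have "B \<subseteq> carrier A" using assms by (simp add: unital_subalgebra_def)
  then show "unital_subalgebra (generated_subalgebra A S) A"
    using sub unfolding generated_subalgebra_def unital_subalgebra_def by blast
qed

lemma generated_subalgebra_superset: "S \<subseteq> generated_subalgebra A S"
  by (auto simp: generated_subalgebra_def)

text \<open>Lifts of the coefficients of Z to the free algebra. The identities that define Z enter
  from here on only through the action of the lifts in the tensor powers.\<close>

locale centre_rep =
  fixes M N :: nat and z :: "nat \<Rightarrow> free_elem"
  assumes nonempty: "M \<noteq> 0 \<or> N \<noteq> 0"
    and z_FC: "z n \<in> FC M N"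
    and beta_z: "beta M N m (z n) = tZ M N m $ n"
begin

text \<open>In every tensor power the generators are close to their diagonal action, and Z to the
  corresponding supertrace with factor \<open>-(r + 1)\<close>. These main parts cancel, and what
  remains raises the degree by less than \<open>r\<close>.\<close>

lemma z_lead: "z (Suc (Suc r)) + of_nat (Suc r) * lead M N r \<in> G M N r 0"
proof (rule psi_criterion)
  have JF: "lead M N r \<in> FC M N" using lead_G by (rule G_FC)
  show "z (Suc (Suc r)) + of_nat (Suc r) * lead M N r \<in> FC M N"
    by (intro FC_add z_FC FC_mult JF) (induction r, auto)
  fix n s assume s: "r < sdeg n s \<or> r = sdeg n s \<and> 0 \<le> socc n s"
  have T: "beta M N n (tw [(c, c, r)]) = tT M N n c c $ Suc r" if "c \<in> {1..M + N}" for c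
    using that by (subst beta_tw_Cons) (auto simp: qletters_def beta_1)
  have "beta M N n (lead M N r) = (\<Sum>c\<in>{1..M + N}. (- 1) ^ parity M c * tT M N n c c $ Suc r)"
    unfolding lead_def beta_sum beta_mult beta_sign by (intro sum.cong refl) (simp only: T)
  then have eq: "beta M N n (z (Suc (Suc r)) + of_nat (Suc r) * lead M N r) =
      (tZ M N n $ Suc (Suc r) + of_nat (Suc r) * lead_op M N n r) +
      of_nat (Suc r) * (\<Sum>c\<in>{1..M + N}. (- 1) ^ parity M c * (tT M N n c c $ Suc r - Dop M n (c, c, r)))"
    by (simp add: beta_add beta_mult beta_of_nat beta_z lead_op_def right_diff_distrib sum_subtractf del: of_nat_Suc)
  have "raises n (int r - 1) (beta M N n (z (Suc (Suc r)) + of_nat (Suc r) * lead M N r))"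
    unfolding eq by (intro raises_add raises_tZ_diff raises_of_nat raises_sum raises_sign raises_tT_diff) auto
  from raisesD[OF this bounded_vac]
  show "psi M N n (z (Suc (Suc r)) + of_nat (Suc r) * lead M N r) s = 0"
    using s unfolding bounded_def psi_def by force
qed

definition zc :: "nat \<Rightarrow> free_elem" where
  "zc r = Poly_Mapping.single 0 (- 1 / of_nat (Suc r)) * z (Suc (Suc r))"

lemma zc_lead: "zc r - lead M N r \<in> G M N r 0"
proof -
  have "Poly_Mapping.single 0 (- 1 / of_nat (Suc r)) * (of_nat (Suc r) * lead M N r) = - lead M N r"
    using of_nat_scale[of "Suc r" "lead M N r"] by (simp only: minus_divide_left[symmetric] single_uminus mult_minus_left)
  then have "zc r - lead M N r = Poly_Mapping.single 0 (- 1 / of_nat (Suc r)) * (z (Suc (Suc r)) + of_nat (Suc r) * lead M N r)"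
    by (simp only: zc_def distrib_left) simp
  then show ?thesis using G_scale[OF z_lead] by simp
qed

lemma zc_G: "zc r \<in> G M N r 2"
proof -
  have "zc r - lead M N r + lead M N r \<in> G M N r 2"
    by (intro G_add G_mono[OF zc_lead] lead_G) auto
  then show ?thesis by simp
qed

lemma z_zc: "z (Suc (Suc r)) = Poly_Mapping.single 0 (- of_nat (Suc r)) * zc r"
  by (simp add: zc_def mult.assoc[symmetric] mult_single del: of_nat_Suc)

section \<open>The subalgebra of central elements\<close>

text \<open>Evenness together with ordinary commutation is stable under sums and products without
  signs, so these elements give a subalgebra containing everything that the lifts generate.\<close>

definition central_rep :: "free_elem \<Rightarrow> bool" where
  "central_rep x \<longleftrightarrow> x \<in> FC M N \<and> hp M 1 x \<in> yangian_ideal M N \<and>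
     (\<forall>m. \<forall>y\<in>FC M N. beta M N m x * beta M N m y = beta M N m y * beta M N m x)"

text \<open>For evenness, the image commutes with the grading operator, so its vacuum expansion has
  no odd states. Commutation is that of scalar matrices with left multiplications at each
  site.\<close>

lemma central_rep_z: "central_rep (z n)"
proof -
  have "hp M 1 (z n) \<in> yangian_ideal M N"
  proof (rule YI_criterion)
    fix l s
    show "psi M N l (hp M 1 (z n)) s = 0"
    proof (cases "even (spar M s l)")
      case True
      then show ?thesis by (intro psi_parity[OF FC_hp[OF z_FC] homogeneous_hp]) simp
    next
      case False
      have "tZ M N l $ n * theta M l = (- 1) ^ 0 * (theta M l * tZ M N l $ n)"
        using tZ_commutes[OF theta_site_supercommutes, of l] by simp
      then have "psi M N l (z n) s = 0"
        unfolding psi_def beta_z by (rule even_operator_vac) (use False in simp)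
      then show ?thesis by (simp add: psi_hp[OF z_FC])
    qed
  qed (simp add: z_FC)
  moreover have "beta M N m (z n) * beta M N m y = beta M N m y * beta M N m (z n)" if "y \<in> FC M N" for m y
    using beta_commutes[OF tZ_site_supercommutes that] unfolding beta_z by metis
  ultimately show ?thesis by (simp add: central_rep_def z_FC)
qed

lemma central_rep_const: "central_rep (Poly_Mapping.single 0 c)"
proof -
  have "homogeneous M 0 (Poly_Mapping.single 0 c :: free_elem)"
    by (simp add: homogeneous_def word_parity_def zero_gen_word_def)
  then have "hp M 1 (Poly_Mapping.single 0 c) = 0" by (subst hp_homogeneous) auto
  moreover have "beta M N m (Poly_Mapping.single 0 c) * Y = Y * beta M N m (Poly_Mapping.single 0 c)" for m Y
    using beta_scale[of M N m c 1] by (simp add: beta_1 cs_commute)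
  ultimately show ?thesis by (simp add: central_rep_def)
qed

lemma central_rep_add: "central_rep x \<Longrightarrow> central_rep y \<Longrightarrow> central_rep (x + y)"
  by (simp add: central_rep_def hp_add YI_add beta_add distrib_left distrib_right)

lemma central_rep_mult:
  assumes "central_rep x" "central_rep y"
  shows "central_rep (x * y)"
proof -
  have "hp M 1 (x * y) \<in> yangian_ideal M N"
    using assms hp_mult[of 1 M x y]
    by (auto simp: central_rep_def intro!: YI_add intro: YI_mult_left YI_mult_right)
  moreover have "beta M N m (x * y) * beta M N m w = beta M N m w * beta M N m (x * y)" if "w \<in> FC M N" for m w
  proof -
    have c: "beta M N m x * beta M N m w = beta M N m w * beta M N m x"
      "beta M N m y * beta M N m w = beta M N m w * beta M N m y"
      using assms that by (auto simp: central_rep_def)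
    show ?thesis unfolding beta_mult by (metis c mult.assoc)
  qed
  ultimately show ?thesis using assms by (simp add: central_rep_def)
qed

lemma central_rep_commute:
  assumes "central_rep x" "y \<in> FC M N"
  shows "x * y - y * x \<in> yangian_ideal M N"
  using assms
  by (intro YI_criterion) (auto simp: central_rep_def psi_def beta_diff beta_mult app_simps)

text \<open>For an even element the supercommutator is the commutator, and vanishing in all tensor
  powers suffices.\<close>

lemma central_rep_supercentre:
  assumes x: "central_rep x"
  shows "cls M N x \<in> supercentre (yangian M N)"
proof -
  have xF: "x \<in> FC M N" and odd: "hp M 1 x \<in> yangian_ideal M N" using x by (auto simp: central_rep_def)
  have b1: "beta M N n (hp M 1 x) = 0" for n by (rule beta_YI[OF odd])
  have b0: "beta M N n (hp M 0 x) = beta M N n x" for n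
    using hp_split[of M x] beta_add[of M N n "hp M 0 x" "hp M 1 x"] b1 by simp
  have "free_supercomm M x y \<in> yangian_ideal M N" if y: "y \<in> FC M N" for y
  proof (rule YI_criterion[OF free_supercomm_FC[OF xF y]])
    fix n s
    have "beta M N n x * beta M N n (hp M p y) = beta M N n (hp M p y) * beta M N n x" for p
      using x y by (simp add: central_rep_def)
    then have "beta M N n (free_supercomm M x y) = 0"
      using b1 unfolding free_supercomm_def by (simp add: beta_add beta_diff beta_mult beta_uminus b0)
    then show "psi M N n (free_supercomm M x y) s = 0" by (simp add: psi_def app_simps)
  qed
  then show ?thesis by (simp add: supercentre_Yg[OF xF])
qed

abbreviation "YA \<equiv> yangian M N"

definition gen :: "free_elem set set" where
  "gen = generated_subalgebra YA ((\<lambda>n. cls M N (z n)) ` {2..})"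

lemma gen_unital: "unital_subalgebra gen YA" and gen_supercentre: "gen \<subseteq> supercentre YA"
proof -
  let ?B = "cls M N ` Collect central_rep"
  have FC: "central_rep x \<Longrightarrow> x \<in> FC M N" for x by (simp add: central_rep_def)
  have B: "unital_subalgebra ?B YA"
    unfolding unital_subalgebra_def
  proof (intro conjI ballI allI)
    show "?B \<subseteq> carrier YA" using FC by (auto simp: carrier_Yg)
    show "\<zero>\<^bsub>YA\<^esub> \<in> ?B" using central_rep_const[of 0] by (auto simp: zero_Yg)
    show "\<one>\<^bsub>YA\<^esub> \<in> ?B" using central_rep_const[of 1] by (auto simp: one_Yg)
    show "a \<oplus>\<^bsub>YA\<^esub> b \<in> ?B" "a \<otimes>\<^bsub>YA\<^esub> b \<in> ?B" if "a \<in> ?B" "b \<in> ?B" for a b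
      using that by (auto simp: add_Yg mult_Yg FC intro: central_rep_add central_rep_mult)
    show "c \<odot>\<^bsub>YA\<^esub> a \<in> ?B" if "a \<in> ?B" for c a
      using that by (auto simp: smult_Yg FC intro!: imageI central_rep_mult central_rep_const)
  qed
  have sub: "(\<lambda>n. cls M N (z n)) ` {2..} \<subseteq> ?B" using central_rep_z by auto
  show "unital_subalgebra gen YA" unfolding gen_def by (rule generated_subalgebra_unital(1)[OF B sub])
  have "gen \<subseteq> ?B" unfolding gen_def by (rule generated_subalgebra_unital(2)[OF B sub])
  then show "gen \<subseteq> supercentre YA" using central_rep_supercentre by auto
qed

lemma gen_add: "x \<in> FC M N \<Longrightarrow> y \<in> FC M N \<Longrightarrow> cls M N x \<in> gen \<Longrightarrow> cls M N y \<in> gen \<Longrightarrow> cls M N (x + y) \<in> gen"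
  and gen_mult: "x \<in> FC M N \<Longrightarrow> y \<in> FC M N \<Longrightarrow> cls M N x \<in> gen \<Longrightarrow> cls M N y \<in> gen \<Longrightarrow> cls M N (x * y) \<in> gen"
  and gen_scale: "x \<in> FC M N \<Longrightarrow> cls M N x \<in> gen \<Longrightarrow> cls M N (Poly_Mapping.single 0 c * x) \<in> gen"
  and gen_0: "cls M N 0 \<in> gen" and gen_1: "cls M N 1 \<in> gen"
  using gen_unital unfolding unital_subalgebra_def
  by (metis add_Yg, metis mult_Yg, metis smult_Yg, metis zero_Yg, metis one_Yg)

lemma gen_zc: "cls M N (zc r) \<in> gen"
proof -
  have "cls M N (z (Suc (Suc r))) \<in> gen"
    using generated_subalgebra_superset unfolding gen_def by (rule subsetD) auto
  then show ?thesis unfolding zc_def by (rule gen_scale[OF z_FC])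
qed

lemma ordered_poly_gen: "ordered_poly zc D P F \<in> FC M N \<and> cls M N (ordered_poly zc D P F) \<in> gen"
proof (induction P arbitrary: F)
  case 0
  then show ?case using gen_scale[OF FC_1 gen_1, of "F []"] by simp
next
  case (Suc P)
  have "sum f A \<in> FC M N \<and> cls M N (sum f A) \<in> gen"
    if "finite A" "\<And>a. a \<in> A \<Longrightarrow> f a \<in> FC M N \<and> cls M N (f a) \<in> gen" for f :: "nat \<Rightarrow> free_elem" and A
    using that by (induction A rule: finite_induct) (auto simp: gen_0 gen_add)
  then show ?case
    using Suc.IH zc_G[THEN G_FC] gen_zc by (auto simp: gen_mult)
qed

theorem supercentre_gen:
  assumes "x \<in> G M N d p" "cls M N x \<in> supercentre YA"
  shows "cls M N x \<in> gen"
  using assms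
proof (induction rule: G_induct)
  case (bottom x)
  then have "cls M N x = cls M N 0" using YI_FC by (simp add: cls_eq_iff)
  then show ?case using gen_0 by simp
next
  case (drop x d p)
  then show ?case by simp
next
  case (step x d P)
  have xF: "x \<in> FC M N" by (rule G_FC[OF step.hyps])
  have cent: "free_supercomm M x y \<in> yangian_ideal M N" if "y \<in> FC M N" for y
    using step.prems that by (simp add: supercentre_Yg[OF xF])
  have one: "(1 :: nat) \<in> {1..M + N}" using nonempty by auto
  \<comment> \<open>The symbol is determined by its values at words in the letters
    \<open>(1, 1, q)\<close>; the sign compensates the weight of the index 1 in the
    supertraces.\<close>
  define F where "F qs = (- 1) ^ (parity M 1 * length qs) * symbol M N d P x (map (\<lambda>q. (1, 1, q)) qs)" for qs
  have F: "sum_list qs = d" if "F qs \<noteq> 0" for qs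
    using that by (auto simp: F_def symbol_def qdeg_def lq_def comp_def split: if_splits)
  obtain X where X: "finite X" "X \<subseteq> qletters M N"
    "\<And>X'. finite X' \<Longrightarrow> X \<subseteq> X' \<Longrightarrow> X' \<subseteq> qletters M N \<Longrightarrow>
       wsum X' P (symbol M N d P x) - of_nat (fact P) * x \<in> G M N d P"
    using symbol_reconstruct[OF step.hyps] by metis
  obtain D where D: "\<And>q. q \<in> lq ` X \<Longrightarrow> q \<le> D"
    using X(1) by (metis finite_imageI finite_nat_set_iff_bounded_le)
  have XD: "X \<subseteq> box M N D" using X(2) D by (force simp: box_def qletters_def lq_def)
  have sym: "symbol M N d P x v = diagonal_symbol M F v" if "set v \<subseteq> qletters M N" for v
  proof -
    have "symbol M N d P x ([] @ v) =
        diagonal_symbol M (\<lambda>qs. (- 1) ^ (parity M 1 * length qs) * symbol M N d P x ([] @ map (\<lambda>q. (1, 1, q)) qs)) v"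
      by (rule diagonal_form[OF central_symbol(1)[OF step.hyps cent] central_symbol(2)[OF step.hyps cent] one that])
    then show ?thesis by (simp add: F_def[abs_def])
  qed
  have "wsum (box M N D) P (symbol M N d P x) = wsum (box M N D) P (diagonal_symbol M F)"
    unfolding wsum_def
    by (intro sum.cong refl) (auto simp: words_def sym[OF subset_trans[OF _ box_qletters[of M N D]]])
  then have w: "ordered_poly (lead M N) D P F - of_nat (fact P) * x \<in> G M N d P"
    using X(3)[OF finite_box XD box_qletters] by (simp add: wsum_diagonal_symbol)
  have j: "ordered_poly zc D P F - ordered_poly (lead M N) D P F \<in> G M N d P"
    by (rule ordered_poly_diff[OF zc_G lead_G zc_lead F])
  define y where "y = Poly_Mapping.single 0 (1 / of_nat (fact P)) * ordered_poly zc D P F"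
  have yF: "y \<in> FC M N" and yg: "cls M N y \<in> gen" unfolding y_def using ordered_poly_gen gen_scale by auto
  have "Poly_Mapping.single 0 (1 / of_nat (fact P)) * (ordered_poly zc D P F - of_nat (fact P) * x) = y - x"
    unfolding right_diff_distrib y_def using of_nat_scale[of "fact P" x] by simp
  moreover have "ordered_poly zc D P F - of_nat (fact P) * x \<in> G M N d P"
    using G_add[OF j w] by simp
  ultimately have yx: "y - x \<in> G M N d P" by (metis G_scale)
  \<comment> \<open>Being in the generated subalgebra, \<open>y\<close> is central, so the lower
    element \<open>y - x\<close> is central too and the induction hypothesis applies to it.\<close>
  have "free_supercomm M y w \<in> yangian_ideal M N" if "w \<in> FC M N" for w
    using gen_supercentre yg that supercentre_Yg[OF yF] by blast
  then have "cls M N (y - x) \<in> supercentre YA"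
    unfolding supercentre_Yg[OF FC_diff[OF yF xF]] free_supercomm_diff using cent by (intro ballI YI_diff)
  from gen_scale[OF FC_diff[OF yF xF] step.IH[OF yx this], of "-1"]
  have "cls M N (x - y) \<in> gen" by (simp add: single_uminus)
  from gen_add[OF yF FC_diff[OF xF yF] yg this] show ?case by simp
qed

lemma gen_eq_supercentre: "gen = supercentre YA"
proof
  show "supercentre YA \<subseteq> gen"
  proof
    fix X assume X: "X \<in> supercentre YA"
    then obtain x where x: "X = cls M N x" "x \<in> FC M N" by (auto simp: supercentre_def carrier_Yg)
    obtain d p where "x \<in> G M N d p" by (rule FC_G[OF x(2)])
    from supercentre_gen[OF this] X x show "X \<in> gen" by simp
  qed
qed (rule gen_supercentre)

end

section \<open>Algebraic independence\<close>

lemma del_Nats: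
  assumes "even (lpar M x)" "\<And>v. f v \<in> \<nat>"
  shows "del M x f v \<in> \<nat>"
  using assms(2)
proof (induction v arbitrary: f)
  case (Cons y v)
  have "del M x (\<lambda>v'. f (y # v')) v \<in> \<nat>" by (rule Cons.IH[OF Cons.prems])
  then show ?case using assms(1) Cons.prems[of v] by simp
qed simp

lemma Sym_Nats: "\<forall>x\<in>set w. even (lpar M x) \<Longrightarrow> Sym M w v \<in> \<nat>"
  by (induction w arbitrary: v) (auto intro: del_Nats)

text \<open>Even letters produce no signs, so contributions are natural numbers and cannot cancel,
  and the arrangement that leaves the word in order counts. This is why words in
  \<open>(1, 1, q)\<close> serve as test words.\<close>

lemma Sym_self_nonzero: "\<forall>x\<in>set w. even (lpar M x) \<Longrightarrow> Sym M w w \<noteq> 0"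
proof (induction w)
  case (Cons x w)
  have "del M x (\<lambda>v'. Sym M w (x # v')) w \<in> \<nat>" "Sym M w w \<in> \<nat>"
    using Cons.prems by (auto intro!: del_Nats Sym_Nats)
  then obtain a b where ab: "del M x (\<lambda>v'. Sym M w (x # v')) w = of_nat a" "Sym M w w = of_nat b"
    by (metis Nats_cases)
  have "b \<noteq> 0" using Cons ab(2) by auto
  then have "of_nat b + of_nat a \<noteq> (0 :: complex)" by (metis add_is_0 of_nat_add of_nat_eq_0_iff)
  then show ?case using Cons.prems by (simp add: ab)
qed simp

lemma diagonal_word:
  "set v \<subseteq> (\<lambda>q. (c, c, q)) ` UNIV \<Longrightarrow> v = map (\<lambda>q. (c, c, q)) (map lq v)"
  by (induction v) (auto simp: lq_def)

lemma qdeg_diagonal: "qdeg (map (\<lambda>q. (c, c, q)) qs) = sum_list qs"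
  by (induction qs) (simp_all add: lq_def)

lemma map_lq_diagonal: "map lq (map (\<lambda>q. (c, c, q)) qs) = qs"
  by (induction qs) (simp_all add: lq_def)

lemma lex_maximum:
  fixes f g :: "'a \<Rightarrow> nat"
  assumes "finite K" "K \<noteq> {}"
  shows "\<exists>m0\<in>K. \<forall>m\<in>K. f m < f m0 \<or> f m = f m0 \<and> g m \<le> g m0"
  using assms
proof (induction K rule: finite_ne_induct)
  case (insert a K)
  then obtain m0 where m0: "m0 \<in> K" "\<And>m. m \<in> K \<Longrightarrow> f m < f m0 \<or> f m = f m0 \<and> g m \<le> g m0" by blast
  show ?case
  proof (cases "f a < f m0 \<or> f a = f m0 \<and> g a \<le> g m0")
    case True
    then show ?thesis using m0 by (intro bexI[of _ m0]) auto
  next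
    case False
    then have "f m < f a \<or> f m = f a \<and> g m \<le> g a" if "m \<in> K" for m
      using m0(2)[OF that] by linarith
    then show ?thesis by (intro bexI[of _ a]) auto
  qed
qed simp

text \<open>Lists, with multiplicity, the degrees of the supertraces that lead the factors of a
  monomial. The subtraction is truncated, so exponents can be recovered only for indices from 2
  on.\<close>

definition exponent_word :: "(nat \<Rightarrow>\<^sub>0 nat) \<Rightarrow> nat list" where
  "exponent_word m = concat (map (\<lambda>r. replicate (Poly_Mapping.lookup m r) (r - 2))
     (sorted_list_of_set (Poly_Mapping.keys m)))"

lemma count_exponent_word:
  assumes "Poly_Mapping.keys m \<subseteq> {2..}" "2 \<le> r"
  shows "count (mset (exponent_word m)) (r - 2) = Poly_Mapping.lookup m r"
proof -
  have "count (mset (concat (map (\<lambda>r. replicate (k r) (r - 2)) l))) (r - 2) = (if r \<in> set l then k r else 0)"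
    if "distinct l" "set l \<subseteq> {2..}" for l and k :: "nat \<Rightarrow> nat"
    using that
  proof (induction l)
    case (Cons a l)
    then have "r - 2 = a - 2 \<longleftrightarrow> r = a" using assms(2) by auto
    then show ?case using Cons by auto
  qed simp
  from this[of "sorted_list_of_set (Poly_Mapping.keys m)" "Poly_Mapping.lookup m"]
  show ?thesis using assms by (auto simp: exponent_word_def in_keys_iff)
qed

lemma exponent_word_inj:
  assumes "Poly_Mapping.keys m \<subseteq> {2..}" "Poly_Mapping.keys m' \<subseteq> {2..}"
    and "mset (exponent_word m) = mset (exponent_word m')"
  shows "m = m'"
proof (rule poly_mapping_eqI)
  fix r
  show "Poly_Mapping.lookup m r = Poly_Mapping.lookup m' r"
  proof (cases "2 \<le> r")
    case True
    then show ?thesis using assms count_exponent_word by metis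
  next
    case False
    then have "r \<notin> Poly_Mapping.keys m" "r \<notin> Poly_Mapping.keys m'" using assms(1,2) by auto
    then show ?thesis by (simp add: in_keys_iff)
  qed
qed

section \<open>Independence of monomials in the central elements\<close>

context centre_rep
begin

definition zprod :: "nat list \<Rightarrow> free_elem" where
  "zprod qs = prod_list (map zc qs)"

lemma sum_list_support: "(if qs' = qs then 1 else 0 :: complex) \<noteq> 0 \<Longrightarrow> sum_list qs' = sum_list (qs :: nat list)"
  by (simp split: if_splits)

lemma zprod_G: "zprod qs \<in> G M N (sum_list qs) (Suc (length qs))"
proof -
  have "set qs \<subseteq> {..sum_list qs}" using member_le_sum_list by auto
  from ordered_poly_single[OF this, of zc] show ?thesis
    unfolding zprod_def
    by (metis (mono_tags, lifting) ordered_poly_G[OF zc_G sum_list_support])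
qed

lemma psi_zprod_low:
  assumes "sum_list qs < sum_list qs0 \<or> sum_list qs = sum_list qs0 \<and> length qs < length qs0"
  shows "psi M N (length qs0) (zprod qs) (state_of (map (\<lambda>q. (1, 1, q)) qs0)) = 0"
proof (rule psi_G[OF zprod_G])
  let ?v = "map (\<lambda>q. (1, 1, q)) qs0 :: letter list"
  have "sdeg (length qs0) (state_of ?v) = sum_list qs0" "socc (length qs0) (state_of ?v) = length qs0"
    using sdeg_state_of[of ?v] socc_state_of[of ?v] by (simp_all only: length_map qdeg_diagonal)
  then show "sum_list qs < sdeg (length qs0) (state_of ?v) \<or>
      sum_list qs = sdeg (length qs0) (state_of ?v) \<and> Suc (length qs) \<le> socc (length qs0) (state_of ?v)"
    using assms by auto
qed

text \<open>Products of supertraces involve all diagonal letters, but at a test word in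
  \<open>(1, 1, q)\<close> only its own rearrangements contribute, so monomials of equal degree and
  length are separated by their multisets of degrees.\<close>

lemma psi_zprod_top:
  assumes "sum_list qs = sum_list qs0" "length qs = length qs0"
  shows "psi M N (length qs0) (zprod qs) (state_of (map (\<lambda>q. (1, 1, q)) qs0)) =
    (if mset qs = mset qs0 then (- 1) ^ (parity M 1 * length qs) *
      Sym M (map (\<lambda>q. (1, 1, q)) qs) (map (\<lambda>q. (1, 1, q)) qs0) else 0)"
proof -
  let ?v = "map (\<lambda>q. (1, 1, q)) :: nat list \<Rightarrow> letter list"
  let ?D = "sum_list qs" and ?P = "length qs0"
  let ?F = "\<lambda>qs'. if qs' = qs then 1 else 0 :: complex"
  have qv: "qdeg (?v qs) = sum_list qs" for qs by (rule qdeg_diagonal)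
  have D: "set qs \<subseteq> {..?D}" using member_le_sum_list by auto
  have one: "(1 :: nat) \<in> {1..M + N}" using nonempty by auto
  have s: "sdeg ?P (state_of (?v qs0)) = ?D" "socc ?P (state_of (?v qs0)) = ?P"
    using sdeg_state_of[of "?v qs0"] socc_state_of[of "?v qs0"] by (simp_all only: length_map qdeg_diagonal assms)
  have "ordered_poly zc ?D ?P ?F = zprod qs"
    using ordered_poly_single[OF D, of zc] assms by (simp add: zprod_def)
  moreover have "ordered_poly zc ?D ?P ?F - ordered_poly (lead M N) ?D ?P ?F \<in> G M N ?D ?P"
    by (rule ordered_poly_diff[OF zc_G lead_G zc_lead sum_list_support])
  ultimately have "zprod qs - ordered_poly (lead M N) ?D ?P ?F \<in> G M N ?D ?P" by simp
  then have "psi M N ?P (zprod qs - ordered_poly (lead M N) ?D ?P ?F) (state_of (?v qs0)) = 0"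
    by (rule psi_G) (unfold s, simp)
  then have "psi M N ?P (zprod qs) (state_of (?v qs0)) = psi M N ?P (wsum (box M N ?D) ?P (diagonal_symbol M ?F)) (state_of (?v qs0))"
    by (simp add: psi_diff wsum_diagonal_symbol)
  also have "\<dots> = (\<Sum>w\<in>words (box M N ?D) ?P. diagonal_symbol M ?F w * psi M N ?P (tw w) (state_of (?v qs0)))"
    unfolding wsum_def psi_sum psi_scale ..
  also have "\<dots> = (\<Sum>w\<in>words (box M N ?D) ?P. if w = ?v qs \<and> mset qs = mset qs0 then diagonal_symbol M ?F w * Sym M w (?v qs0) else 0)"
  proof (rule sum.cong[OF refl])
    fix w assume w: "w \<in> words (box M N ?D) ?P"
    show "diagonal_symbol M ?F w * psi M N ?P (tw w) (state_of (?v qs0)) =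
        (if w = ?v qs \<and> mset qs = mset qs0 then diagonal_symbol M ?F w * Sym M w (?v qs0) else 0)"
    proof (cases "diagonal_symbol M ?F w = 0")
      case False
      then have lw: "map lq w = qs" using diagonal_symbol_nonzero[OF False] by (simp split: if_splits)
      have wq: "set w \<subseteq> qletters M N" "length w = ?P"
        using w box_qletters[of M N ?D] by (auto simp: words_def)
      have "qdeg (?v qs0) = qdeg w" using qv[of qs0] assms lw by (simp add: qdeg_def)
      then have p: "psi M N ?P (tw w) (state_of (?v qs0)) = Sym M w (?v qs0)"
        using psi_tw_top[OF wq(1), of "?v qs0"] wq(2) by simp
      \<comment> \<open>A rearrangement of the test word consists of letters with matrix indices 1,
        and is then determined by its list of degrees.\<close>
      have "w = ?v qs \<and> mset qs = mset qs0" if "Sym M w (?v qs0) \<noteq> 0"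
      proof -
        have m: "mset w = mset (?v qs0)" using Sym_nonzero[OF that] by simp
        then have "set w = set (?v qs0)" by (rule mset_eq_setD)
        then have "w = ?v (map lq w)" by (intro diagonal_word) auto
        then have wv: "w = ?v qs" using lw by simp
        have "mset qs = mset (map lq (?v qs0))"
          unfolding lw[symmetric] mset_map[of lq] m ..
        then show ?thesis using wv unfolding map_lq_diagonal by blast
      qed
      then show ?thesis using p by auto
    qed (simp only: mult_zero_left if_cancel)
  qed
  also have "\<dots> = (if mset qs = mset qs0 then diagonal_symbol M ?F (?v qs) * Sym M (?v qs) (?v qs0) else 0)"
  proof -
    have "?v qs \<in> words (box M N ?D) ?P"
      using D one assms by (auto simp: words_def box_def)
    then show ?thesis
      using finite_words[OF finite_box] by (cases "mset qs = mset qs0") (simp_all add: sum.delta)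
  qed
  finally show ?thesis by (simp add: diagonal_symbol_const)
qed

lemma psi_zprod_self: "psi M N (length qs) (zprod qs) (state_of (map (\<lambda>q. (1, 1, q)) qs)) \<noteq> 0"
  using Sym_self_nonzero[of "map (\<lambda>q. (1, 1, q)) qs" M] unfolding psi_zprod_top[OF refl refl]
  by (simp add: lpar_def)

lemma zprod_append: "zprod (v @ w) = zprod v * zprod w"
  by (simp add: zprod_def)

lemma zprod_FC: "zprod qs \<in> FC M N"
  using zprod_G by (rule G_FC)

definition multiple :: "free_elem \<Rightarrow> free_elem set \<Rightarrow> bool" where
  "multiple x X \<longleftrightarrow> (\<exists>c. c \<noteq> 0 \<and> X = cls M N (Poly_Mapping.single 0 c * x))"

lemma multiple_mult:
  assumes "x \<in> FC M N" "y \<in> FC M N" "multiple x X" "multiple y Y"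
  shows "multiple (x * y) (X \<otimes>\<^bsub>YA\<^esub> Y)"
proof -
  obtain c d where c: "c \<noteq> 0" "X = cls M N (Poly_Mapping.single 0 c * x)"
    and d: "d \<noteq> 0" "Y = cls M N (Poly_Mapping.single 0 d * y)"
    using assms(3,4) unfolding multiple_def by blast
  have "(Poly_Mapping.single 0 c * x) * (Poly_Mapping.single 0 d * y) =
      Poly_Mapping.single 0 c * (Poly_Mapping.single 0 d * (x * y))"
    unfolding mult.assoc scale_left_commute[of x d y] ..
  also have "\<dots> = Poly_Mapping.single 0 (c * d) * (x * y)"
    by (simp add: mult.assoc[symmetric] mult_single)
  finally have "X \<otimes>\<^bsub>YA\<^esub> Y = cls M N (Poly_Mapping.single 0 (c * d) * (x * y))"
    using assms by (simp add: c d mult_Yg)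
  then show ?thesis using c(1) d(1) unfolding multiple_def by (intro exI[of _ "c * d"]) simp
qed

lemma multiple_one: "multiple (zprod []) \<one>\<^bsub>YA\<^esub>"
  unfolding multiple_def by (rule exI[of _ 1]) (simp add: one_Yg zprod_def)

lemma multiple_z:
  assumes "2 \<le> r"
  shows "multiple (zprod [r - 2]) (cls M N (z r))"
proof -
  have "Suc (Suc (r - 2)) = r" using assms by simp
  then have "cls M N (z r) = cls M N (Poly_Mapping.single 0 (- of_nat (Suc (r - 2))) * zprod [r - 2])"
    using z_zc[of "r - 2"] by (simp add: zprod_def del: of_nat_Suc)
  then show ?thesis unfolding multiple_def by (intro exI[of _ "- of_nat (Suc (r - 2))"]) (simp del: of_nat_Suc)
qed

lemma multiple_power: "2 \<le> r \<Longrightarrow> multiple (zprod (replicate k (r - 2))) (cls M N (z r) [^]\<^bsub>YA\<^esub> k)"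
proof (induction k)
  case 0
  then show ?case using multiple_one by (simp add: nat_pow_def)
next
  case (Suc k)
  interpret ring YA by (rule ring_Yg)
  show ?case
    unfolding nat_pow_Suc replicate_Suc replicate_append_same[symmetric] zprod_append
    by (intro multiple_mult zprod_FC multiple_z Suc)
qed

lemma multiple_monomial:
  assumes "Poly_Mapping.keys m \<subseteq> {2..}"
  shows "multiple (zprod (exponent_word m)) (eval_monomial YA (\<lambda>n. cls M N (z n)) m)"
proof -
  have "multiple (zprod (concat (map (\<lambda>r. replicate (k r) (r - 2)) l)))
      (foldr (\<lambda>r x. (cls M N (z r) [^]\<^bsub>YA\<^esub> k r) \<otimes>\<^bsub>YA\<^esub> x) l \<one>\<^bsub>YA\<^esub>)"
    if "set l \<subseteq> {2..}" for l and k :: "nat \<Rightarrow> nat"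
    using that
  proof (induction l)
    case Nil
    then show ?case using multiple_one by simp
  next
    case (Cons r l)
    then show ?case
      by (simp only: list.map concat.simps foldr.simps comp_apply zprod_append)
        (rule multiple_mult[OF zprod_FC zprod_FC multiple_power Cons.IH]; simp)
  qed
  then show ?thesis
    unfolding exponent_word_def eval_monomial_def using assms by simp
qed

lemma alg_independent_z: "alg_independent YA (\<lambda>n. cls M N (z n)) {2..}"
  unfolding alg_independent_def
proof (intro conjI ballI allI impI)
  show "cls M N (z r) \<otimes>\<^bsub>YA\<^esub> cls M N (z s) = cls M N (z s) \<otimes>\<^bsub>YA\<^esub> cls M N (z r)" for r s
    using central_rep_commute[OF central_rep_z z_FC] by (simp add: mult_Yg z_FC cls_eq_iff)
  fix P :: "(nat \<Rightarrow>\<^sub>0 nat) \<Rightarrow>\<^sub>0 complex"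
  assume keys: "\<forall>m\<in>Poly_Mapping.keys P. Poly_Mapping.keys m \<subseteq> {2..}"
    and zero: "eval_poly YA (\<lambda>n. cls M N (z n)) P = \<zero>\<^bsub>YA\<^esub>"
  let ?K = "Poly_Mapping.keys P" and ?w = exponent_word
  obtain c where c: "\<And>m. m \<in> ?K \<Longrightarrow> c m \<noteq> 0 \<and>
      eval_monomial YA (\<lambda>n. cls M N (z n)) m = cls M N (Poly_Mapping.single 0 (c m) * zprod (?w m))"
    using multiple_monomial keys unfolding multiple_def by metis
  define x where "x = (\<Sum>m\<in>?K. Poly_Mapping.single 0 (Poly_Mapping.lookup P m) * (Poly_Mapping.single 0 (c m) * zprod (?w m)))"
  have xF: "x \<in> FC M N" unfolding x_def by (intro FC_sum FC_scale zprod_FC)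
  have "eval_poly YA (\<lambda>n. cls M N (z n)) P = cls M N x"
    unfolding eval_poly_def x_def by (rule finsum_Yg') (auto simp: c smult_Yg zprod_FC)
  then have "cls M N x = cls M N 0" using zero by (simp only: zero_Yg)
  then have x: "x \<in> yangian_ideal M N" using cls_eq_iff[OF xF FC_0] by simp
  show "P = 0"
  proof (rule ccontr)
    assume "P \<noteq> 0"
    \<comment> \<open>Largest total degree, then largest length: at the test word of
      \<open>m0\<close> smaller monomials vanish by the filtration, and those of equal rank vanish
      because their multisets differ.\<close>
    then obtain m0 where m0: "m0 \<in> ?K" "\<And>m. m \<in> ?K \<Longrightarrow> sum_list (?w m) < sum_list (?w m0) \<or>
        sum_list (?w m) = sum_list (?w m0) \<and> length (?w m) \<le> length (?w m0)"
      using lex_maximum[of ?K "\<lambda>m. sum_list (?w m)" "\<lambda>m. length (?w m)"] by auto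
    let ?f = "\<lambda>y. psi M N (length (?w m0)) y (state_of (map (\<lambda>q. (1, 1, q)) (?w m0)))"
    have other: "?f (zprod (?w m)) = 0" if m: "m \<in> ?K" "m \<noteq> m0" for m
    proof (cases "sum_list (?w m) = sum_list (?w m0) \<and> length (?w m) = length (?w m0)")
      case True
      have "mset (?w m) \<noteq> mset (?w m0)" using exponent_word_inj keys m m0(1) by blast
      then show ?thesis using True by (simp only: psi_zprod_top if_False)
    next
      case False
      then show ?thesis using m0(2)[OF m(1)] by (intro psi_zprod_low) auto
    qed
    have "?f x = (\<Sum>m\<in>?K. if m = m0 then Poly_Mapping.lookup P m0 * (c m0 * ?f (zprod (?w m0))) else 0)"
      unfolding x_def psi_sum psi_scale using other by (intro sum.cong refl) auto
    also have "\<dots> = Poly_Mapping.lookup P m0 * (c m0 * ?f (zprod (?w m0)))"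
      using m0(1) by simp
    finally have "Poly_Mapping.lookup P m0 * (c m0 * ?f (zprod (?w m0))) = 0"
      using psi_YI[OF x] by simp
    moreover have "Poly_Mapping.lookup P m0 \<noteq> 0" using m0(1) by (simp add: in_keys_iff)
    ultimately show False using c[OF m0(1)] psi_zprod_self[of "?w m0"] by simp
  qed
qed

end

theorem theorem2p6:
  fixes M N :: nat
    and T' :: "nat \<Rightarrow> nat \<Rightarrow> nat \<Rightarrow> free_elem set"
    and Z :: "nat \<Rightarrow> free_elem set"
  assumes "M \<noteq> 0 \<or> N \<noteq> 0"
    and "tensor_inverse M N (yangian M N) (yangian_T M N) T'"
    and "\<forall>n. Z n \<in> carrier (yangian M N)"
    and "Z 0 = \<one>\<^bsub>yangian M N\<^esub>" and "Z 1 = \<zero>\<^bsub>yangian M N\<^esub>"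
    and "Z_identities M N T' Z"
  shows "alg_independent (yangian M N) Z {2..} \<and>
         generated_subalgebra (yangian M N) (Z ` {2..}) = supercentre (yangian M N)"
proof -
  have "\<forall>n. \<exists>x. Z n = cls M N x \<and> x \<in> FC M N"
    using assms(3) by (auto simp: carrier_Yg)
  then obtain z where z: "\<And>n. Z n = cls M N (z n)" "\<And>n. z n \<in> FC M N" by metis
  interpret centre_rep M N z
    using assms(1) z(2) beta_Z[OF assms(2,6) z assms(1)] by unfold_locales
  have "Z = (\<lambda>n. cls M N (z n))" using z(1) by auto
  then show ?thesis
    using alg_independent_z gen_eq_supercentre unfolding gen_def by simp
qed

end
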